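(* Let $\Omega\subset\mathbb{R}^2$ be a bounded domain with Lipschitz boundary, let $1<q<2$, and let $h\colon\mathbb{R}\to[0,+\infty]$ be such that: $h$ is convex and $C^1$ on $(0,+\infty)$; $\lim_{t\to0+}h(t)=+\infty$ and $\liminf_{t\to\infty}h(t)/t>0$; and $h(t)=+\infty$ for $t\le 0$. Let $W(A):=|A|^q+h(\det A)$ for $A\in\mathbb{R}^{2\times2}$ and $I(u):=\int_\Omega W(\nabla u(x))\,dx$. Let $\lambda>0$ satisfy $h'(\lambda^2)>0$ and $$\frac{1}{2^{3-q}\,h'(\lambda^2)\,\lambda^{2-q}}\ >\ (q-1)^{(q-1)/2}q^{-q/2}.$$ Then there is a constant $c=c(\Omega,\lambda,q)>0$ such that for every $u\in\mathcal{A}_\lambda$ $$\int_\Omega\min\{|\nabla u-\lambda\mathbf{1}|^2,\,|\nabla u-\lambda\mathbf{1}|^q\}\,dx\ \le\ c\,\delta(u),$$ where $\delta(u):=I(u)-I(u_\lambda)$. Moreover, for every $u\in\mathcal{A}_\lambda$, $$\lambda\,h'(\lambda^2)\int_\Omega\frac{2\lambda^2(\operatorname{curl}u)^2}{3\big((\operatorname{curl}u)^2+\max\{4\lambda^2,(\operatorname{div}u)^2\}\big)^{3/2}}\,dx\ \le\ \delta(u).$$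
   Context: $|A|=(\operatorname{tr}(A^TA))^{1/2}$; $\mathbf{1}$ is the identity matrix; $u_\lambda(x):=\lambda x$. The admissible class is $\mathcal{A}_\lambda:=\{u\in W^{1,q}(\Omega,\mathbb{R}^2): u=u_\lambda \text{ on }\partial\Omega \text{ (in the sense of traces)},\ \det\nabla u>0\text{ a.e. in }\Omega\}$. With $(\nabla u)_{ij}=\partial_ju_i$, $\operatorname{curl}u:=(\nabla u)_{12}-(\nabla u)_{21}$ and $\operatorname{div}u:=\operatorname{tr}\nabla u$. The function $h$ is fixed throughout. *)

theory Defs
  imports "HOL-Analysis.Analysis"
begin

type_synonym plane = "real ^ 2"
type_synonym mat2 = "real ^ 2 ^ 2"

text \<open>The library norm on matrices is the Frobenius norm.\<close>

lemma norm_matrix_eq_sqrt_trace: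
  fixes A :: mat2
  shows "norm A = sqrt (trace (transpose A ** A))"
  by (simp add: norm_vec_def L2_set_def trace_def transpose_def matrix_matrix_mult_def
      sum_2 power2_eq_square algebra_simps)

definition lipschitz_boundary :: "plane set \<Rightarrow> bool" where
  "lipschitz_boundary \<Omega> \<longleftrightarrow>
     (\<forall>p \<in> frontier \<Omega>. \<exists>r > 0. \<exists>R :: plane \<Rightarrow> plane. \<exists>\<gamma> :: real \<Rightarrow> real. \<exists>L.
        orthogonal_transformation R \<and> L-lipschitz_on UNIV \<gamma> \<and>
        \<Omega> \<inter> ball p r = {x \<in> ball p r. \<gamma> (R x $ 1) < R x $ 2})"

definition bounded_lipschitz_domain :: "plane set \<Rightarrow> bool" where
  "bounded_lipschitz_domain \<Omega> \<longleftrightarrow>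
     open \<Omega> \<and> connected \<Omega> \<and> \<Omega> \<noteq> {} \<and> bounded \<Omega> \<and> lipschitz_boundary \<Omega>"

definition partial :: "2 \<Rightarrow> (plane \<Rightarrow> real) \<Rightarrow> plane \<Rightarrow> real" where
  "partial j f x = frechet_derivative f (at x) (axis j 1)"

primrec Ck :: "nat \<Rightarrow> (plane \<Rightarrow> real) \<Rightarrow> bool" where
  "Ck 0 f \<longleftrightarrow> continuous_on UNIV f"
| "Ck (Suc k) f \<longleftrightarrow> (\<forall>x. f differentiable at x) \<and> (\<forall>j. Ck k (partial j f))"

definition smooth :: "(plane \<Rightarrow> real) \<Rightarrow> bool" where
  "smooth f \<longleftrightarrow> (\<forall>k. Ck k f)"

definition test_functions :: "plane set \<Rightarrow> (plane \<Rightarrow> real) set" where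
  "test_functions \<Omega> =
     {\<phi>. smooth \<phi> \<and> (\<exists>K. compact K \<and> K \<subseteq> \<Omega> \<and> (\<forall>x. x \<notin> K \<longrightarrow> \<phi> x = 0))}"

definition loc_integrable :: "plane set \<Rightarrow> (plane \<Rightarrow> 'b::euclidean_space) \<Rightarrow> bool" where
  "loc_integrable \<Omega> f \<longleftrightarrow> f \<in> borel_measurable (lebesgue_on \<Omega>) \<and>
     (\<forall>K. compact K \<and> K \<subseteq> \<Omega> \<longrightarrow> set_integrable lebesgue K f)"

definition Lq :: "plane set \<Rightarrow> real \<Rightarrow> (plane \<Rightarrow> 'b::euclidean_space) set" where
  "Lq \<Omega> q = {f. f \<in> borel_measurable (lebesgue_on \<Omega>) \<and>
     (\<integral>\<^sup>+ x\<in>\<Omega>. ennreal (norm (f x) powr q) \<partial>lebesgue) < \<infinity>}"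

definition has_weak_gradient :: "plane set \<Rightarrow> (plane \<Rightarrow> plane) \<Rightarrow> (plane \<Rightarrow> mat2) \<Rightarrow> bool" where
  "has_weak_gradient \<Omega> u G \<longleftrightarrow> loc_integrable \<Omega> u \<and> loc_integrable \<Omega> G \<and>
     (\<forall>\<phi> \<in> test_functions \<Omega>. \<forall>i j.
        (LINT x:\<Omega>|lebesgue. u x $ i * partial j \<phi> x) =
        - (LINT x:\<Omega>|lebesgue. G x $ i $ j * \<phi> x))"

text \<open>Weak gradients are unique up to null sets, so the choice below only selects a representative.\<close>

definition weak_gradient :: "plane set \<Rightarrow> (plane \<Rightarrow> plane) \<Rightarrow> plane \<Rightarrow> mat2" where
  "weak_gradient \<Omega> u = (SOME G. has_weak_gradient \<Omega> u G)"

definition sobolev_W1 :: "plane set \<Rightarrow> real \<Rightarrow> (plane \<Rightarrow> plane) set" where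
  "sobolev_W1 \<Omega> q = {u. u \<in> Lq \<Omega> q \<and> (\<exists>G. has_weak_gradient \<Omega> u G \<and> G \<in> Lq \<Omega> q)}"

text \<open>One-dimensional Hausdorff measure, which is the arc-length measure on a Lipschitz boundary.
  The outer measure below is a metric outer measure, hence countably additive on Borel sets.\<close>

definition hausdorff1_pre :: "real \<Rightarrow> plane set \<Rightarrow> ennreal" where
  "hausdorff1_pre \<delta> A =
     (INF C \<in> {C :: nat \<Rightarrow> plane set. A \<subseteq> (\<Union>i. C i) \<and>
                 (\<forall>i. bounded (C i) \<and> diameter (C i) \<le> \<delta>)}.
        (\<Sum>i. ennreal (diameter (C i))))"

definition hausdorff1_outer :: "plane set \<Rightarrow> ennreal" where
  "hausdorff1_outer A = (SUP \<delta> \<in> {0<..}. hausdorff1_pre \<delta> A)"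

definition hausdorff1 :: "plane measure" where
  "hausdorff1 = measure_of UNIV (sets borel) hausdorff1_outer"

text \<open>The trace operator is the continuous extension of \<open>v \<mapsto> v|\<partial>\<Omega>\<close> from functions smooth up to
  the boundary (which are dense) to an operator \<open>W\<^bsup>1,q\<^esup>(\<Omega>) \<rightarrow> L\<^bsup>q\<^esup>(\<partial>\<Omega>)\<close>; the following predicate
  is its graph.\<close>

definition has_trace ::
  "plane set \<Rightarrow> real \<Rightarrow> (plane \<Rightarrow> plane) \<Rightarrow> (plane \<Rightarrow> plane) \<Rightarrow> bool" where
  "has_trace \<Omega> q u g \<longleftrightarrow>
     g \<in> borel_measurable (restrict_space borel (frontier \<Omega>)) \<and>
     (\<exists>v :: nat \<Rightarrow> plane \<Rightarrow> plane.
        (\<forall>k i. smooth (\<lambda>x. v k x $ i)) \<and>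
        (\<lambda>k. \<integral>\<^sup>+ x\<in>\<Omega>. ennreal (norm (v k x - u x) powr q) \<partial>lebesgue) \<longlonglongrightarrow> 0 \<and>
        (\<lambda>k. \<integral>\<^sup>+ x\<in>\<Omega>. ennreal (norm (jacobian (v k) (at x) - weak_gradient \<Omega> u x) powr q)
               \<partial>lebesgue) \<longlonglongrightarrow> 0 \<and>
        (\<lambda>k. \<integral>\<^sup>+ x\<in>frontier \<Omega>. ennreal (norm (v k x - g x) powr q) \<partial>hausdorff1) \<longlonglongrightarrow> 0)"

definition u_lin :: "real \<Rightarrow> plane \<Rightarrow> plane" where
  "u_lin lam x = lam *\<^sub>R x"

definition admissible :: "plane set \<Rightarrow> real \<Rightarrow> real \<Rightarrow> (plane \<Rightarrow> plane) set" where
  "admissible \<Omega> q lam = {u \<in> sobolev_W1 \<Omega> q. has_trace \<Omega> q u (u_lin lam) \<and>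
     (AE x in lebesgue_on \<Omega>. det (weak_gradient \<Omega> u x) > 0)}"

definition curl :: "plane set \<Rightarrow> (plane \<Rightarrow> plane) \<Rightarrow> plane \<Rightarrow> real" where
  "curl \<Omega> u x = weak_gradient \<Omega> u x $ 1 $ 2 - weak_gradient \<Omega> u x $ 2 $ 1"

definition divergence :: "plane set \<Rightarrow> (plane \<Rightarrow> plane) \<Rightarrow> plane \<Rightarrow> real" where
  "divergence \<Omega> u x = trace (weak_gradient \<Omega> u x)"

definition C1_on_pos :: "(real \<Rightarrow> real) \<Rightarrow> bool" where
  "C1_on_pos f \<longleftrightarrow> f differentiable_on {0<..} \<and> continuous_on {0<..} (deriv f)"

text \<open>The functions \<open>h\<close> take values in \<open>[0,\<infinity>]\<close>; being \<open>C\<^sup>1\<close> on \<open>(0,\<infinity>)\<close> includes being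
  finite there, so that convexity and derivatives refer to \<open>enn2real \<circ> h\<close>.\<close>

definition admissible_h :: "(real \<Rightarrow> ennreal) \<Rightarrow> bool" where
  "admissible_h h \<longleftrightarrow>
     (\<forall>t > 0. h t < \<infinity>) \<and>
     convex_on {0<..} (enn2real \<circ> h) \<and> C1_on_pos (enn2real \<circ> h) \<and>
     (h \<longlongrightarrow> \<infinity>) (at_right 0) \<and>
     Liminf at_top (\<lambda>t. h t / ennreal t) > 0 \<and>
     (\<forall>t \<le> 0. h t = \<infinity>)"

definition stored_energy :: "real \<Rightarrow> (real \<Rightarrow> ennreal) \<Rightarrow> mat2 \<Rightarrow> ennreal" where
  "stored_energy q h A = ennreal (norm A powr q) + h (det A)"

definition energy ::
  "plane set \<Rightarrow> real \<Rightarrow> (real \<Rightarrow> ennreal) \<Rightarrow> (plane \<Rightarrow> plane) \<Rightarrow> ennreal" where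
  "energy \<Omega> q h u = (\<integral>\<^sup>+ x\<in>\<Omega>. stored_energy q h (weak_gradient \<Omega> u x) \<partial>lebesgue)"

definition excess ::
  "plane set \<Rightarrow> real \<Rightarrow> (real \<Rightarrow> ennreal) \<Rightarrow> real \<Rightarrow> (plane \<Rightarrow> plane) \<Rightarrow> ereal" where
  "excess \<Omega> q h lam u =
     enn2ereal (energy \<Omega> q h u) - enn2ereal (energy \<Omega> q h (u_lin lam))"

end

theory Submission
  imports Defs
begin

text \<open>
  By convexity of \<open>h\<close> it suffices to bound \<open>|A|\<^bsup>q\<^esup> + k det A\<close>, \<open>k = h'(\<lambda>\<^sup>2)\<close>, from below on
  \<open>{det A > 0}\<close> by an affine function of \<open>tr A\<close> plus the claimed remainder, because \<open>\<integral> \<nabla>u\<close> is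
  determined by the boundary values. In terms of the sum \<open>s = sqrt ((div u)\<^sup>2 + (curl u)\<^sup>2)\<close> and the
  squared difference \<open>D\<close> of the singular values the energy is concave in \<open>D \<in> [0, s\<^sup>2]\<close>, so the
  tangent in \<open>s\<close> at \<open>2\<lambda>\<close> need only be compared with it for \<open>D = 0\<close> (convexity) and \<open>D = s\<^sup>2\<close>. The
  hypothesis on \<open>\<lambda>\<close> enters in the latter case through \<open>k \<lambda> (s - \<lambda>) \<le> 2\<^bsup>q-3\<^esup> s\<^bsup>q\<^esup>\<close>, which leaves the
  multiple \<open>1 - 2\<^bsup>q-3\<^esup>\<close> of \<open>s\<^bsup>q\<^esup>\<close> to dominate the rest of the tangent. The gap \<open>s - div u\<close> yields the
  curl estimate.

  The identity \<open>\<integral> \<nabla>u = \<lambda>|\<Omega>| 1\<close> follows from \<open>|\<integral>\<^sub>\<Omega> \<partial>\<^sub>j w| \<le> 2 \<integral>\<^bsub>\<partial>\<Omega>\<^esub> |w| dH\<^sup>1\<close> for \<open>C\<^sup>1\<close> functions \<open>w\<close>,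
  which holds for every bounded open set: on each line parallel to the \<open>j\<close>-axis the integral is a sum
  of boundary values over the endpoints of countably many intervals, and these sums are integrated by
  the Eilenberg inequality. Lipschitz regularity only enters through \<open>H\<^sup>1(\<partial>\<Omega>) < \<infinity>\<close>.
\<close>

subsection \<open>One-dimensional Hausdorff measure\<close>

lemma suminf_offset_tendsto_0_ennreal:
  fixes f :: "nat \<Rightarrow> ennreal"
  assumes "(\<Sum>n. f n) \<noteq> \<infinity>"
  shows "(\<lambda>N. \<Sum>n. f (n + N)) \<longlonglongrightarrow> 0"
proof -
  have split: "(\<Sum>n. f n) = (\<Sum>n. f (n + N)) + (\<Sum>n<N. f n)" for N
    by (rule suminf_offset) auto
  then have "(\<Sum>n<N. f n) \<noteq> \<infinity>" for N using assms by (metis ennreal_add_eq_top infinity_ennreal_def)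
  then have "(\<Sum>n. f (n + N)) = (\<Sum>n. f n) - (\<Sum>n<N. f n)" for N
    by (subst split[of N]) simp
  moreover have "(\<lambda>N. (\<Sum>n. f n) - (\<Sum>n<N. f n)) \<longlonglongrightarrow> (\<Sum>n. f n) - (\<Sum>n. f n)"
    using assms by (intro tendsto_diff_ennreal tendsto_const summable_LIMSEQ) auto
  ultimately show ?thesis using assms by simp
qed

locale metric_outer_measure =
  fixes \<mu> :: "'a :: metric_space set \<Rightarrow> ennreal"
  assumes empty: "\<mu> {} = 0"
    and mono: "A \<subseteq> B \<Longrightarrow> \<mu> A \<le> \<mu> B"
    and countably_subadditive: "\<mu> (\<Union>i :: nat. C i) \<le> (\<Sum>i. \<mu> (C i))"
    and separated_superadditive:
      "0 < d \<Longrightarrow> (\<And>a b. a \<in> A \<Longrightarrow> b \<in> B \<Longrightarrow> d \<le> dist a b) \<Longrightarrow> \<mu> A + \<mu> B \<le> \<mu> (A \<union> B)"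
begin

lemma subadditive: "\<mu> (A \<union> B) \<le> \<mu> A + \<mu> B"
  using countably_subadditive[of "binaryset A B"] empty
  by (simp add: UN_binaryset_eq suminf_binaryset_eq)

lemma sum_alternate_increments_le:
  assumes P: "incseq P"
    and separated: "\<And>n. \<exists>d>0. \<forall>a\<in>P n. \<forall>b\<in>(\<Union>n. P n) - P (Suc n). d \<le> dist a b"
  shows "(\<Sum>k<K. \<mu> (P (Suc (2 * k + p)) - P (2 * k + p))) \<le> (SUP n. \<mu> (P n))"
proof -
  define D where "D k = P (Suc (2 * k + p)) - P (2 * k + p)" for k
  have D_subset: "(\<Union>k<K. D k) \<subseteq> P (2 * K + p - 1)" for K
  proof
    fix x assume "x \<in> (\<Union>k<K. D k)"
    then obtain k where "k < K" "x \<in> P (Suc (2 * k + p))" by (auto simp: D_def)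
    moreover have "Suc (2 * k + p) \<le> 2 * K + p - 1" using \<open>k < K\<close> by linarith
    ultimately show "x \<in> P (2 * K + p - 1)" using incseqD[OF P] by blast
  qed
  have "(\<Sum>k<K. \<mu> (D k)) \<le> \<mu> (\<Union>k<K. D k)"
  proof (induction K)
    case (Suc K)
    show ?case
    proof (cases "K = 0")
      case False
      then have "Suc (2 * K + p - 1) = 2 * K + p" by simp
      then obtain d where d: "0 < d"
          "\<And>a b. a \<in> P (2 * K + p - 1) \<Longrightarrow> b \<in> (\<Union>n. P n) - P (2 * K + p) \<Longrightarrow> d \<le> dist a b"
        using separated[of "2 * K + p - 1"] by auto
      have "(\<Sum>k<Suc K. \<mu> (D k)) \<le> \<mu> (\<Union>k<K. D k) + \<mu> (D K)"
        using Suc.IH by (simp add: add_right_mono)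
      also have "\<dots> \<le> \<mu> ((\<Union>k<K. D k) \<union> D K)"
      proof (rule separated_superadditive[OF d(1)])
        fix a b assume "a \<in> (\<Union>k<K. D k)" "b \<in> D K"
        then show "d \<le> dist a b" using D_subset[of K] by (intro d(2)) (auto simp: D_def)
      qed
      also have "(\<Union>k<K. D k) \<union> D K = (\<Union>k<Suc K. D k)" by (auto simp: lessThan_Suc)
      finally show ?thesis .
    qed (simp add: lessThan_Suc)
  qed (simp add: empty)
  also have "\<dots> \<le> \<mu> (P (2 * K + p - 1))" by (rule mono[OF D_subset])
  also have "\<dots> \<le> (SUP n. \<mu> (P n))" by (rule SUP_upper) simp
  finally show ?thesis by (simp add: D_def)
qed

lemma UN_le_SUP_if_increments_separated:
  assumes P: "incseq P"
    and separated: "\<And>n. \<exists>d>0. \<forall>a\<in>P n. \<forall>b\<in>(\<Union>n. P n) - P (Suc n). d \<le> dist a b"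
  shows "\<mu> (\<Union>n. P n) \<le> (SUP n. \<mu> (P n))"
proof (cases "(SUP n. \<mu> (P n)) = \<infinity>")
  case False
  define S where "S = (SUP n. \<mu> (P n))"
  define f where "f n = \<mu> (P (Suc n) - P n)" for n
  have "(\<Sum>n<m. f n) \<le> 2 * S" for m
  proof -
    have "(\<Sum>n<m. f n) \<le> (\<Sum>n<2 * m. f n)" by (rule sum_mono2) auto
    also have "\<dots> = (\<Sum>k<m. f (2 * k + 0)) + (\<Sum>k<m. f (2 * k + 1))"
      by (induction m) (auto simp: algebra_simps)
    also have "\<dots> \<le> S + S"
      unfolding f_def S_def by (intro add_mono sum_alternate_increments_le P separated)
    finally show ?thesis by (simp add: mult_2)
  qed
  then have "(\<Sum>n. f n) \<le> 2 * S" unfolding suminf_eq_SUP by (intro SUP_least)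
  also have "\<dots> < \<infinity>"
    using False unfolding S_def[symmetric] by (simp add: ennreal_mult_eq_top_iff flip: less_top)
  finally have "(\<lambda>N. \<Sum>n. f (n + N)) \<longlonglongrightarrow> 0" by (intro suminf_offset_tendsto_0_ennreal) simp
  then have limit: "(\<lambda>N. S + (\<Sum>n. f (n + N))) \<longlonglongrightarrow> S + 0" by (intro tendsto_intros)
  have "\<mu> (\<Union>n. P n) \<le> S + (\<Sum>n. f (n + N))" for N
  proof -
    have "P m \<subseteq> P N \<union> (\<Union>n. P (Suc (n + N)) - P (n + N))" for m
    proof (induction m)
      case (Suc m)
      show ?case
      proof (cases "Suc m \<le> N")
        case False
        then have "P (Suc m) - P m = P (Suc ((m - N) + N)) - P ((m - N) + N)" by simp
        then show ?thesis using Suc.IH by blast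
      qed (use incseqD[OF P] in blast)
    qed (use incseqD[OF P, of 0 N] in auto)
    then have "\<mu> (\<Union>n. P n) \<le> \<mu> (P N \<union> (\<Union>n. P (Suc (n + N)) - P (n + N)))" by (intro mono) blast
    also have "\<dots> \<le> \<mu> (P N) + \<mu> (\<Union>n. P (Suc (n + N)) - P (n + N))" by (rule subadditive)
    also have "\<dots> \<le> S + (\<Sum>n. f (n + N))"
      unfolding S_def f_def by (intro add_mono SUP_upper countably_subadditive) auto
    finally show ?thesis .
  qed
  then show ?thesis using tendsto_lowerbound[OF limit] by (simp add: S_def)
next
  case True
  show ?thesis unfolding True by simp
qed

lemma diff_closed_le_SUP_infdist:
  assumes F: "closed F" "F \<noteq> {}"
  shows "\<mu> (X - F) \<le> (SUP n. \<mu> {x \<in> X. inverse (real (Suc n)) \<le> infdist x F})"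
proof -
  define r where "r n = inverse (real (Suc n))" for n
  define P where "P n = {x \<in> X. r n \<le> infdist x F}" for n
  have r: "0 < r n" "r (Suc n) < r n" for n by (auto simp: r_def)
  have P: "incseq P"
  proof (rule incseq_SucI)
    show "P n \<subseteq> P (Suc n)" for n using r(2)[of n] by (auto simp: P_def)
  qed
  have P_Un: "(\<Union>n. P n) = X - F"
  proof
    show "(\<Union>n. P n) \<subseteq> X - F"
    proof
      fix x assume "x \<in> (\<Union>n. P n)"
      then obtain n where "x \<in> X" "r n \<le> infdist x F" by (auto simp: P_def)
      then show "x \<in> X - F" using r(1)[of n] by auto
    qed
    show "X - F \<subseteq> (\<Union>n. P n)"
    proof
      fix x assume x: "x \<in> X - F"
      then have "0 < infdist x F"
        using in_closed_iff_infdist_zero[OF F, of x] infdist_nonneg[of x F] by fastforce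
      then obtain n where "r n < infdist x F" unfolding r_def using reals_Archimedean by blast
      then show "x \<in> (\<Union>n. P n)" using x by (auto simp: P_def intro!: exI[of _ n])
    qed
  qed
  have "\<exists>d>0. \<forall>a\<in>P n. \<forall>b\<in>(\<Union>n. P n) - P (Suc n). d \<le> dist a b" for n
  proof (intro exI conjI ballI)
    show "0 < r n - r (Suc n)" using r(2)[of n] by simp
    fix a b assume "a \<in> P n" "b \<in> (\<Union>n. P n) - P (Suc n)"
    then have "r n \<le> infdist a F" "infdist b F < r (Suc n)" by (auto simp: P_Un P_def not_le)
    then show "r n - r (Suc n) \<le> dist a b" using infdist_triangle[of a F b] by linarith
  qed
  then have "\<mu> (X - F) \<le> (SUP n. \<mu> (P n))"
    using UN_le_SUP_if_increments_separated[OF P] by (simp only: P_Un)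
  then show ?thesis by (simp only: P_def r_def)
qed

lemma closed_splits:
  assumes F: "closed F"
  shows "\<mu> (X \<inter> F) + \<mu> (X - F) \<le> \<mu> X"
proof (cases "F = {}")
  case False
  define P where "P n = {x \<in> X. inverse (real (Suc n)) \<le> infdist x F}" for n
  have "\<mu> (X \<inter> F) + \<mu> (X - F) \<le> (SUP n. \<mu> (X \<inter> F) + \<mu> (P n))"
    using diff_closed_le_SUP_infdist[OF F False, of X] unfolding P_def
    by (subst ennreal_SUP_add_right[symmetric]) (auto intro: add_left_mono)
  also have "\<dots> \<le> \<mu> X"
  proof (rule SUP_least)
    fix n
    have "\<mu> (X \<inter> F) + \<mu> (P n) \<le> \<mu> ((X \<inter> F) \<union> P n)"
    proof (rule separated_superadditive)
      fix a b assume "a \<in> X \<inter> F" "b \<in> P n"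
      then show "inverse (real (Suc n)) \<le> dist a b"
        using infdist_le[of a F b] by (auto simp: P_def dist_commute)
    qed simp
    also have "\<dots> \<le> \<mu> X" by (rule mono) (auto simp: P_def)
    finally show "\<mu> (X \<inter> F) + \<mu> (P n) \<le> \<mu> X" .
  qed
  finally show ?thesis .
qed (simp add: empty)

lemma measure_space_borel: "measure_space UNIV (sets borel) \<mu>"
proof -
  interpret P: sigma_algebra UNIV "Pow UNIV :: 'a set set" by (rule sigma_algebra_Pow)
  define L where "L = lambda_system UNIV (Pow UNIV) \<mu>"
  have "outer_measure_space (Pow UNIV) \<mu>"
    unfolding outer_measure_space_def positive_def increasing_def countably_subadditive_def
    using empty mono countably_subadditive by auto
  then have L: "measure_space UNIV L \<mu>" unfolding L_def by (rule P.caratheodory_lemma)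
  then interpret L: sigma_algebra UNIV L by (simp add: measure_space_def)
  have "F \<in> L" if "closed F" for F
  proof -
    have "\<mu> (X \<inter> F) + \<mu> (X - F) = \<mu> X" for X
    proof (rule antisym)
      have "X = (X \<inter> F) \<union> (X - F)" by blast
      then show "\<mu> X \<le> \<mu> (X \<inter> F) + \<mu> (X - F)" using subadditive by metis
    qed (rule closed_splits[OF that])
    then show ?thesis unfolding L_def P.lambda_system_eq by simp
  qed
  then have "sets borel \<subseteq> L"
    unfolding borel_eq_closed using L.sigma_sets_subset[of "Collect closed"] by auto
  moreover have "sigma_algebra UNIV (sets (borel :: 'a measure))"
    using sets.sigma_algebra_axioms[of "borel :: 'a measure"] by simp
  ultimately show ?thesis using measure_down[OF L] by blast
qed

end

lemma hausdorff1_pre_le: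
  assumes "A \<subseteq> (\<Union>i. C i)" "\<And>i. bounded (C i)" "\<And>i. diameter (C i) \<le> \<delta>"
  shows "hausdorff1_pre \<delta> A \<le> (\<Sum>i. ennreal (diameter (C i)))"
  unfolding hausdorff1_pre_def using assms by (intro INF_lower) auto

lemma hausdorff1_pre_antimono: "\<delta> \<le> \<delta>' \<Longrightarrow> hausdorff1_pre \<delta>' A \<le> hausdorff1_pre \<delta> A"
  unfolding hausdorff1_pre_def by (intro INF_superset_mono) (auto intro: order_trans)

lemma hausdorff1_pre_empty: "0 \<le> \<delta> \<Longrightarrow> hausdorff1_pre \<delta> {} = 0"
  using hausdorff1_pre_le[of "{}" "\<lambda>_. {}" \<delta>] by simp

lemma hausdorff1_pre_mono: "A \<subseteq> B \<Longrightarrow> hausdorff1_pre \<delta> A \<le> hausdorff1_pre \<delta> B"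
  unfolding hausdorff1_pre_def by (intro INF_superset_mono) auto

lemma hausdorff1_pre_coverE:
  assumes "hausdorff1_pre \<delta> A \<noteq> \<infinity>" "0 < e"
  obtains C :: "nat \<Rightarrow> plane set" where "A \<subseteq> (\<Union>i. C i)" "\<And>i. bounded (C i)"
    "\<And>i. diameter (C i) \<le> \<delta>" "(\<Sum>i. ennreal (diameter (C i))) \<le> hausdorff1_pre \<delta> A + ennreal e"
  using INF_approx_ennreal[OF assms(2) hausdorff1_pre_def assms(1)] by auto

lemma hausdorff1_pre_countably_subadditive:
  "hausdorff1_pre \<delta> (\<Union>n. A n) \<le> (\<Sum>n. hausdorff1_pre \<delta> (A n))" for A :: "nat \<Rightarrow> plane set"
proof (rule ennreal_le_epsilon)
  fix e :: real assume finite: "(\<Sum>n. hausdorff1_pre \<delta> (A n)) < top" and e: "0 < e"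
  define e' where "e' n = e * (1 / 2) ^ Suc n" for n
  have e': "0 < e' n" for n using e by (simp add: e'_def)
  have "hausdorff1_pre \<delta> (A n) \<noteq> \<infinity>" for n
    using ennreal_suminf_lessD[OF finite, of n] by simp
  then have "\<exists>C. A n \<subseteq> (\<Union>i. C i) \<and> (\<forall>i. bounded (C i)) \<and> (\<forall>i. diameter (C i) \<le> \<delta>) \<and>
      (\<Sum>i. ennreal (diameter (C i))) \<le> hausdorff1_pre \<delta> (A n) + ennreal (e' n)" for n
    by (rule hausdorff1_pre_coverE[OF _ e']) blast
  then obtain C where C: "\<And>n. A n \<subseteq> (\<Union>i. C n i)" "\<And>n i. bounded (C n i)" "\<And>n i. diameter (C n i) \<le> \<delta>"
      "\<And>n. (\<Sum>i. ennreal (diameter (C n i))) \<le> hausdorff1_pre \<delta> (A n) + ennreal (e' n)"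
    by metis
  define E where "E = (\<lambda>(n, i). C n i)"
  have "(\<Union>n. A n) \<subseteq> (\<Union>k. E (prod_decode k))"
  proof
    fix x assume "x \<in> (\<Union>n. A n)"
    then obtain n i where "x \<in> C n i" using C(1) by blast
    then have "x \<in> E (prod_decode (prod_encode (n, i)))" by (simp add: E_def)
    then show "x \<in> (\<Union>k. E (prod_decode k))" by blast
  qed
  then have "hausdorff1_pre \<delta> (\<Union>n. A n) \<le> (\<Sum>k. ennreal (diameter (E (prod_decode k))))"
    by (rule hausdorff1_pre_le) (auto simp: E_def C split: prod.split)
  also have "\<dots> = (\<Sum>n. \<Sum>i. ennreal (diameter (C n i)))"
    using suminf_ennreal_2dimen[of "\<lambda>n. \<Sum>i. ennreal (diameter (C n i))" "\<lambda>p. ennreal (diameter (E p))"]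
    by (simp add: E_def)
  also have "\<dots> \<le> (\<Sum>n. hausdorff1_pre \<delta> (A n) + ennreal (e' n))"
    by (intro suminf_le C) auto
  also have "\<dots> = (\<Sum>n. hausdorff1_pre \<delta> (A n)) + (\<Sum>n. ennreal (e' n))"
    by (intro suminf_add[symmetric]) auto
  also have "(\<Sum>n. ennreal (e' n)) = ennreal e"
    using sums_mult[OF power_half_series, of e] e' unfolding e'_def
    by (intro suminf_ennreal_eq) (auto intro: less_imp_le)
  finally show "hausdorff1_pre \<delta> (\<Union>n. A n) \<le> (\<Sum>n. hausdorff1_pre \<delta> (A n)) + ennreal e" .
qed

lemma hausdorff1_pre_separated:
  assumes sep: "\<And>a b. a \<in> A \<Longrightarrow> b \<in> B \<Longrightarrow> \<delta> < dist a b" and \<delta>: "0 \<le> \<delta>"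
  shows "hausdorff1_pre \<delta> A + hausdorff1_pre \<delta> B \<le> hausdorff1_pre \<delta> (A \<union> B)"
  unfolding hausdorff1_pre_def[of \<delta> "A \<union> B"]
proof (rule INF_greatest, clarify)
  fix C :: "nat \<Rightarrow> plane set"
  assume C: "A \<union> B \<subseteq> (\<Union>i. C i)" "\<forall>i. bounded (C i) \<and> diameter (C i) \<le> \<delta>"
  define CA where "CA i = (if C i \<inter> A = {} then {} else C i)" for i
  define CB where "CB i = (if C i \<inter> A = {} then C i else {})" for i
  have disjoint: "C i \<inter> B = {}" if "C i \<inter> A \<noteq> {}" for i
  proof (rule ccontr)
    assume "C i \<inter> B \<noteq> {}"
    then obtain a b where ab: "a \<in> A" "a \<in> C i" "b \<in> B" "b \<in> C i" using \<open>C i \<inter> A \<noteq> {}\<close> by blast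
    then have "dist a b \<le> diameter (C i)" using C(2) by (intro diameter_bounded_bound) auto
    then show False using sep[of a b] ab C(2) by (meson less_le_trans not_less order_trans)
  qed
  have "hausdorff1_pre \<delta> A + hausdorff1_pre \<delta> B
      \<le> (\<Sum>i. ennreal (diameter (CA i))) + (\<Sum>i. ennreal (diameter (CB i)))"
  proof (intro add_mono hausdorff1_pre_le)
    show "A \<subseteq> (\<Union>i. CA i)" using C(1) by (auto simp: CA_def) blast
    show "B \<subseteq> (\<Union>i. CB i)" using C(1) disjoint by (auto simp: CB_def) blast
  qed (use C(2) \<delta> in \<open>auto simp: CA_def CB_def\<close>)
  also have "\<dots> = (\<Sum>i. ennreal (diameter (CA i)) + ennreal (diameter (CB i)))"
    by (intro suminf_add) auto
  also have "\<dots> = (\<Sum>i. ennreal (diameter (C i)))"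
    by (intro suminf_cong) (auto simp: CA_def CB_def)
  finally show "hausdorff1_pre \<delta> A + hausdorff1_pre \<delta> B \<le> (\<Sum>i. ennreal (diameter (C i)))" .
qed

lemma hausdorff1_pre_le_outer: "0 < \<delta> \<Longrightarrow> hausdorff1_pre \<delta> A \<le> hausdorff1_outer A"
  unfolding hausdorff1_outer_def by (intro SUP_upper) auto

lemma metric_outer_measure_hausdorff1_outer: "metric_outer_measure hausdorff1_outer"
proof
  show "hausdorff1_outer {} = 0"
    by (simp add: hausdorff1_outer_def hausdorff1_pre_empty)
  show "hausdorff1_outer A \<le> hausdorff1_outer B" if "A \<subseteq> B" for A B
    unfolding hausdorff1_outer_def by (intro SUP_mono' hausdorff1_pre_mono that)
  show "hausdorff1_outer (\<Union>i. C i) \<le> (\<Sum>i. hausdorff1_outer (C i))" for C :: "nat \<Rightarrow> plane set"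
    unfolding hausdorff1_outer_def[of "\<Union>i. C i"]
  proof (rule SUP_least)
    fix \<delta> :: real assume "\<delta> \<in> {0<..}"
    then show "hausdorff1_pre \<delta> (\<Union>i. C i) \<le> (\<Sum>i. hausdorff1_outer (C i))"
      by (intro order.trans[OF hausdorff1_pre_countably_subadditive] suminf_le hausdorff1_pre_le_outer) auto
  qed
  fix A B :: "plane set" and d :: real
  assume d: "0 < d" and sep: "\<And>a b. a \<in> A \<Longrightarrow> b \<in> B \<Longrightarrow> d \<le> dist a b"
  have "hausdorff1_outer A + hausdorff1_outer B
      = (SUP \<delta>\<in>{0<..}. hausdorff1_pre \<delta> A + hausdorff1_pre \<delta> B)"
    unfolding hausdorff1_outer_def
  proof (rule SUP_add_directed_ennreal[symmetric])
    fix \<delta> \<epsilon> :: real assume "\<delta> \<in> {0<..}" "\<epsilon> \<in> {0<..}"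
    then show "\<exists>\<eta>\<in>{0<..}. hausdorff1_pre \<delta> A + hausdorff1_pre \<epsilon> B
        \<le> hausdorff1_pre \<eta> A + hausdorff1_pre \<eta> B"
      by (intro bexI[of _ "min \<delta> \<epsilon>"] add_mono hausdorff1_pre_antimono) auto
  qed
  also have "\<dots> \<le> hausdorff1_outer (A \<union> B)"
  proof (rule SUP_least)
    fix \<delta> :: real assume "\<delta> \<in> {0<..}"
    define \<eta> where "\<eta> = min \<delta> (d / 2)"
    have \<eta>: "0 < \<eta>" "\<eta> \<le> \<delta>" "\<eta> < d" using \<open>\<delta> \<in> {0<..}\<close> d by (auto simp: \<eta>_def)
    have "hausdorff1_pre \<delta> A + hausdorff1_pre \<delta> B \<le> hausdorff1_pre \<eta> A + hausdorff1_pre \<eta> B"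
      using \<eta> by (intro add_mono hausdorff1_pre_antimono)
    also have "\<dots> \<le> hausdorff1_pre \<eta> (A \<union> B)"
      using \<eta> sep by (intro hausdorff1_pre_separated) (auto intro: less_le_trans)
    also have "\<dots> \<le> hausdorff1_outer (A \<union> B)" using \<eta> by (intro hausdorff1_pre_le_outer)
    finally show "hausdorff1_pre \<delta> A + hausdorff1_pre \<delta> B \<le> hausdorff1_outer (A \<union> B)" .
  qed
  finally show "hausdorff1_outer A + hausdorff1_outer B \<le> hausdorff1_outer (A \<union> B)" .
qed

lemmas hausdorff1_outer_mono = metric_outer_measure.mono[OF metric_outer_measure_hausdorff1_outer]

lemma sets_hausdorff1 [measurable_cong, simp]: "sets hausdorff1 = sets borel"
  unfolding hausdorff1_def using sets.sigma_sets_eq[of "borel :: plane measure"] by simp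

lemma emeasure_hausdorff1: "A \<in> sets borel \<Longrightarrow> emeasure hausdorff1 A = hausdorff1_outer A"
  unfolding hausdorff1_def
  using metric_outer_measure.measure_space_borel[OF metric_outer_measure_hausdorff1_outer]
  by (intro emeasure_measure_of_sigma) (auto simp: measure_space_def)

lemma emeasure_lborel_le_diameter:
  fixes S :: "real set"
  assumes "bounded S"
  shows "emeasure lborel S \<le> ennreal (diameter S)"
proof (cases "S = {}")
  case False
  have bdd: "bdd_below S" "bdd_above S"
    using assms by (auto intro: bounded_imp_bdd_below bounded_imp_bdd_above)
  have "Sup S \<le> Inf S + diameter S"
  proof (rule cSup_least[OF False])
    fix x assume x: "x \<in> S"
    have "x - diameter S \<le> Inf S"
      using diameter_bounded_bound[OF assms x]
      by (intro cInf_greatest False) (fastforce simp: dist_real_def)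
    then show "x \<le> Inf S + diameter S" by linarith
  qed
  then have "Sup S - Inf S \<le> diameter S" by simp
  have "S \<subseteq> {Inf S..Sup S}" using bdd by (auto intro: cInf_lower cSup_upper)
  then have "emeasure lborel S \<le> emeasure lborel {Inf S..Sup S}" by (intro emeasure_mono) auto
  also have "\<dots> = ennreal (Sup S - Inf S)" using bdd False by (simp add: cInf_le_cSup)
  also have "\<dots> \<le> ennreal (diameter S)"
    using \<open>Sup S - Inf S \<le> diameter S\<close> by (rule ennreal_leI)
  finally show ?thesis .
qed simp

lemma emeasure_lipschitz_image_le_hausdorff1:
  fixes f :: "plane \<Rightarrow> real"
  assumes f: "1-lipschitz_on UNIV f"
  shows "emeasure lborel (f ` A) \<le> hausdorff1_outer A"
proof -
  have "emeasure lborel (f ` A) \<le> hausdorff1_pre 1 A"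
    unfolding hausdorff1_pre_def
  proof (rule INF_greatest, clarify)
    fix C :: "nat \<Rightarrow> plane set"
    assume A: "A \<subseteq> (\<Union>i. C i)" and C: "\<forall>i. bounded (C i) \<and> diameter (C i) \<le> 1"
    have image: "bounded (f ` C i)" "diameter (f ` C i) \<le> diameter (C i)" for i
    proof -
      have "dist (f x) (f y) \<le> diameter (C i)" if "x \<in> C i" "y \<in> C i" for x y
        using lipschitz_onD[OF f, of x y] diameter_bounded_bound[of "C i" x y] C that by auto
      moreover have "0 \<le> diameter (C i)" using C by (simp add: diameter_ge_0)
      ultimately show "bounded (f ` C i)" "diameter (f ` C i) \<le> diameter (C i)"
        by (auto simp: bounded_two_points dist_norm intro!: diameter_le)
    qed
    define I where "I i = closure (f ` C i)" for i
    have "f ` A \<subseteq> (\<Union>i. f ` C i)" using A by blast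
    also have "\<dots> \<subseteq> (\<Union>i. I i)" unfolding I_def by (intro UN_mono closure_subset) simp
    finally have "emeasure lborel (f ` A) \<le> emeasure lborel (\<Union>i. I i)"
      by (intro emeasure_mono) (auto simp: I_def)
    also have "\<dots> \<le> (\<Sum>i. emeasure lborel (I i))"
      by (intro emeasure_subadditive_countably) (auto simp: I_def)
    also have "\<dots> \<le> (\<Sum>i. ennreal (diameter (C i)))"
    proof (rule suminf_le)
      fix i
      have "emeasure lborel (I i) \<le> ennreal (diameter (f ` C i))"
        using emeasure_lborel_le_diameter[OF bounded_closure, OF image(1)[of i]]
        by (simp add: I_def diameter_closure image(1))
      then show "emeasure lborel (I i) \<le> ennreal (diameter (C i))"
        using image(2) by (auto intro: order_trans ennreal_leI)
    qed auto
    finally show "emeasure lborel (f ` A) \<le> (\<Sum>i. ennreal (diameter (C i)))" .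
  qed
  also have "\<dots> \<le> hausdorff1_outer A" by (rule hausdorff1_pre_le_outer) simp
  finally show ?thesis .
qed

lemma half_open_interval_subset_cells:
  fixes h :: real
  assumes "0 < h"
  shows "{a..<b} \<subseteq> (\<Union>i. {a + real i * h..a + real (Suc i) * h})"
proof
  fix t assume t: "t \<in> {a..<b}"
  define i where "i = nat \<lfloor>(t - a) / h\<rfloor>"
  have "real i = of_int \<lfloor>(t - a) / h\<rfloor>" using t assms by (simp add: i_def)
  then have "real i \<le> (t - a) / h" "(t - a) / h \<le> real (Suc i)" by linarith+
  then have "t \<in> {a + real i * h..a + real (Suc i) * h}" using assms by (simp add: field_simps)
  then show "t \<in> (\<Union>i. {a + real i * h..a + real (Suc i) * h})" by blast
qed

lemma hausdorff1_pre_lipschitz_image: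
  fixes f :: "real \<Rightarrow> plane"
  assumes f: "L-lipschitz_on {a..<b} f" and ab: "a < b"
    and N: "0 < N" "L * (b - a) / real N \<le> \<delta>"
  shows "hausdorff1_pre \<delta> (f ` {a..<b}) \<le> ennreal (L * (b - a))"
proof -
  have L: "0 \<le> L" using f by (rule lipschitz_on_nonneg)
  define h where "h = (b - a) / real N"
  have h: "0 < h" "real N * h = b - a" using ab N by (auto simp: h_def)
  define C where "C i = f ` ({a..<b} \<inter> {a + real i * h..a + real (Suc i) * h})" for i
  have dist_C: "dist x y \<le> L * h" if xy: "x \<in> C i" "y \<in> C i" for x y i
  proof -
    obtain s t where st: "x = f s" "y = f t" "s \<in> {a..<b}" "t \<in> {a..<b}"
        "s \<in> {a + real i * h..a + real (Suc i) * h}" "t \<in> {a + real i * h..a + real (Suc i) * h}"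
      using xy unfolding C_def by blast
    then have "dist s t \<le> h" by (simp add: dist_real_def abs_le_iff algebra_simps)
    then have "L * dist s t \<le> L * h" using L by (rule mult_left_mono)
    then show ?thesis using lipschitz_onD[OF f st(3,4)] by (simp add: st(1,2))
  qed
  have C_empty: "C i = {}" if "N \<le> i" for i
  proof -
    have "b - a \<le> real i * h" using mult_right_mono[of "real N" "real i" h] that h by simp
    then show ?thesis by (auto simp: C_def)
  qed
  have diameter_C: "diameter (C i) \<le> L * h" for i
    using dist_C L h by (intro diameter_le) (auto simp: dist_norm)
  have "f ` {a..<b} \<subseteq> (\<Union>i. C i)"
    using half_open_interval_subset_cells[OF h(1), of a b] unfolding C_def by blast
  then have "hausdorff1_pre \<delta> (f ` {a..<b}) \<le> (\<Sum>i. ennreal (diameter (C i)))"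
  proof (rule hausdorff1_pre_le)
    show "bounded (C i)" for i unfolding bounded_two_points using dist_C by blast
    show "diameter (C i) \<le> \<delta>" for i using diameter_C[of i] N by (simp add: h_def)
  qed
  also have "\<dots> = (\<Sum>i<N. ennreal (diameter (C i)))"
    by (rule suminf_finite) (auto simp: C_empty not_less)
  also have "\<dots> \<le> (\<Sum>i<N. ennreal (L * h))" using diameter_C by (intro sum_mono ennreal_leI)
  also have "\<dots> = ennreal (L * (b - a))"
    using L h by (simp add: ennreal_of_nat_eq_real_of_nat mult.left_commute flip: ennreal_mult')
  finally show ?thesis .
qed

lemma hausdorff1_outer_lipschitz_image:
  fixes f :: "real \<Rightarrow> plane"
  assumes f: "L-lipschitz_on {a..<b} f" and ab: "a < b"
  shows "hausdorff1_outer (f ` {a..<b}) \<le> ennreal (L * (b - a))"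
  unfolding hausdorff1_outer_def
proof (rule SUP_least)
  fix \<delta> :: real assume "\<delta> \<in> {0<..}"
  then have \<delta>: "0 < \<delta>" by simp
  obtain N :: nat where "L * (b - a) / \<delta> < real N" using reals_Archimedean2 by blast
  then have "L * (b - a) \<le> \<delta> * real (Suc N)" using \<delta> by (simp add: divide_less_eq algebra_simps)
  then have "L * (b - a) / real (Suc N) \<le> \<delta>" by (simp add: divide_le_eq)
  then show "hausdorff1_pre \<delta> (f ` {a..<b}) \<le> ennreal (L * (b - a))"
    by (intro hausdorff1_pre_lipschitz_image[OF f ab]) auto
qed

subsection \<open>The Eilenberg inequality\<close>

lemma continuous_image_compact_Int_open_borel:
  fixes f :: "'a :: euclidean_space \<Rightarrow> 'b :: t2_space"
  assumes K: "compact K" and V: "open V" and f: "continuous_on UNIV f"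
  shows "f ` (K \<inter> V) \<in> sets borel"
proof -
  obtain D :: "nat \<Rightarrow> 'a set" where D: "\<And>n. compact (D n)" "\<Union>(range D) = V"
    using open_Union_compact_subsets[OF V] by metis
  have "f ` (K \<inter> V) = (\<Union>n. f ` (K \<inter> D n))" using D(2) by blast
  moreover have "closed (f ` (K \<inter> D n))" for n
    using K D
    by (intro compact_imp_closed compact_continuous_image compact_Int continuous_on_subset[OF f]) auto
  ultimately show ?thesis by (simp add: sets.countable_UN')
qed

definition fine_cover :: "'a :: metric_space set \<Rightarrow> real \<Rightarrow> nat \<Rightarrow> (nat \<Rightarrow> 'a set) \<Rightarrow> bool" where
  "fine_cover E \<delta> N A \<longleftrightarrow> (\<Union>k<N. A k) = E \<and> (\<forall>k. \<forall>x\<in>A k. \<forall>y\<in>A k. dist x y < \<delta>)"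

lemma fine_cover_mono: "fine_cover E \<delta> N A \<Longrightarrow> \<delta> \<le> \<epsilon> \<Longrightarrow> fine_cover E \<epsilon> N A"
  unfolding fine_cover_def using order.strict_trans2 by blast

lemma compact_fine_partitionE:
  fixes E :: "'a :: metric_space set"
  assumes E: "compact E" and e: "0 < e"
  obtains N and A :: "nat \<Rightarrow> 'a set"
  where "fine_cover E e N A" "disjoint_family A" "\<And>k. \<exists>K V. compact K \<and> open V \<and> A k = K \<inter> V"
proof -
  obtain S where S: "finite S" "E \<subseteq> (\<Union>x\<in>S. ball x (e / 2))"
  proof (rule compactE_image[OF E, of E "\<lambda>x. ball x (e / 2)"])
    show "E \<subseteq> (\<Union>x\<in>E. ball x (e / 2))" using e by force
  qed auto
  obtain N and p :: "nat \<Rightarrow> 'a" where p: "S = p ` {..<N}"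
    using finite_imp_nat_seg_image_inj_on[OF S(1)] unfolding lessThan_def by metis
  define B where "B k = ball (p k) (e / 2)" for k
  define A where "A k = E \<inter> disjointed B k" for k
  show thesis
  proof (rule that[of N A])
    have "(\<Union>k<N. A k) = E \<inter> (\<Union>k<N. disjointed B k)" by (auto simp: A_def)
    also have "(\<Union>k<N. disjointed B k) = (\<Union>k<N. B k)"
      using finite_UN_disjointed_eq[of B N] by (simp only: atLeast0LessThan)
    finally have "(\<Union>k<N. A k) = E" using S(2) by (auto simp: p B_def)
    moreover have "dist x y < e" if "x \<in> A k" "y \<in> A k" for k x y
    proof -
      have "x \<in> ball (p k) (e / 2)" "y \<in> ball (p k) (e / 2)"
        using that disjointed_subset[of B k] by (auto simp: A_def B_def)
      then show ?thesis using dist_triangle_half_r[of "p k" x e y] by (simp add: dist_commute)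
    qed
    ultimately show "fine_cover E e N A" by (simp add: fine_cover_def)
    show "disjoint_family A"
      using disjoint_family_disjointed[of B] by (auto simp: disjoint_family_on_def A_def)
    show "\<exists>K V. compact K \<and> open V \<and> A k = K \<inter> V" for k
    proof (intro exI conjI)
      show "compact (E - (\<Union>i\<in>{0..<k}. B i))" using E by (intro compact_diff open_UN) (auto simp: B_def)
      show "open (B k)" by (simp add: B_def)
      show "A k = (E - (\<Union>i\<in>{0..<k}. B i)) \<inter> B k" by (auto simp: A_def disjointed_def)
    qed
  qed
qed

text \<open>A lower Riemann sum, over the cells of a partition, for the sum of \<open>w\<close> over a fibre of \<open>f\<close>.\<close>

definition fibre_lower_sum ::
  "('a \<Rightarrow> real) \<Rightarrow> ('a \<Rightarrow> real) \<Rightarrow> (nat \<Rightarrow> 'a set) \<Rightarrow> nat \<Rightarrow> real \<Rightarrow> ennreal" where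
  "fibre_lower_sum f w A N t = (\<Sum>k<N. ennreal (INF x\<in>A k. w x) * indicator (f ` A k) t)"

lemma borel_measurable_fibre_lower_sum:
  assumes "\<And>k. k < N \<Longrightarrow> f ` A k \<in> sets borel"
  shows "fibre_lower_sum f w A N \<in> borel_measurable borel"
  unfolding fibre_lower_sum_def[abs_def] using assms by measurable

lemma nn_integral_fibre_lower_sum_le:
  fixes f :: "plane \<Rightarrow> real"
  assumes f: "1-lipschitz_on UNIV f" and w: "w \<in> borel_measurable borel" "\<And>x. 0 \<le> w x"
    and A: "disjoint_family A" "\<And>k. A k \<in> sets borel" "\<And>k. f ` A k \<in> sets borel"
  shows "(\<integral>\<^sup>+ t. fibre_lower_sum f w A N t \<partial>lborel) \<le> (\<integral>\<^sup>+ x\<in>(\<Union>k<N. A k). ennreal (w x) \<partial>hausdorff1)"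
proof -
  note [measurable] = A(2,3) w(1)
  have "(\<integral>\<^sup>+ t. fibre_lower_sum f w A N t \<partial>lborel)
      = (\<Sum>k<N. ennreal (INF x\<in>A k. w x) * emeasure lborel (f ` A k))"
    unfolding fibre_lower_sum_def by (subst nn_integral_sum) (auto simp: nn_integral_cmult_indicator)
  also have "\<dots> \<le> (\<Sum>k<N. ennreal (INF x\<in>A k. w x) * emeasure hausdorff1 (A k))"
    using emeasure_lipschitz_image_le_hausdorff1[OF f]
    by (intro sum_mono mult_left_mono) (auto simp: emeasure_hausdorff1)
  also have "\<dots> \<le> (\<Sum>k<N. \<integral>\<^sup>+ x\<in>A k. ennreal (w x) \<partial>hausdorff1)"
  proof (rule sum_mono)
    fix k
    have "ennreal (INF x\<in>A k. w x) * emeasure hausdorff1 (A k)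
        = (\<integral>\<^sup>+ x\<in>A k. ennreal (INF x\<in>A k. w x) \<partial>hausdorff1)"
      by (simp add: nn_integral_cmult_indicator)
    also have "\<dots> \<le> (\<integral>\<^sup>+ x\<in>A k. ennreal (w x) \<partial>hausdorff1)"
      using w(2)
      by (intro nn_integral_mono)
        (auto simp: indicator_def intro!: ennreal_leI cINF_lower bdd_belowI[of _ 0])
    finally show "ennreal (INF x\<in>A k. w x) * emeasure hausdorff1 (A k)
        \<le> (\<integral>\<^sup>+ x\<in>A k. ennreal (w x) \<partial>hausdorff1)" .
  qed
  also have "\<dots> = (\<integral>\<^sup>+ x. (\<Sum>k<N. ennreal (w x) * indicator (A k) x) \<partial>hausdorff1)"
    by (rule nn_integral_sum[symmetric]) measurable
  also have "\<dots> = (\<integral>\<^sup>+ x\<in>(\<Union>k<N. A k). ennreal (w x) \<partial>hausdorff1)"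
    using A(1)
    by (intro nn_integral_cong)
      (simp add: indicator_UN_disjoint disjoint_family_on_def flip: sum_distrib_left)
  finally show ?thesis .
qed

lemma sum_INF_le_fibre_lower_sum:
  assumes "inj_on \<kappa> T" and \<kappa>: "\<And>x. x \<in> T \<Longrightarrow> \<kappa> x < N" "\<And>x. x \<in> T \<Longrightarrow> x \<in> A (\<kappa> x)"
    and T: "\<And>x. x \<in> T \<Longrightarrow> f x = t"
  shows "(\<Sum>x\<in>T. ennreal (INF y\<in>A (\<kappa> x). w y)) \<le> fibre_lower_sum f w A N t"
proof -
  have "(\<Sum>x\<in>T. ennreal (INF y\<in>A (\<kappa> x). w y))
      = (\<Sum>k\<in>\<kappa> ` T. ennreal (INF y\<in>A k. w y) * indicator (f ` A k) t)"
    unfolding sum.reindex[OF assms(1)]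
  proof (rule sum.cong)
    fix x assume "x \<in> T"
    then have "t \<in> f ` A (\<kappa> x)" using T \<kappa>(2) by force
    then show "ennreal (INF y\<in>A (\<kappa> x). w y)
        = ((\<lambda>k. ennreal (INF y\<in>A k. w y) * indicator (f ` A k) t) \<circ> \<kappa>) x" by simp
  qed simp
  also have "\<dots> \<le> fibre_lower_sum f w A N t"
    unfolding fibre_lower_sum_def using \<kappa>(1) by (intro sum_mono2) auto
  finally show ?thesis .
qed

lemma fine_cover_distinct_cellsE:
  assumes "fine_cover E \<delta> N A" "T \<subseteq> E" "\<And>x y. x \<in> T \<Longrightarrow> y \<in> T \<Longrightarrow> dist x y < \<delta> \<Longrightarrow> x = y"
  obtains \<kappa> where "inj_on \<kappa> T" "\<And>x. x \<in> T \<Longrightarrow> \<kappa> x < N" "\<And>x. x \<in> T \<Longrightarrow> x \<in> A (\<kappa> x)"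
proof -
  have "\<forall>x\<in>T. \<exists>k<N. x \<in> A k" using assms(1,2) by (auto simp: fine_cover_def)
  then obtain \<kappa> where \<kappa>: "\<And>x. x \<in> T \<Longrightarrow> \<kappa> x < N" "\<And>x. x \<in> T \<Longrightarrow> x \<in> A (\<kappa> x)" by metis
  have "inj_on \<kappa> T"
  proof (rule inj_onI)
    fix x y assume "x \<in> T" "y \<in> T" "\<kappa> x = \<kappa> y"
    moreover from this have "x \<in> A (\<kappa> x)" "y \<in> A (\<kappa> x)" using \<kappa>(2) by metis+
    ultimately show "x = y" using assms(1,3) unfolding fine_cover_def by blast
  qed
  then show thesis using that \<kappa> by blast
qed

lemma sum_le_fibre_lower_sum:
  fixes w :: "'a :: metric_space \<Rightarrow> real"
  assumes w: "uniformly_continuous_on E w" "\<And>x. 0 \<le> w x"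
    and T: "finite T" "T \<subseteq> E" "\<And>x. x \<in> T \<Longrightarrow> f x = t" and e: "0 < e"
  shows "\<exists>\<delta>>0. \<forall>N A. fine_cover E \<delta> N A \<longrightarrow>
    ennreal (\<Sum>x\<in>T. w x) \<le> fibre_lower_sum f w A N t + ennreal e"
proof -
  define \<epsilon> where "\<epsilon> = e / (real (card T) + 1)"
  have \<epsilon>: "0 < \<epsilon>" "real (card T) * \<epsilon> \<le> e" using e by (auto simp: \<epsilon>_def field_simps)
  obtain d where d: "0 < d" "\<And>x y. x \<in> E \<Longrightarrow> y \<in> E \<Longrightarrow> dist x y < d \<Longrightarrow> dist (w x) (w y) < \<epsilon>"
    using w(1) \<epsilon>(1) unfolding uniformly_continuous_on_def by metis
  obtain r where r: "0 < r" "\<And>x y. x \<in> T \<Longrightarrow> y \<in> T \<Longrightarrow> dist x y < r \<Longrightarrow> x = y"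
  proof -
    have "uniform_discrete T" using T(1) by (induction T) (auto simp: uniform_discrete_insert)
    then show thesis using that by (auto simp: uniform_discrete_def)
  qed
  show ?thesis
  proof (intro exI[of _ "min d r"] conjI allI impI)
    show "0 < min d r" using d r by simp
    fix A and N :: nat
    assume fine: "fine_cover E (min d r) N A"
    obtain \<kappa> where \<kappa>: "inj_on \<kappa> T" "\<And>x. x \<in> T \<Longrightarrow> \<kappa> x < N" "\<And>x. x \<in> T \<Longrightarrow> x \<in> A (\<kappa> x)"
      using fine_cover_distinct_cellsE[OF fine T(2)] r(2) by (metis min_less_iff_conj)
    define m where "m k = (INF x\<in>A k. w x)" for k
    have m_ge: "w x - \<epsilon> \<le> m (\<kappa> x)" if "x \<in> T" for x
      unfolding m_def
    proof (rule cINF_greatest)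
      show "A (\<kappa> x) \<noteq> {}" using \<kappa>(3)[OF that] by blast
      fix y assume "y \<in> A (\<kappa> x)"
      then have "y \<in> E" "x \<in> E" "dist x y < d"
        using fine \<kappa>(2,3)[OF that] that T(2) by (auto simp: fine_cover_def)
      then show "w x - \<epsilon> \<le> w y" using d(2)[of x y] by (auto simp: dist_real_def)
    qed
    have m_nonneg: "0 \<le> m (\<kappa> x)" if "x \<in> T" for x
      unfolding m_def using \<kappa>(3)[OF that] w(2) by (intro cINF_greatest) auto
    have "(\<Sum>x\<in>T. w x) \<le> (\<Sum>x\<in>T. m (\<kappa> x) + \<epsilon>)"
      using m_ge by (intro sum_mono) (simp add: diff_le_eq)
    also have "\<dots> \<le> (\<Sum>x\<in>T. m (\<kappa> x)) + e" using \<epsilon>(2) by (simp add: sum.distrib)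
    finally have "ennreal (\<Sum>x\<in>T. w x) \<le> ennreal ((\<Sum>x\<in>T. m (\<kappa> x)) + e)" by (rule ennreal_leI)
    also have "\<dots> = (\<Sum>x\<in>T. ennreal (m (\<kappa> x))) + ennreal e"
      using e m_nonneg by (subst ennreal_plus) (auto intro!: sum_nonneg)
    also have "(\<Sum>x\<in>T. ennreal (m (\<kappa> x))) \<le> fibre_lower_sum f w A N t"
      unfolding m_def by (rule sum_INF_le_fibre_lower_sum[OF \<kappa> T(3)])
    finally show "ennreal (\<Sum>x\<in>T. w x) \<le> fibre_lower_sum f w A N t + ennreal e"
      by (simp add: add_right_mono)
  qed
qed

lemma fibre_sum_le_liminf_fibre_lower_sum:
  fixes w :: "'a :: metric_space \<Rightarrow> real"
  assumes w: "uniformly_continuous_on E w" "\<And>x. 0 \<le> w x"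
    and fine: "\<And>n. fine_cover E (inverse (real (Suc n))) (N n) (A n)"
  shows "(\<Sum>\<^sub>\<infinity>x\<in>{x \<in> E. f x = t}. ennreal (w x)) \<le> liminf (\<lambda>n. fibre_lower_sum f w (A n) (N n) t)"
  unfolding nonneg_infsum_complete[OF zero_le]
proof (rule SUP_least, rule ennreal_le_epsilon)
  let ?L = "\<lambda>n. fibre_lower_sum f w (A n) (N n) t"
  fix T and e :: real
  assume "T \<in> {F. finite F \<and> F \<subseteq> {x \<in> E. f x = t}}" and e: "0 < e"
  then have T: "finite T" "T \<subseteq> E" "\<And>x. x \<in> T \<Longrightarrow> f x = t" by auto
  obtain \<delta> where \<delta>: "0 < \<delta>"
      "\<And>N A. fine_cover E \<delta> N A \<Longrightarrow> ennreal (\<Sum>x\<in>T. w x) \<le> fibre_lower_sum f w A N t + ennreal e"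
    using sum_le_fibre_lower_sum[of E w T f t e, OF w T e] by blast
  have "eventually (\<lambda>n. inverse (real (Suc n)) < \<delta>) sequentially"
    using LIMSEQ_inverse_real_of_nat \<delta>(1) by (rule order_tendstoD)
  then have "eventually (\<lambda>n. ennreal (\<Sum>x\<in>T. w x) - ennreal e \<le> ?L n) sequentially"
  proof eventually_elim
    case (elim n)
    have "ennreal (\<Sum>x\<in>T. w x) \<le> ?L n + ennreal e"
      using fine_cover_mono[OF fine[of n]] elim by (intro \<delta>(2)) auto
    then show ?case by (simp add: ennreal_minus_le_iff add.commute)
  qed
  then have "ennreal (\<Sum>x\<in>T. w x) - ennreal e \<le> liminf ?L" by (rule Liminf_bounded)
  then show "(\<Sum>x\<in>T. ennreal (w x)) \<le> liminf ?L + ennreal e"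
    using w(2) by (simp add: ennreal_minus_le_iff add.commute)
qed

theorem eilenberg_inequality:
  fixes f :: "plane \<Rightarrow> real"
  assumes E: "compact E" and f: "1-lipschitz_on UNIV f"
    and w: "continuous_on UNIV w" "\<And>x. 0 \<le> w x"
  shows "(\<integral>\<^sup>+ t. (\<Sum>\<^sub>\<infinity>x\<in>{x \<in> E. f x = t}. ennreal (w x)) \<partial>lborel) \<le> (\<integral>\<^sup>+ x\<in>E. ennreal (w x) \<partial>hausdorff1)"
proof -
  have "\<exists>N A. fine_cover E (inverse (real (Suc n))) N A \<and> disjoint_family A
      \<and> (\<forall>k. \<exists>K V. compact K \<and> open V \<and> A k = K \<inter> V)" for n
    using compact_fine_partitionE[OF E, of "inverse (real (Suc n))"] by (simp del: of_nat_Suc) metis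
  then obtain N and A :: "nat \<Rightarrow> nat \<Rightarrow> plane set" where
    fine: "\<And>n. fine_cover E (inverse (real (Suc n))) (N n) (A n)"
    and disjoint: "\<And>n. disjoint_family (A n)"
    and shape: "\<And>n k. \<exists>K V. compact K \<and> open V \<and> A n k = K \<inter> V" by metis
  have A_borel: "A n k \<in> sets borel" "f ` A n k \<in> sets borel" for n k
  proof -
    obtain K V where "compact K" "open V" "A n k = K \<inter> V" using shape by metis
    then show "A n k \<in> sets borel" "f ` A n k \<in> sets borel"
      using lipschitz_on_continuous_on[OF f]
      by (auto intro: continuous_image_compact_Int_open_borel sets.Int borel_compact)
  qed
  define L where "L n = fibre_lower_sum f w (A n) (N n)" for n
  have "uniformly_continuous_on E w"
    using E w(1) by (intro compact_uniformly_continuous) (auto intro: continuous_on_subset)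
  then have "(\<integral>\<^sup>+ t. (\<Sum>\<^sub>\<infinity>x\<in>{x \<in> E. f x = t}. ennreal (w x)) \<partial>lborel)
      \<le> (\<integral>\<^sup>+ t. liminf (\<lambda>n. L n t) \<partial>lborel)"
    unfolding L_def using w(2) fine by (intro nn_integral_mono fibre_sum_le_liminf_fibre_lower_sum)
  also have "\<dots> \<le> liminf (\<lambda>n. \<integral>\<^sup>+ t. L n t \<partial>lborel)"
    unfolding L_def using A_borel
    by (intro nn_integral_liminf) (auto intro: borel_measurable_fibre_lower_sum)
  also have "\<dots> \<le> (\<integral>\<^sup>+ x\<in>E. ennreal (w x) \<partial>hausdorff1)"
  proof (intro Liminf_le always_eventually allI)
    show "(\<integral>\<^sup>+ t. L n t \<partial>lborel) \<le> (\<integral>\<^sup>+ x\<in>E. ennreal (w x) \<partial>hausdorff1)" for n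
      using nn_integral_fibre_lower_sum_le[of f w "A n" "N n", OF f _ w(2) disjoint A_borel]
        borel_measurable_continuous_onI[OF w(1)] fine[of n]
      by (simp add: L_def fine_cover_def)
  qed simp
  finally show ?thesis .
qed

subsection \<open>The boundary estimate for integrals of partial derivatives\<close>

lemma sum_le_infsum_ennreal:
  fixes f :: "'a \<Rightarrow> ennreal"
  assumes "finite T" "T \<subseteq> A"
  shows "sum f T \<le> infsum f A"
  using assms by (auto simp: nonneg_infsum_complete intro: SUP_upper)

lemma infsum_mono_set_ennreal:
  fixes f :: "'a \<Rightarrow> ennreal"
  assumes "A \<subseteq> B"
  shows "infsum f A \<le> infsum f B"
  using assms by (intro infsum_mono_neutral nonneg_summable_on_complete) auto

lemma infsum_cmult_ennreal:
  fixes f :: "'a \<Rightarrow> ennreal"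
  shows "(\<Sum>\<^sub>\<infinity>x\<in>A. c * f x) = c * (\<Sum>\<^sub>\<infinity>x\<in>A. f x)"
  by (simp add: nonneg_infsum_complete SUP_mult_left_ennreal sum_distrib_left)

lemma component_of_open_bounded_real:
  fixes U :: "real set"
  assumes U: "open U" "bounded U" and c: "c \<in> components U"
  shows "c = {Inf c<..<Sup c}" "Inf c < Sup c" "Inf c \<in> frontier U" "Sup c \<in> frontier U"
proof -
  have c_props: "c \<noteq> {}" "open c" "bounded c" "connected c"
    using U c in_components_subset[OF c]
    by (auto intro: open_components bounded_subset in_components_connected dest: in_components_nonempty)
  have bdd: "bdd_below c" "bdd_above c"
    using c_props(3) by (auto intro: bounded_imp_bdd_below bounded_imp_bdd_above)
  have between: "Inf c < x \<and> x < Sup c" if "x \<in> c" for x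
  proof -
    obtain e where e: "0 < e" "ball x e \<subseteq> c" using c_props(2) \<open>x \<in> c\<close> by (rule openE)
    then have "x - e / 2 \<in> c" "x + e / 2 \<in> c" by (auto simp: dist_real_def subset_iff)
    then have "Inf c \<le> x - e / 2" "x + e / 2 \<le> Sup c" using bdd by (auto intro: cInf_lower cSup_upper)
    then show ?thesis using e(1) by linarith
  qed
  have "x \<in> c" if "Inf c < x" "x < Sup c" for x
  proof -
    have "\<exists>y\<in>c. y < x" "\<exists>z\<in>c. x < z"
      using that c_props(1) bdd by (simp_all flip: cInf_less_iff less_cSup_iff)
    then show ?thesis using connected_contains_Icc[OF c_props(4)] by force
  qed
  then have "x \<in> c \<longleftrightarrow> x \<in> {Inf c<..<Sup c}" for x using between by auto
  then show interval: "c = {Inf c<..<Sup c}" by (rule set_eqI)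
  show less: "Inf c < Sup c" using c_props(1) between by fastforce
  have "frontier c = {Inf c, Sup c}"
    using less frontier_box[of "Inf c" "Sup c"] interval by (auto simp: box_real)
  then show "Inf c \<in> frontier U" "Sup c \<in> frontier U"
    using frontier_of_components_subset[OF c] by auto
qed

lemma components_of_open_bounded_real_eqI:
  fixes U :: "real set"
  assumes U: "open U" "bounded U" and c: "c \<in> components U" "c' \<in> components U"
    and eq: "Inf c = Inf c' \<or> Sup c = Sup c'"
  shows "c = c'"
proof -
  define t where "t = (max (Inf c) (Inf c') + min (Sup c) (Sup c')) / 2"
  note interval = component_of_open_bounded_real(1,2)[OF U]
  have "t \<in> {Inf c<..<Sup c}" "t \<in> {Inf c'<..<Sup c'}"
    using eq interval(2)[OF c(1)] interval(2)[OF c(2)] by (auto simp: t_def max_def min_def)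
  then have "t \<in> c \<inter> c'" using interval(1)[OF c(1)] interval(1)[OF c(2)] by simp
  then show ?thesis using components_eq[OF c] by blast
qed

lemma countable_components_open:
  fixes U :: "'a :: {second_countable_topology, real_normed_vector} set"
  assumes "open U"
  shows "countable (components U)"
  using assms pairwise_disjoint_components[of U]
  by (intro countable_disjoint_open_subsets) (auto intro: open_components simp: pairwise_def disjnt_def)

lemma set_integrable_bounded_if_continuous:
  fixes f :: "'a :: euclidean_space \<Rightarrow> 'b :: euclidean_space"
  assumes "bounded A" "A \<in> sets borel" "continuous_on UNIV f"
  shows "set_integrable lborel A f"
proof (rule set_integrable_subset)
  show "set_integrable lborel (closure A) f"
    unfolding set_integrable_def using assms
    by (intro borel_integrable_compact) (auto intro: continuous_on_subset)
qed (use assms closure_subset in auto)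

lemma integral_deriv_components:
  fixes U :: "real set" and f f' :: "real \<Rightarrow> real"
  assumes U: "open U" "bounded U"
    and deriv: "\<And>x. (f has_real_derivative f' x) (at x)" and cont: "continuous_on UNIV f'"
    and F: "finite F" "F \<subseteq> components U"
  shows "(LINT x:\<Union>F|lborel. f' x) = (\<Sum>c\<in>F. f (Sup c) - f (Inf c))"
proof -
  have comp: "open c" "bounded c" if "c \<in> F" for c
    using that F(2) U in_components_subset[of c U] by (auto intro: open_components bounded_subset)
  have disjoint: "disjoint_family_on (\<lambda>c. c) F"
    using pairwise_disjoint_components[of U] F(2) unfolding disjoint_family_on_def pairwise_def by blast
  have "(LINT x:(\<Union>c\<in>F. c)|lborel. f' x) = (\<Sum>c\<in>F. LINT x:c|lborel. f' x)"
    using F(1) disjoint comp cont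
    by (intro set_integral_finite_Union set_integrable_bounded_if_continuous) auto
  also have "\<dots> = (\<Sum>c\<in>F. f (Sup c) - f (Inf c))"
  proof (rule sum.cong)
    fix c assume "c \<in> F"
    then have c: "c \<in> components U" using F(2) by blast
    note interval = component_of_open_bounded_real(1,2)[OF U c]
    have "(LINT x:{Inf c<..<Sup c}|lborel. f' x) = (LINT x:{Inf c..Sup c}|lborel. f' x)"
    proof (rule set_integral_cong_set)
      show "AE x in lborel. (x \<in> {Inf c..Sup c}) = (x \<in> {Inf c<..<Sup c})"
        using AE_lborel_singleton[of "Inf c"] AE_lborel_singleton[of "Sup c"] by eventually_elim auto
    qed (use borel_measurable_continuous_onI[OF cont] in \<open>simp_all add: set_borel_measurable_def\<close>)
    also have "\<dots> = f (Sup c) - f (Inf c)"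
      unfolding set_lebesgue_integral_def using interval(2) deriv cont
      by (intro integral_FTC_Icc) (auto simp: has_real_derivative_iff_has_vector_derivative[symmetric]
        intro: DERIV_subset continuous_on_subset)
    finally show "(LINT x:c|lborel. f' x) = f (Sup c) - f (Inf c)" using interval(1) by simp
  qed simp
  finally show ?thesis by simp
qed

lemma sum_abs_increments_components_le:
  fixes U :: "real set" and f :: "real \<Rightarrow> real"
  assumes U: "open U" "bounded U" and F: "finite F" "F \<subseteq> components U"
  shows "ennreal \<bar>\<Sum>c\<in>F. f (Sup c) - f (Inf c)\<bar> \<le> 2 * (\<Sum>\<^sub>\<infinity>t\<in>frontier U. ennreal \<bar>f t\<bar>)"
proof -
  have endpoint: "(\<Sum>c\<in>F. ennreal \<bar>f (e c)\<bar>) \<le> (\<Sum>\<^sub>\<infinity>t\<in>frontier U. ennreal \<bar>f t\<bar>)"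
    if "inj_on e F" "e ` F \<subseteq> frontier U" for e :: "real set \<Rightarrow> real"
    using sum_le_infsum_ennreal[of "e ` F" "frontier U" "\<lambda>t. ennreal \<bar>f t\<bar>"] F that
    by (simp add: sum.reindex)
  have "ennreal \<bar>\<Sum>c\<in>F. f (Sup c) - f (Inf c)\<bar> \<le> ennreal (\<Sum>c\<in>F. \<bar>f (Sup c)\<bar> + \<bar>f (Inf c)\<bar>)"
    by (intro ennreal_leI order.trans[OF sum_abs] sum_mono) linarith
  also have "\<dots> = (\<Sum>c\<in>F. ennreal \<bar>f (Sup c)\<bar>) + (\<Sum>c\<in>F. ennreal \<bar>f (Inf c)\<bar>)"
    by (simp add: sum.distrib sum_nonneg)
  also have "\<dots> \<le> (\<Sum>\<^sub>\<infinity>t\<in>frontier U. ennreal \<bar>f t\<bar>) + (\<Sum>\<^sub>\<infinity>t\<in>frontier U. ennreal \<bar>f t\<bar>)"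
  proof (intro add_mono endpoint)
    show "inj_on Sup F" "inj_on Inf F"
      using components_of_open_bounded_real_eqI[OF U] F(2) by (auto simp: inj_on_def subset_iff)
    show "Sup ` F \<subseteq> frontier U" "Inf ` F \<subseteq> frontier U"
      using component_of_open_bounded_real(3,4)[OF U] F(2) by auto
  qed
  finally show ?thesis by (simp add: mult_2)
qed

lemma integral_deriv_open_bounded_real_le:
  fixes U :: "real set" and f f' :: "real \<Rightarrow> real"
  assumes U: "open U" "bounded U"
    and deriv: "\<And>x. (f has_real_derivative f' x) (at x)" and cont: "continuous_on UNIV f'"
  shows "ennreal \<bar>LINT x:U|lborel. f' x\<bar> \<le> 2 * (\<Sum>\<^sub>\<infinity>t\<in>frontier U. ennreal \<bar>f t\<bar>)"
proof (cases "U = {}")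
  case False
  define C where "C = from_nat_into (components U)"
  have range_C: "range C = components U"
    unfolding C_def using countable_components_open[OF U(1)] False by (intro range_from_nat_into) auto
  define V where "V n = \<Union>(C ` {..<n})" for n
  have V_Un: "(\<Union>n. V n) = U"
  proof -
    have "(\<Union>n. V n) = \<Union>(range C)" unfolding V_def by auto
    then show ?thesis by (simp add: range_C)
  qed
  have "(\<lambda>n. LINT x:V n|lborel. f' x) \<longlonglongrightarrow> (LINT x:(\<Union>n. V n)|lborel. f' x)"
  proof (rule set_integral_cont_up)
    show "V n \<in> sets lborel" for n
      using range_C open_components[OF U(1)] by (auto simp: V_def intro!: borel_open open_Union)
    show "incseq V" unfolding incseq_def V_def by (intro allI impI Union_mono image_mono) auto
    show "set_integrable lborel (\<Union>n. V n) f'"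
      unfolding V_Un using U cont by (intro set_integrable_bounded_if_continuous) auto
  qed
  then have limit: "(\<lambda>n. ennreal \<bar>LINT x:V n|lborel. f' x\<bar>) \<longlonglongrightarrow> ennreal \<bar>LINT x:U|lborel. f' x\<bar>"
    unfolding V_Un by (intro tendsto_intros)
  have "ennreal \<bar>LINT x:V n|lborel. f' x\<bar> \<le> 2 * (\<Sum>\<^sub>\<infinity>t\<in>frontier U. ennreal \<bar>f t\<bar>)" for n
  proof -
    have F: "finite (C ` {..<n})" "C ` {..<n} \<subseteq> components U" using range_C by auto
    show ?thesis
      unfolding V_def integral_deriv_components[OF U deriv cont F]
      by (rule sum_abs_increments_components_le[OF U F])
  qed
  then show ?thesis by (intro tendsto_upperbound[OF limit]) auto
qed (simp add: set_lebesgue_integral_def)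

lemma Ck_1_iff:
  "Ck 1 f \<longleftrightarrow> (\<forall>x. f differentiable at x) \<and> (\<forall>j. continuous_on UNIV (partial j f))"
  unfolding One_nat_def by simp

lemma Ck_1_continuous_on: "Ck 1 f \<Longrightarrow> continuous_on UNIV f"
  by (auto simp: Ck_1_iff intro!: continuous_at_imp_continuous_on differentiable_imp_continuous_within)

lemma has_derivative_frechet:
  "f differentiable at x \<Longrightarrow> (f has_derivative frechet_derivative f (at x)) (at x)"
  by (simp add: frechet_derivative_works)

lemma partial_eqI: "(f has_derivative D) (at x) \<Longrightarrow> partial j f x = D (axis j 1)"
  unfolding partial_def using frechet_derivative_at by metis

lemma partial_const: "partial j (\<lambda>x. c) = (\<lambda>x. 0)"
  by (rule ext) (simp add: partial_eqI[OF has_derivative_const])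

lemma has_derivative_coordinate: "((\<lambda>x :: plane. x $ i) has_derivative (\<lambda>h. h $ i)) (at x)"
  by (rule bounded_linear_imp_has_derivative[OF bounded_linear_vec_nth])

lemma partial_coordinate: "partial j (\<lambda>x. x $ i) = (\<lambda>x. if i = j then 1 else 0)"
  by (rule ext) (simp add: partial_eqI[OF has_derivative_coordinate] axis_def)

lemma partial_add:
  assumes "f differentiable at x" "g differentiable at x"
  shows "partial j (\<lambda>x. f x + g x) x = partial j f x + partial j g x"
  using partial_eqI[OF has_derivative_add[OF assms[THEN has_derivative_frechet]]]
  by (simp add: partial_def)

lemma partial_diff:
  assumes "f differentiable at x" "g differentiable at x"
  shows "partial j (\<lambda>x. f x - g x) x = partial j f x - partial j g x"
  using partial_eqI[OF has_derivative_diff[OF assms[THEN has_derivative_frechet]]]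
  by (simp add: partial_def)

lemma partial_mult:
  assumes "f differentiable at x" "g differentiable at x"
  shows "partial j (\<lambda>x. f x * g x) x = f x * partial j g x + partial j f x * g x"
  using partial_eqI[OF has_derivative_mult[OF assms[THEN has_derivative_frechet]]]
  by (simp add: partial_def)

lemma has_derivative_compose_real:
  assumes "f differentiable at x" "(h has_real_derivative h') (at (f x))"
  shows "((\<lambda>x. h (f x)) has_derivative (\<lambda>y. h' * frechet_derivative f (at x) y)) (at x)"
  using has_derivative_compose[OF has_derivative_frechet[OF assms(1)]
      assms(2)[unfolded has_field_derivative_def]] .

lemma partial_compose:
  assumes "f differentiable at x" "(h has_real_derivative h') (at (f x))"
  shows "partial j (\<lambda>x. h (f x)) x = h' * partial j f x"
  using partial_eqI[OF has_derivative_compose_real[OF assms]] by (simp add: partial_def)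

lemma Ck_1_diff:
  assumes "Ck 1 f" "Ck 1 g"
  shows "Ck 1 (\<lambda>x. f x - g x)"
proof -
  have "partial j (\<lambda>x. f x - g x) = (\<lambda>x. partial j f x - partial j g x)" for j
    using assms by (intro ext partial_diff) (auto simp: Ck_1_iff)
  then show ?thesis using assms by (auto simp: Ck_1_iff intro!: continuous_intros)
qed

lemma Ck_1_mult:
  assumes "Ck 1 f" "Ck 1 g"
  shows "Ck 1 (\<lambda>x. f x * g x)"
proof -
  have "partial j (\<lambda>x. f x * g x) = (\<lambda>x. f x * partial j g x + partial j f x * g x)" for j
    using assms by (intro ext partial_mult) (auto simp: Ck_1_iff)
  then show ?thesis
    using assms Ck_1_continuous_on by (auto simp: Ck_1_iff intro!: continuous_intros)
qed

lemma has_real_derivative_along_axis: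
  assumes "f differentiable at (p + s *\<^sub>R axis j 1)"
  shows "((\<lambda>s. f (p + s *\<^sub>R axis j 1)) has_real_derivative partial j f (p + s *\<^sub>R axis j 1)) (at s)"
proof -
  have "((\<lambda>s. p + s *\<^sub>R axis j 1) has_derivative (\<lambda>h. h *\<^sub>R axis j 1)) (at s)"
    by (auto intro!: derivative_eq_intros)
  from has_derivative_compose[OF this has_derivative_frechet[OF assms]] show ?thesis
    unfolding has_field_derivative_def partial_def
    by (elim has_derivative_eq_rhs) (simp add: linear_cmul linear_frechet_derivative[OF assms] fun_eq_iff)
qed

lemma frontier_continuous_preimage_subset:
  assumes "continuous_on UNIV g" "open \<Omega>"
  shows "frontier {s. g s \<in> \<Omega>} \<subseteq> {s. g s \<in> frontier \<Omega>}"
proof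
  fix s assume s: "s \<in> frontier {s. g s \<in> \<Omega>}"
  have "open {s. g s \<in> \<Omega>}" using open_vimage[OF assms(2,1)] by (simp add: vimage_def)
  then have "s \<in> closure {s. g s \<in> \<Omega>}" "g s \<notin> \<Omega>" using s by (auto simp: frontier_def interior_open)
  moreover have "g ` closure {s. g s \<in> \<Omega>} \<subseteq> closure \<Omega>"
    using assms(1) closure_subset
    by (intro image_closure_subset) (auto intro: continuous_on_subset)
  ultimately show "s \<in> {s. g s \<in> frontier \<Omega>}" using assms(2) by (auto simp: frontier_def interior_open)
qed

lemma abs_integral_partial_along_axis_le:
  fixes w :: "plane \<Rightarrow> real"
  assumes \<Omega>: "open \<Omega>" "bounded \<Omega>" and w: "Ck 1 w"
  shows "ennreal \<bar>LINT s:{s. p + s *\<^sub>R axis j 1 \<in> \<Omega>}|lborel. partial j w (p + s *\<^sub>R axis j 1)\<bar>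
    \<le> 2 * (\<Sum>\<^sub>\<infinity>x\<in>{x \<in> frontier \<Omega>. \<forall>i. i \<noteq> j \<longrightarrow> x $ i = p $ i}. ennreal \<bar>w x\<bar>)"
proof -
  define g :: "real \<Rightarrow> plane" where "g s = p + s *\<^sub>R axis j 1" for s
  define U where "U = {s. g s \<in> \<Omega>}"
  have g: "continuous_on UNIV g" "inj g"
    unfolding g_def by (auto intro!: continuous_intros injI simp: axis_eq_0_iff)
  have "open U" using open_vimage[OF \<Omega>(1) g(1)] by (simp add: U_def vimage_def)
  moreover have "bounded U"
  proof -
    obtain B where B: "\<And>x. x \<in> \<Omega> \<Longrightarrow> norm x \<le> B" using \<Omega>(2) by (auto simp: bounded_iff)
    have "\<bar>s\<bar> \<le> B + \<bar>p $ j\<bar>" if "s \<in> U" for s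
    proof -
      have "\<bar>g s $ j\<bar> \<le> B" using that B component_le_norm_cart order_trans unfolding U_def by blast
      then show ?thesis by (simp add: g_def axis_def)
    qed
    then show ?thesis by (auto simp: bounded_iff)
  qed
  moreover have "((\<lambda>s. w (g s)) has_real_derivative partial j w (g s)) (at s)" for s
    unfolding g_def using w by (intro has_real_derivative_along_axis) (simp add: Ck_1_iff)
  moreover have "continuous_on UNIV (\<lambda>s. partial j w (g s))"
    using w g(1) by (auto simp: Ck_1_iff intro: continuous_on_compose2)
  ultimately have "ennreal \<bar>LINT s:U|lborel. partial j w (g s)\<bar>
      \<le> 2 * (\<Sum>\<^sub>\<infinity>s\<in>frontier U. ennreal \<bar>w (g s)\<bar>)"
    by (rule integral_deriv_open_bounded_real_le)
  also have "(\<Sum>\<^sub>\<infinity>s\<in>frontier U. ennreal \<bar>w (g s)\<bar>) = (\<Sum>\<^sub>\<infinity>x\<in>g ` frontier U. ennreal \<bar>w x\<bar>)"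
    using infsum_reindex[of g "frontier U" "\<lambda>x. ennreal \<bar>w x\<bar>"] g(2)
    by (simp add: o_def inj_on_subset)
  also have "\<dots> \<le> (\<Sum>\<^sub>\<infinity>x\<in>{x \<in> frontier \<Omega>. \<forall>i. i \<noteq> j \<longrightarrow> x $ i = p $ i}. ennreal \<bar>w x\<bar>)"
    using frontier_continuous_preimage_subset[OF g(1) \<Omega>(1)]
    by (intro infsum_mono_set_ennreal) (auto simp: U_def g_def axis_def)
  finally show ?thesis by (simp add: U_def g_def mult_left_mono)
qed

lemma lborel_plane_eq_distr:
  fixes i j :: 2
  assumes "i \<noteq> j"
  shows "(lborel :: plane measure) =
    distr (lborel \<Otimes>\<^sub>M lborel) borel (\<lambda>(t, s). t *\<^sub>R axis i 1 + s *\<^sub>R axis j 1)"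
proof (rule lborel_eqI)
  define \<Phi> :: "real \<times> real \<Rightarrow> plane" where "\<Phi> = (\<lambda>(t, s). t *\<^sub>R axis i 1 + s *\<^sub>R axis j 1)"
  have index: "k = i \<or> k = j" for k :: 2
    using assms exhaust_2[of i] exhaust_2[of j] exhaust_2[of k] by auto
  have component: "\<Phi> (t, s) $ i = t" "\<Phi> (t, s) $ j = s" for t s
    using assms by (auto simp: \<Phi>_def axis_def)
  have measurable: "\<Phi> \<in> borel_measurable (lborel \<Otimes>\<^sub>M lborel)"
    unfolding \<Phi>_def lborel_prod
    by (simp add: case_prod_beta' borel_measurable_continuous_onI continuous_intros)
  fix l u :: plane assume le: "\<And>b. b \<in> Basis \<Longrightarrow> l \<bullet> b \<le> u \<bullet> b"
  have "\<Phi> -` box l u \<inter> space (lborel \<Otimes>\<^sub>M lborel) = {l $ i<..<u $ i} \<times> {l $ j<..<u $ j}"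
  proof -
    have "(\<forall>k. Q k) \<longleftrightarrow> Q i \<and> Q j" for Q :: "2 \<Rightarrow> bool" using index by metis
    then have box_iff: "x \<in> box l u \<longleftrightarrow> l $ i < x $ i \<and> x $ i < u $ i \<and> l $ j < x $ j
        \<and> x $ j < u $ j" for x
      unfolding mem_box_cart by simp
    show ?thesis by (auto simp: box_iff component space_pair_measure)
  qed
  then have "emeasure (distr (lborel \<Otimes>\<^sub>M lborel) borel \<Phi>) (box l u)
      = emeasure (lborel \<Otimes>\<^sub>M lborel) ({l $ i<..<u $ i} \<times> {l $ j<..<u $ j})"
    by (subst emeasure_distr[OF measurable]) auto
  also have "\<dots> = ennreal ((u $ i - l $ i) * (u $ j - l $ j))"
    using le[of "axis i 1"] le[of "axis j 1"]
    by (subst lborel.emeasure_pair_measure_Times) (auto simp: ennreal_mult inner_axis)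
  also have "(u $ i - l $ i) * (u $ j - l $ j) = (\<Prod>b\<in>Basis. (u - l) \<bullet> b)"
  proof -
    have "(UNIV :: 2 set) = {i, j}" using index by auto
    then have basis: "(Basis :: plane set) = {axis i 1, axis j 1}" unfolding Basis_vec_def by auto
    show ?thesis unfolding basis using assms by (simp add: inner_axis axis_eq_axis)
  qed
  finally show "emeasure
      (distr (lborel \<Otimes>\<^sub>M lborel) borel (\<lambda>(t, s). t *\<^sub>R axis i 1 + s *\<^sub>R axis j 1)) (box l u)
    = (\<Prod>b\<in>Basis. (u - l) \<bullet> b)" by (simp add: \<Phi>_def)
qed simp

lemma integral_plane_eq_iterated:
  fixes g :: "plane \<Rightarrow> real"
  assumes g: "integrable lborel g" and ij: "i \<noteq> j"
  defines "S \<equiv> \<lambda>t. LINT s|lborel. g (t *\<^sub>R axis i 1 + s *\<^sub>R axis j 1)"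
  shows "integrable lborel S" "integral\<^sup>L lborel g = integral\<^sup>L lborel S"
proof -
  define \<Phi> :: "real \<times> real \<Rightarrow> plane" where "\<Phi> = (\<lambda>(t, s). t *\<^sub>R axis i 1 + s *\<^sub>R axis j 1)"
  have \<Phi>: "\<Phi> \<in> borel_measurable (lborel \<Otimes>\<^sub>M lborel)"
    unfolding \<Phi>_def lborel_prod
    by (simp add: case_prod_beta' borel_measurable_continuous_onI continuous_intros)
  have lborel_eq: "lborel = distr (lborel \<Otimes>\<^sub>M lborel) borel \<Phi>"
    unfolding \<Phi>_def by (rule lborel_plane_eq_distr[OF ij])
  have g_borel: "g \<in> borel_measurable borel" using g by simp
  have pair: "integrable (lborel \<Otimes>\<^sub>M lborel) (\<lambda>z. g (\<Phi> z))"
    using g \<Phi> g_borel unfolding lborel_eq by (subst (asm) integrable_distr_eq) auto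
  from lborel_pair.integrable_fst'[OF pair] show "integrable lborel S"
    by (simp add: S_def \<Phi>_def)
  have "integral\<^sup>L lborel g = integral\<^sup>L (lborel \<Otimes>\<^sub>M lborel) (\<lambda>z. g (\<Phi> z))"
    using \<Phi> g_borel by (subst lborel_eq, subst integral_distr) auto
  then show "integral\<^sup>L lborel g = integral\<^sup>L lborel S"
    using lborel_pair.integral_fst'[OF pair] by (simp add: S_def \<Phi>_def)
qed

lemma abs_integral_partial_le_fibre_sums:
  fixes w :: "plane \<Rightarrow> real"
  assumes \<Omega>: "open \<Omega>" "bounded \<Omega>" and w: "Ck 1 w" and ij: "i \<noteq> j"
  shows "ennreal \<bar>LINT x:\<Omega>|lebesgue. partial j w x\<bar>
    \<le> (\<integral>\<^sup>+ t. 2 * (\<Sum>\<^sub>\<infinity>x\<in>{x \<in> frontier \<Omega>. x $ i = t}. ennreal \<bar>w x\<bar>) \<partial>lborel)"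
proof -
  define p :: "real \<Rightarrow> plane" where "p t = t *\<^sub>R axis i 1" for t
  define g where "g x = indicator \<Omega> x *\<^sub>R partial j w x" for x
  define S where "S t = (LINT s|lborel. g (p t + s *\<^sub>R axis j 1))" for t
  have g: "integrable lborel g"
    using set_integrable_bounded_if_continuous[of \<Omega> "partial j w"] \<Omega> w
    by (simp add: set_integrable_def g_def[abs_def] Ck_1_iff)
  note iterated = integral_plane_eq_iterated[OF g ij, folded p_def, folded S_def]
  have "(LINT x:\<Omega>|lebesgue. partial j w x) = integral\<^sup>L lborel g"
    using borel_measurable_integrable[OF g]
    by (simp add: set_lebesgue_integral_def g_def[abs_def] integral_completion)
  then have "ennreal \<bar>LINT x:\<Omega>|lebesgue. partial j w x\<bar> = ennreal (norm (integral\<^sup>L lborel S))"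
    using iterated(2) by simp
  also have "\<dots> \<le> (\<integral>\<^sup>+ t. ennreal (norm (S t)) \<partial>lborel)"
    by (rule integral_norm_bound_ennreal[OF iterated(1)])
  also have "\<dots> \<le> (\<integral>\<^sup>+ t. 2 * (\<Sum>\<^sub>\<infinity>x\<in>{x \<in> frontier \<Omega>. x $ i = t}. ennreal \<bar>w x\<bar>) \<partial>lborel)"
  proof (rule nn_integral_mono)
    fix t
    have "S t = (LINT s:{s. p t + s *\<^sub>R axis j 1 \<in> \<Omega>}|lborel. partial j w (p t + s *\<^sub>R axis j 1))"
      by (simp add: S_def g_def set_lebesgue_integral_def indicator_def)
    also have "ennreal \<bar>\<dots>\<bar>
        \<le> 2 * (\<Sum>\<^sub>\<infinity>x\<in>{x \<in> frontier \<Omega>. \<forall>k. k \<noteq> j \<longrightarrow> x $ k = p t $ k}. ennreal \<bar>w x\<bar>)"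
      by (rule abs_integral_partial_along_axis_le[OF \<Omega> w])
    also have "\<dots> \<le> 2 * (\<Sum>\<^sub>\<infinity>x\<in>{x \<in> frontier \<Omega>. x $ i = t}. ennreal \<bar>w x\<bar>)"
      using ij by (intro mult_left_mono infsum_mono_set_ennreal) (auto simp: p_def axis_def)
    finally show "ennreal (norm (S t)) \<le> 2 * (\<Sum>\<^sub>\<infinity>x\<in>{x \<in> frontier \<Omega>. x $ i = t}. ennreal \<bar>w x\<bar>)"
      by simp
  qed
  finally show ?thesis .
qed

lemma abs_integral_partial_le_boundary:
  fixes w :: "plane \<Rightarrow> real"
  assumes \<Omega>: "open \<Omega>" "bounded \<Omega>" and w: "Ck 1 w"
  shows "ennreal \<bar>LINT x:\<Omega>|lebesgue. partial j w x\<bar>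
     \<le> 2 * (\<integral>\<^sup>+ x\<in>frontier \<Omega>. ennreal \<bar>w x\<bar> \<partial>hausdorff1)"
proof -
  obtain i :: 2 where "i \<noteq> j" by (metis one_neq_zero)
  then have "ennreal \<bar>LINT x:\<Omega>|lebesgue. partial j w x\<bar>
      \<le> (\<integral>\<^sup>+ t. 2 * (\<Sum>\<^sub>\<infinity>x\<in>{x \<in> frontier \<Omega>. x $ i = t}. ennreal \<bar>w x\<bar>) \<partial>lborel)"
    by (rule abs_integral_partial_le_fibre_sums[OF \<Omega> w])
  also have "\<dots> = (\<integral>\<^sup>+ t. (\<Sum>\<^sub>\<infinity>x\<in>{x \<in> frontier \<Omega>. x $ i = t}. ennreal (2 * \<bar>w x\<bar>)) \<partial>lborel)"
    by (simp add: ennreal_mult' infsum_cmult_ennreal)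
  also have "\<dots> \<le> (\<integral>\<^sup>+ x\<in>frontier \<Omega>. ennreal (2 * \<bar>w x\<bar>) \<partial>hausdorff1)"
  proof (rule eilenberg_inequality)
    show "compact (frontier \<Omega>)" using \<Omega>(2) by (rule compact_frontier_bounded)
    show "1-lipschitz_on UNIV (\<lambda>x :: plane. x $ i)"
      by (intro lipschitz_onI) (simp_all add: dist_vec_nth_le)
    show "continuous_on UNIV (\<lambda>x. 2 * \<bar>w x\<bar>)"
      using Ck_1_continuous_on[OF w] by (intro continuous_intros)
  qed simp
  also have "\<dots> = 2 * (\<integral>\<^sup>+ x\<in>frontier \<Omega>. ennreal \<bar>w x\<bar> \<partial>hausdorff1)"
  proof -
    have [measurable]: "w \<in> borel_measurable borel" "frontier \<Omega> \<in> sets borel"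
      using Ck_1_continuous_on[OF w] by (auto intro: borel_measurable_continuous_onI borel_closed)
    show ?thesis
      by (subst nn_integral_cmult[symmetric]) (measurable, simp add: ennreal_mult' mult.assoc)
  qed
  finally show ?thesis .
qed

subsection \<open>Boundaries of finite length\<close>

lemma frontier_subset_lipschitz_graph:
  fixes \<gamma> :: "real \<Rightarrow> real" and R :: "plane \<Rightarrow> plane"
  assumes \<Omega>: "open \<Omega>" and R: "continuous_on UNIV R" and \<gamma>: "continuous_on UNIV \<gamma>"
    and graph: "\<Omega> \<inter> ball p r = {x \<in> ball p r. \<gamma> (R x $ 1) < R x $ 2}"
    and x: "x \<in> frontier \<Omega>" "x \<in> ball p r"
  shows "R x $ 2 = \<gamma> (R x $ 1)"
proof -
  have x_closure: "x \<in> closure \<Omega>" "x \<notin> \<Omega>" using x(1) \<Omega> by (auto simp: frontier_def interior_open)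
  then have "\<not> \<gamma> (R x $ 1) < R x $ 2" using x(2) graph by blast
  moreover have "\<not> R x $ 2 < \<gamma> (R x $ 1)"
  proof
    assume below: "R x $ 2 < \<gamma> (R x $ 1)"
    define V where "V = ball p r \<inter> {y. R y $ 2 < \<gamma> (R y $ 1)}"
    have "continuous_on UNIV (\<lambda>y. \<gamma> (R y $ 1))"
      by (rule continuous_on_compose2[OF \<gamma>]) (auto intro!: continuous_intros R)
    then have "open V"
      unfolding V_def by (intro open_Int open_ball open_Collect_less continuous_intros R)
    moreover have "x \<in> V" using below x(2) by (simp add: V_def)
    ultimately obtain y where "y \<in> V" "y \<in> \<Omega>"
      using x_closure(1) by (meson closure_iff_nhds_not_empty disjoint_iff order_refl)
    then have "y \<in> \<Omega> \<inter> ball p r" "R y $ 2 < \<gamma> (R y $ 1)" by (auto simp: V_def)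
    then show False unfolding graph by auto
  qed
  ultimately show ?thesis by linarith
qed

lemma lipschitz_on_rotated_graph:
  fixes \<gamma> :: "real \<Rightarrow> real" and S :: "plane \<Rightarrow> plane"
  assumes S: "orthogonal_transformation S" and \<gamma>: "L-lipschitz_on UNIV \<gamma>"
  shows "(1 + L)-lipschitz_on A (\<lambda>s. S (vector [s, \<gamma> s]))"
proof (rule lipschitz_onI)
  fix s t
  have "dist (S (vector [s, \<gamma> s])) (S (vector [t, \<gamma> t]))
      = norm (vector [s, \<gamma> s] - vector [t, \<gamma> t] :: plane)"
    using S by (simp add: orthogonal_transformation_isometry dist_norm)
  also have "\<dots> \<le> (\<Sum>k\<in>UNIV. \<bar>(vector [s, \<gamma> s] - vector [t, \<gamma> t] :: plane) $ k\<bar>)"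
    by (rule norm_le_l1_cart)
  also have "\<dots> = dist s t + dist (\<gamma> s) (\<gamma> t)" by (simp add: sum_2 dist_real_def)
  also have "\<dots> \<le> (1 + L) * dist s t" using lipschitz_onD[OF \<gamma>, of s t] by (simp add: algebra_simps)
  finally show "dist (S (vector [s, \<gamma> s])) (S (vector [t, \<gamma> t])) \<le> (1 + L) * dist s t" .
qed (use lipschitz_on_nonneg[OF \<gamma>] in auto)

lemma hausdorff1_outer_frontier_ball_finite:
  assumes \<Omega>: "open \<Omega>" "lipschitz_boundary \<Omega>" and p: "p \<in> frontier \<Omega>"
  shows "\<exists>r>0. hausdorff1_outer (frontier \<Omega> \<inter> ball p r) < \<infinity>"
proof -
  obtain r :: real and R :: "plane \<Rightarrow> plane" and \<gamma> :: "real \<Rightarrow> real" and L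
    where r: "0 < r" and R: "orthogonal_transformation R" and \<gamma>: "L-lipschitz_on UNIV \<gamma>"
      and graph: "\<Omega> \<inter> ball p r = {x \<in> ball p r. \<gamma> (R x $ 1) < R x $ 2}"
    using \<Omega>(2) p unfolding lipschitz_boundary_def by blast
  define c where "c = R p $ 1"
  define g :: "real \<Rightarrow> plane" where "g s = inv R (vector [s, \<gamma> s])" for s
  have inv_R: "orthogonal_transformation (inv R)" "inv R (R x) = x" for x
    using R orthogonal_transformation_bij[OF R] by (auto simp: orthogonal_transformation_inv bij_is_inj)
  have "frontier \<Omega> \<inter> ball p r \<subseteq> g ` {c - r..<c + r}"
  proof
    fix x assume x: "x \<in> frontier \<Omega> \<inter> ball p r"
    have "continuous_on UNIV R"
      using R
      by (intro linear_continuous_on linear_conv_bounded_linear[THEN iffD1] orthogonal_transformation_linear)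
    then have "R x $ 2 = \<gamma> (R x $ 1)"
      using frontier_subset_lipschitz_graph[OF \<Omega>(1) _ lipschitz_on_continuous_on[OF \<gamma>] graph] x by blast
    then have "vector [R x $ 1, \<gamma> (R x $ 1)] = R x" by (simp add: vec_eq_iff forall_2)
    then have "x = g (R x $ 1)" by (simp add: g_def inv_R)
    moreover have "\<bar>R x $ 1 - c\<bar> < r"
    proof -
      have "dist (R x $ 1) c \<le> dist (R x) (R p)" unfolding c_def by (rule dist_vec_nth_le)
      also have "\<dots> < r" using R x by (simp add: orthogonal_transformation_isometry dist_commute)
      finally show ?thesis by (simp add: dist_real_def)
    qed
    then have "R x $ 1 \<in> {c - r..<c + r}" by auto
    ultimately show "x \<in> g ` {c - r..<c + r}" by blast
  qed
  then have "hausdorff1_outer (frontier \<Omega> \<inter> ball p r) \<le> hausdorff1_outer (g ` {c - r..<c + r})"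
    by (rule hausdorff1_outer_mono)
  also have "\<dots> \<le> ennreal ((1 + L) * ((c + r) - (c - r)))"
    using lipschitz_on_rotated_graph[OF inv_R(1) \<gamma>] r
    unfolding g_def by (intro hausdorff1_outer_lipschitz_image) auto
  also have "\<dots> < \<infinity>" by simp
  finally show ?thesis using r by blast
qed

lemma emeasure_hausdorff1_frontier_finite:
  assumes "bounded_lipschitz_domain \<Omega>"
  shows "emeasure hausdorff1 (frontier \<Omega>) < \<infinity>"
proof -
  have \<Omega>: "open \<Omega>" "bounded \<Omega>" "lipschitz_boundary \<Omega>"
    using assms by (auto simp: bounded_lipschitz_domain_def)
  obtain \<rho> where \<rho>: "\<And>p. p \<in> frontier \<Omega> \<Longrightarrow> 0 < \<rho> p"
    "\<And>p. p \<in> frontier \<Omega> \<Longrightarrow> hausdorff1_outer (frontier \<Omega> \<inter> ball p (\<rho> p)) < \<infinity>"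
    using hausdorff1_outer_frontier_ball_finite[OF \<Omega>(1,3)] by metis
  obtain F where F: "F \<subseteq> frontier \<Omega>" "finite F" "frontier \<Omega> \<subseteq> (\<Union>p\<in>F. ball p (\<rho> p))"
  proof (rule compactE_image[OF compact_frontier_bounded[OF \<Omega>(2)], of "frontier \<Omega>" "\<lambda>p. ball p (\<rho> p)"])
    show "frontier \<Omega> \<subseteq> (\<Union>p\<in>frontier \<Omega>. ball p (\<rho> p))" using \<rho>(1) by force
  qed auto
  have "frontier \<Omega> = (\<Union>p\<in>F. frontier \<Omega> \<inter> ball p (\<rho> p))" using F(3) by blast
  then have "emeasure hausdorff1 (frontier \<Omega>) = emeasure hausdorff1 (\<Union>p\<in>F. frontier \<Omega> \<inter> ball p (\<rho> p))"
    by simp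
  also have "\<dots> \<le> (\<Sum>p\<in>F. emeasure hausdorff1 (frontier \<Omega> \<inter> ball p (\<rho> p)))"
    using F by (intro emeasure_subadditive_finite) (auto simp: borel_closed)
  also have "\<dots> < \<infinity>"
    using F \<rho>(2) by (auto simp: ennreal_sum_less_top emeasure_hausdorff1 borel_closed subset_iff)
  finally show ?thesis .
qed

subsection \<open>Smooth cutoff functions of boxes\<close>

definition flat_exp :: "nat \<Rightarrow> real \<Rightarrow> real" where
  "flat_exp k t = (if 0 < t then exp (- 1 / t) / t ^ k else 0)"

lemma abs_flat_exp_le: "\<bar>flat_exp k t\<bar> \<le> fact (k + 2) * t\<^sup>2"
proof (cases "t > 0")
  case True
  have "(\<Sum>n\<in>{k + 2}. (1 / t) ^ n /\<^sub>R fact n) \<le> (\<Sum>n. (1 / t) ^ n /\<^sub>R fact n)"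
    using True by (intro sum_le_suminf summable_exp_generic) auto
  then have "inverse (exp (1 / t)) \<le> inverse ((1 / t) ^ (k + 2) / fact (k + 2))"
    using True by (intro le_imp_inverse_le) (auto simp: exp_def divide_inverse mult.commute)
  then have "exp (- 1 / t) \<le> fact (k + 2) * t ^ (k + 2)"
    using True by (simp add: exp_minus power_divide mult.commute del: fact_Suc power_Suc add_2_eq_Suc')
  then have "exp (- 1 / t) / t ^ k \<le> fact (k + 2) * t ^ (k + 2) / t ^ k"
    using True by (intro divide_right_mono) auto
  also have "\<dots> = fact (k + 2) * t\<^sup>2" using True by (simp add: power_add power2_eq_square)
  finally show ?thesis using True by (simp add: flat_exp_def)
qed (simp add: flat_exp_def)

lemma has_real_derivative_flat_exp:
  "(flat_exp k has_real_derivative flat_exp (k + 2) t - real k * flat_exp (k + 1) t) (at t)"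
proof -
  consider (pos) "t > 0" | (neg) "t < 0" | (zero) "t = 0" by linarith
  then show ?thesis
  proof cases
    case pos
    have "((\<lambda>t. exp (- 1 / t) / t ^ k) has_real_derivative
        flat_exp (k + 2) t - real k * flat_exp (k + 1) t) (at t)"
      using pos
      by (auto intro!: derivative_eq_intros simp: flat_exp_def field_simps power_add power2_eq_square)
        (cases k; simp add: field_simps)
    then show ?thesis
      by (rule has_field_derivative_transform_within_open[of _ _ _ "{0<..}"])
        (use pos in \<open>auto simp: flat_exp_def\<close>)
  next
    case neg
    have "((\<lambda>t. 0) has_real_derivative 0) (at t)" by simp
    then have "(flat_exp k has_real_derivative 0) (at t)"
      by (rule has_field_derivative_transform_within_open[of _ _ _ "{..<0}"])
        (use neg in \<open>auto simp: flat_exp_def\<close>)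
    then show ?thesis using neg by (simp add: flat_exp_def)
  next
    case zero
    have "((\<lambda>h. flat_exp k h / h) \<longlongrightarrow> 0) (at 0)"
    proof (rule Lim_null_comparison)
      have "norm (flat_exp k h / h) \<le> fact (k + 2) * \<bar>h\<bar>" if "h \<noteq> 0" for h :: real
        using abs_flat_exp_le[of k h] that
        by (simp add: abs_divide divide_le_eq power2_eq_square mult.assoc)
      then show "eventually (\<lambda>h. norm (flat_exp k h / h) \<le> fact (k + 2) * \<bar>h\<bar>) (at 0)"
        unfolding eventually_at_filter by (intro always_eventually) auto
      show "((\<lambda>h. fact (k + 2) * \<bar>h\<bar>) \<longlongrightarrow> (0::real)) (at 0)" by (auto intro!: tendsto_eq_intros)
    qed
    then show ?thesis unfolding zero DERIV_def by (simp add: flat_exp_def)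
  qed
qed

text \<open>This class is closed under \<^const>\<open>partial\<close>, so that membership yields all orders of
  differentiability at once, without formulas for higher derivatives.\<close>

inductive elementary_smooth :: "(plane \<Rightarrow> real) \<Rightarrow> bool" where
  const: "elementary_smooth (\<lambda>x. c)"
| coordinate: "elementary_smooth (\<lambda>x. x $ i)"
| flat_exp: "elementary_smooth f \<Longrightarrow> elementary_smooth (\<lambda>x. flat_exp k (f x))"
| add: "elementary_smooth f \<Longrightarrow> elementary_smooth g \<Longrightarrow> elementary_smooth (\<lambda>x. f x + g x)"
| mult: "elementary_smooth f \<Longrightarrow> elementary_smooth g \<Longrightarrow> elementary_smooth (\<lambda>x. f x * g x)"

lemma elementary_smooth_diff:
  assumes "elementary_smooth f" "elementary_smooth g"
  shows "elementary_smooth (\<lambda>x. f x - g x)"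
  using elementary_smooth.add[OF assms(1) elementary_smooth.mult[OF elementary_smooth.const[of "-1"] assms(2)]]
  by simp

lemma elementary_smooth_partial:
  assumes "elementary_smooth f"
  shows "(\<forall>x. f differentiable at x) \<and> (\<forall>j. elementary_smooth (partial j f))"
  using assms
proof induction
  case (const c)
  then show ?case by (simp add: partial_const elementary_smooth.const)
next
  case (coordinate i)
  have "(\<lambda>x :: plane. x $ i) differentiable at x" for x
    using has_derivative_coordinate by (auto simp: differentiable_def)
  then show ?case by (simp add: partial_coordinate elementary_smooth.const)
next
  case (flat_exp f k)
  then have diff: "f differentiable at x" for x by blast
  have "partial j (\<lambda>x. flat_exp k (f x))
      = (\<lambda>x. (flat_exp (k + 2) (f x) - real k * flat_exp (k + 1) (f x)) * partial j f x)" for j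
    by (rule ext) (rule partial_compose[OF diff has_real_derivative_flat_exp])
  moreover have "(\<lambda>x. flat_exp k (f x)) differentiable at x" for x
    using has_derivative_compose_real[OF diff has_real_derivative_flat_exp]
    by (auto simp: differentiable_def)
  ultimately show ?case
    using flat_exp by (auto intro!: elementary_smooth.intros elementary_smooth_diff)
next
  case (add f g)
  then have "partial j (\<lambda>x. f x + g x) = (\<lambda>x. partial j f x + partial j g x)" for j
    by (intro ext partial_add) auto
  then show ?case using add by (auto intro: elementary_smooth.intros)
next
  case (mult f g)
  then have "partial j (\<lambda>x. f x * g x) = (\<lambda>x. f x * partial j g x + partial j f x * g x)" for j
    by (intro ext partial_mult) auto
  then show ?case using mult by (auto intro!: elementary_smooth.intros)
qed

lemma elementary_smooth_Ck: "elementary_smooth f \<Longrightarrow> Ck k f"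
proof (induction k arbitrary: f)
  case 0
  then show ?case using elementary_smooth_partial[OF 0]
    by (auto intro!: continuous_at_imp_continuous_on differentiable_imp_continuous_within)
next
  case (Suc k)
  then show ?case using elementary_smooth_partial[of f] by simp
qed

lemma elementary_smooth_imp_smooth: "elementary_smooth f \<Longrightarrow> smooth f"
  by (simp add: smooth_def elementary_smooth_Ck)

lemma smooth_imp_Ck: "smooth f \<Longrightarrow> Ck k f"
  by (simp add: smooth_def)

definition box_bump :: "plane \<Rightarrow> plane \<Rightarrow> plane \<Rightarrow> real" where
  "box_bump a b x = flat_exp 0 (x $ 1 - a $ 1) * flat_exp 0 (b $ 1 - x $ 1)
     * (flat_exp 0 (x $ 2 - a $ 2) * flat_exp 0 (b $ 2 - x $ 2))"

definition box_cutoff :: "plane \<Rightarrow> plane \<Rightarrow> nat \<Rightarrow> plane \<Rightarrow> real" where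
  "box_cutoff a b n x = flat_exp 0 (real n * box_bump a b x)"

lemma flat_exp_0_eq_0_iff: "flat_exp 0 t = 0 \<longleftrightarrow> t \<le> 0"
  by (simp add: flat_exp_def)

lemma flat_exp_0_bounds: "0 \<le> flat_exp 0 t" "flat_exp 0 t \<le> 1"
  by (auto simp: flat_exp_def)

lemma box_bump_nonneg: "0 \<le> box_bump a b x"
  unfolding box_bump_def by (intro mult_nonneg_nonneg flat_exp_0_bounds)

lemma box_bump_pos_iff: "0 < box_bump a b x \<longleftrightarrow> x \<in> box a b"
proof -
  have "0 < box_bump a b x \<longleftrightarrow> box_bump a b x \<noteq> 0" using box_bump_nonneg[of a b x] by linarith
  also have "\<dots> \<longleftrightarrow> x \<in> box a b"
    unfolding box_bump_def mem_box_cart forall_2 by (auto simp: flat_exp_0_eq_0_iff)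
  finally show ?thesis .
qed

lemma box_cutoff_bounds: "0 \<le> box_cutoff a b n x" "box_cutoff a b n x \<le> 1"
  unfolding box_cutoff_def by (rule flat_exp_0_bounds)+

lemma box_cutoff_eq_0: "x \<notin> box a b \<Longrightarrow> box_cutoff a b n x = 0"
  using box_bump_pos_iff[of a b x] box_bump_nonneg[of a b x]
  by (simp add: box_cutoff_def flat_exp_def zero_less_mult_iff)

lemma box_cutoff_tendsto: "(\<lambda>n. box_cutoff a b n x) \<longlonglongrightarrow> indicator (box a b) x"
proof (cases "x \<in> box a b")
  case True
  then have pos: "0 < box_bump a b x" by (simp add: box_bump_pos_iff)
  have "(\<lambda>n. exp ((- 1 / box_bump a b x) / real n)) \<longlonglongrightarrow> exp 0"
    by (intro tendsto_exp lim_const_over_n)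
  moreover have "eventually (\<lambda>n. exp ((- 1 / box_bump a b x) / real n) = box_cutoff a b n x)
      sequentially"
    using eventually_gt_at_top[of 0]
    by eventually_elim (use pos in \<open>simp add: box_cutoff_def flat_exp_def mult.commute\<close>)
  ultimately show ?thesis using True by (auto elim: Lim_transform_eventually)
qed (simp add: box_cutoff_eq_0)

lemma box_cutoff_test_function:
  assumes "cbox a b \<subseteq> \<Omega>"
  shows "box_cutoff a b n \<in> test_functions \<Omega>"
proof -
  have "elementary_smooth (box_cutoff a b n)"
    unfolding box_cutoff_def[abs_def] box_bump_def
    by (intro elementary_smooth.intros elementary_smooth_diff)
  then show ?thesis
    unfolding test_functions_def using assms box_subset_cbox
    by (auto intro!: exI[of _ "cbox a b"] box_cutoff_eq_0 elementary_smooth_imp_smooth)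
qed

subsection \<open>Uniqueness of weak gradients\<close>

lemma set_integrable_mult_test_function:
  fixes g :: "plane \<Rightarrow> real"
  assumes g: "loc_integrable \<Omega> g" and \<phi>: "\<phi> \<in> test_functions \<Omega>"
  shows "set_integrable lebesgue \<Omega> (\<lambda>x. g x * \<phi> x)"
proof -
  obtain K where K: "compact K" "K \<subseteq> \<Omega>" "\<And>x. x \<notin> K \<Longrightarrow> \<phi> x = 0" and smooth: "smooth \<phi>"
    using \<phi> by (auto simp: test_functions_def)
  have cont: "continuous_on UNIV \<phi>" using smooth_imp_Ck[OF smooth, of 0] by simp
  then have "bounded (\<phi> ` K)"
    using K(1) by (intro compact_imp_bounded compact_continuous_image) (auto intro: continuous_on_subset)
  then obtain B where B: "\<And>x. x \<in> K \<Longrightarrow> \<bar>\<phi> x\<bar> \<le> B" by (auto simp: bounded_iff)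
  have g_K: "integrable lebesgue (\<lambda>x. indicator K x *\<^sub>R g x)"
    using g K by (auto simp: loc_integrable_def set_integrable_def)
  have \<phi>_measurable: "\<phi> \<in> borel_measurable lebesgue"
    using cont by (intro measurable_completion) (simp add: borel_measurable_continuous_onI)
  have "integrable lebesgue (\<lambda>x. (indicator K x *\<^sub>R g x) * \<phi> x)"
  proof (rule Bochner_Integration.integrable_bound)
    show "integrable lebesgue (\<lambda>x. B * (indicator K x *\<^sub>R g x))"
      using g_K by (intro integrable_mult_right)
    show "(\<lambda>x. (indicator K x *\<^sub>R g x) * \<phi> x) \<in> borel_measurable lebesgue"
      using g_K \<phi>_measurable by (intro borel_measurable_times) auto
    have "norm ((indicator K x *\<^sub>R g x) * \<phi> x) \<le> norm (B * (indicator K x *\<^sub>R g x))" for x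
      using B[of x] by (auto simp: indicator_def abs_mult mult.commute intro!: mult_right_mono)
    then show "AE x in lebesgue. norm ((indicator K x *\<^sub>R g x) * \<phi> x)
        \<le> norm (B * (indicator K x *\<^sub>R g x))"
      by (intro AE_I2)
  qed
  moreover have "(indicator K x *\<^sub>R g x) * \<phi> x = indicator \<Omega> x *\<^sub>R (g x * \<phi> x)" for x
    using K(2) K(3)[of x] by (auto simp: indicator_def)
  ultimately show ?thesis unfolding set_integrable_def by (simp only:)
qed

lemma integral_box_eq_0:
  fixes g :: "plane \<Rightarrow> real"
  assumes g: "loc_integrable \<Omega> g"
    and orthogonal: "\<And>\<phi>. \<phi> \<in> test_functions \<Omega> \<Longrightarrow> (LINT x:\<Omega>|lebesgue. g x * \<phi> x) = 0"
    and ab: "cbox a b \<subseteq> \<Omega>"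
  shows "(LINT x:box a b|lebesgue. g x) = 0"
proof -
  let ?\<phi> = "box_cutoff a b"
  have box: "x \<in> \<Omega>" "x \<in> cbox a b" if "x \<in> box a b" for x
    using that ab box_subset_cbox by blast+
  have g_cbox: "set_integrable lebesgue (cbox a b) g"
    using g ab by (auto simp: loc_integrable_def)
  have "(\<lambda>n. LINT x:\<Omega>|lebesgue. g x * ?\<phi> n x) \<longlonglongrightarrow> (LINT x:box a b|lebesgue. g x)"
    unfolding set_lebesgue_integral_def
  proof (rule integral_dominated_convergence)
    show "(\<lambda>x. indicator (box a b) x *\<^sub>R g x) \<in> borel_measurable lebesgue"
      using set_integrable_subset[OF g_cbox, of "box a b"]
      by (auto simp: box_subset_cbox set_integrable_def)
    show "(\<lambda>x. indicator \<Omega> x *\<^sub>R (g x * ?\<phi> n x)) \<in> borel_measurable lebesgue" for n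
      using set_integrable_mult_test_function[OF g box_cutoff_test_function[OF ab]]
      by (auto simp: set_integrable_def)
    show "integrable lebesgue (\<lambda>x. \<bar>indicator (cbox a b) x *\<^sub>R g x\<bar>)"
      using g_cbox unfolding set_integrable_def by (rule integrable_abs)
    have "(\<lambda>n. indicator \<Omega> x *\<^sub>R (g x * ?\<phi> n x)) \<longlonglongrightarrow> indicator (box a b) x *\<^sub>R g x" for x
    proof -
      have "indicator (box a b) x *\<^sub>R g x = indicator \<Omega> x *\<^sub>R (g x * indicator (box a b) x)"
        using box[of x] by (auto simp: indicator_def)
      then show ?thesis by (simp only:) (intro tendsto_intros box_cutoff_tendsto)
    qed
    then show "AE x in lebesgue. (\<lambda>n. indicator \<Omega> x *\<^sub>R (g x * ?\<phi> n x)) \<longlonglongrightarrow> indicator (box a b) x *\<^sub>R g x"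
      by (intro AE_I2)
    have "norm (indicator \<Omega> x *\<^sub>R (g x * ?\<phi> n x)) \<le> \<bar>indicator (cbox a b) x *\<^sub>R g x\<bar>" for n x
    proof (cases "x \<in> box a b")
      case True
      then show ?thesis using box box_cutoff_bounds[of a b n x] by (simp add: abs_mult mult_left_le)
    qed (simp add: box_cutoff_eq_0)
    then show "AE x in lebesgue. norm (indicator \<Omega> x *\<^sub>R (g x * ?\<phi> n x))
        \<le> \<bar>indicator (cbox a b) x *\<^sub>R g x\<bar>" for n
      by (intro AE_I2)
  qed
  then show ?thesis
    using orthogonal[OF box_cutoff_test_function[OF ab]] by (simp add: LIMSEQ_const_iff)
qed

lemma set_integral_borel_eq_0_if_box_integrals_eq_0:
  fixes f :: "'a :: euclidean_space \<Rightarrow> real"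
  assumes f: "integrable lebesgue f" and total: "integral\<^sup>L lebesgue f = 0"
    and box: "\<And>a b. (LINT x:box a b|lebesgue. f x) = 0" and A: "A \<in> sets borel"
  shows "(LINT x:A|lebesgue. f x) = 0"
proof -
  let ?G = "range (\<lambda>(a, b). box a b :: 'a set)"
  have G: "Int_stable ?G" "?G \<subseteq> Pow UNIV" by (auto simp: Int_stable_def box_Int_box)
  have sets_eq: "sigma_sets UNIV ?G = sets borel" by (simp add: borel_eq_box)
  have f_on: "set_integrable lebesgue B f" if "B \<in> sets borel" for B
    unfolding set_integrable_def using f that by (intro integrable_mult_indicator) auto
  from A have "A \<in> sigma_sets UNIV ?G" by (simp add: sets_eq)
  with G show ?thesis
  proof (induction rule: sigma_sets_induct_disjoint)
    case (basic A)
    then show ?case using box by auto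
  next
    case empty
    then show ?case by (simp add: set_lebesgue_integral_def)
  next
    case (compl A)
    then have "A \<in> sets borel" using sets_eq by simp
    then have "(LINT x:A \<union> (UNIV - A)|lebesgue. f x)
        = (LINT x:A|lebesgue. f x) + (LINT x:UNIV - A|lebesgue. f x)"
      by (intro set_integral_Un f_on) auto
    then show ?case using compl total by (simp add: set_lebesgue_integral_def)
  next
    case (union A)
    then have "(LINT x:(\<Union>i. A i)|lebesgue. f x) = (\<Sum>i. LINT x:A i|lebesgue. f x)"
      using sets_eq by (intro lebesgue_integral_countable_add f_on) (auto simp: disjoint_family_on_def)
    then show ?case using union by simp
  qed
qed

lemma AE_eq_0_if_box_integrals_eq_0:
  fixes f :: "'a :: euclidean_space \<Rightarrow> real"
  assumes f: "integrable lebesgue f" and total: "integral\<^sup>L lebesgue f = 0"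
    and box: "\<And>a b. (LINT x:box a b|lebesgue. f x) = 0"
  shows "AE x in lebesgue. f x = 0"
proof (rule density_unique_real[OF f])
  fix A :: "'a set" assume A_sets: "A \<in> sets lebesgue"
  then obtain S N N' where A: "A = S \<union> N" "N \<subseteq> N'" "N' \<in> null_sets lborel" "S \<in> sets lborel"
    by (rule sets_completionE)
  have "AE x in lebesgue. x \<notin> N'" using A(3) by (intro AE_not_in null_sets_completionI)
  then have "(LINT x:A|lebesgue. f x) = (LINT x:S|lebesgue. f x)"
    using f A_sets A(4)
    by (intro set_integral_cong_set)
      (auto simp: set_borel_measurable_def A(1) subsetD[OF A(2)]
        intro!: borel_measurable_times borel_measurable_indicator)
  also have "\<dots> = 0"
    using set_integral_borel_eq_0_if_box_integrals_eq_0[OF f total box] A(4) by simp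
  finally show "(LINT x:A|lebesgue. f x) = (LINT x:A|lebesgue. 0)" by simp
qed simp

lemma AE_not_in_cbox_minus_box: "AE x in lebesgue. x \<notin> cbox a b - box a b"
  using AE_not_in[of "cbox a b - box a b" lebesgue] negligible_frontier_interval[of a b]
  by (simp add: negligible_iff_null_sets)

lemma AE_eq_0_on_cbox:
  fixes g :: "plane \<Rightarrow> real"
  assumes g: "loc_integrable \<Omega> g"
    and orthogonal: "\<And>\<phi>. \<phi> \<in> test_functions \<Omega> \<Longrightarrow> (LINT x:\<Omega>|lebesgue. g x * \<phi> x) = 0"
    and ab: "cbox a b \<subseteq> \<Omega>"
  shows "AE x in lebesgue. x \<in> cbox a b \<longrightarrow> g x = 0"
proof -
  define f where "f x = indicator (box a b) x *\<^sub>R g x" for x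
  have "set_integrable lebesgue (cbox a b) g" using g ab by (auto simp: loc_integrable_def)
  then have "set_integrable lebesgue (box a b) g"
    by (rule set_integrable_subset) (auto simp: box_subset_cbox)
  then have f: "integrable lebesgue f" by (simp add: set_integrable_def f_def[abs_def])
  have box_0: "(LINT x:box c d|lebesgue. g x) = 0" if "box c d \<subseteq> box a b" for c d
  proof (cases "box c d = {}")
    case False
    then have "box a b \<noteq> {}" using that by blast
    then have "cbox c d \<subseteq> cbox a b"
      using closure_mono[OF that] closure_box[OF False] closure_box by metis
    then show ?thesis using integral_box_eq_0[OF g orthogonal] ab by auto
  qed (simp add: set_lebesgue_integral_def)
  have "AE x in lebesgue. f x = 0"
  proof (rule AE_eq_0_if_box_integrals_eq_0[OF f])
    show "integral\<^sup>L lebesgue f = 0"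
      using box_0[of a b] by (simp add: f_def[abs_def] set_lebesgue_integral_def)
    fix c d :: plane
    obtain p r where pr: "box c d \<inter> box a b = box p r" using box_Int_box by blast
    have "(LINT x:box c d|lebesgue. f x) = (LINT x:box p r|lebesgue. g x)"
      unfolding set_lebesgue_integral_def pr[symmetric] f_def
      by (intro Bochner_Integration.integral_cong) (auto simp: indicator_def)
    then show "(LINT x:box c d|lebesgue. f x) = 0" using box_0[of p r] pr by auto
  qed
  then show ?thesis
    using AE_not_in_cbox_minus_box[of a b]
    by eventually_elim (auto simp: f_def indicator_def split: if_splits)
qed

theorem fundamental_lemma_calculus_of_variations:
  fixes g :: "plane \<Rightarrow> real"
  assumes \<Omega>: "open \<Omega>" and g: "loc_integrable \<Omega> g"
    and orthogonal: "\<And>\<phi>. \<phi> \<in> test_functions \<Omega> \<Longrightarrow> (LINT x:\<Omega>|lebesgue. g x * \<phi> x) = 0"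
  shows "AE x in lebesgue. x \<in> \<Omega> \<longrightarrow> g x = 0"
proof -
  obtain \<D> where \<D>: "countable \<D>" "\<D> \<subseteq> Pow \<Omega>" "\<And>X. X \<in> \<D> \<Longrightarrow> \<exists>a b. X = cbox a b" "\<Union>\<D> = \<Omega>"
    using open_countable_Union_open_cbox[OF \<Omega>] by metis
  have "AE x in lebesgue. x \<in> X \<longrightarrow> g x = 0" if "X \<in> \<D>" for X
    using AE_eq_0_on_cbox[OF g orthogonal] \<D>(2,3) that by blast
  then have "AE x in lebesgue. \<forall>X\<in>\<D>. x \<in> X \<longrightarrow> g x = 0" unfolding AE_ball_countable[OF \<D>(1)] by blast
  then show ?thesis by eventually_elim (use \<D>(4) in auto)
qed

lemma loc_integrable_bounded_linear:
  fixes T :: "'b :: euclidean_space \<Rightarrow> 'c :: euclidean_space"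
  assumes T: "bounded_linear T" and f: "loc_integrable \<Omega> f"
  shows "loc_integrable \<Omega> (\<lambda>x. T (f x))"
  unfolding loc_integrable_def
proof (intro conjI allI impI)
  show "(\<lambda>x. T (f x)) \<in> borel_measurable (lebesgue_on \<Omega>)"
    using f borel_measurable_continuous_onI[OF linear_continuous_on[OF T, of UNIV]]
    unfolding loc_integrable_def by (auto intro: measurable_compose)
  fix K assume "compact K \<and> K \<subseteq> \<Omega>"
  then have "integrable lebesgue (\<lambda>x. indicator K x *\<^sub>R f x)"
    using f by (auto simp: loc_integrable_def set_integrable_def)
  then have "integrable lebesgue (\<lambda>x. T (indicator K x *\<^sub>R f x))"
    by (rule integrable_bounded_linear[OF T])
  then show "set_integrable lebesgue K (\<lambda>x. T (f x))"
    by (simp add: set_integrable_def linear_cmul[OF bounded_linear.linear[OF T]])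
qed

lemma loc_integrable_diff:
  assumes "loc_integrable \<Omega> f" "loc_integrable \<Omega> g"
  shows "loc_integrable \<Omega> (\<lambda>x. f x - g x)"
  using assms by (auto simp: loc_integrable_def intro!: set_integral_diff borel_measurable_diff)

lemma bounded_linear_matrix_entry: "bounded_linear (\<lambda>A :: real ^ 'n ^ 'm. A $ i $ j)"
  by (rule bounded_linear_compose[OF bounded_linear_vec_nth bounded_linear_vec_nth])

lemma has_weak_gradient_unique:
  assumes \<Omega>: "open \<Omega>" and G: "has_weak_gradient \<Omega> u G" "has_weak_gradient \<Omega> u G'"
  shows "AE x in lebesgue. x \<in> \<Omega> \<longrightarrow> G x = G' x"
proof -
  have "AE x in lebesgue. x \<in> \<Omega> \<longrightarrow> G x $ i $ j - G' x $ i $ j = 0" for i j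
  proof (rule fundamental_lemma_calculus_of_variations[OF \<Omega>])
    have entry: "loc_integrable \<Omega> (\<lambda>x. G x $ i $ j)" "loc_integrable \<Omega> (\<lambda>x. G' x $ i $ j)"
      using G
      by (auto simp: has_weak_gradient_def
          intro: loc_integrable_bounded_linear[OF bounded_linear_matrix_entry])
    then show "loc_integrable \<Omega> (\<lambda>x. G x $ i $ j - G' x $ i $ j)" by (rule loc_integrable_diff)
    fix \<phi> assume \<phi>: "\<phi> \<in> test_functions \<Omega>"
    have "(LINT x:\<Omega>|lebesgue. (G x $ i $ j - G' x $ i $ j) * \<phi> x)
      = (LINT x:\<Omega>|lebesgue. G x $ i $ j * \<phi> x) - (LINT x:\<Omega>|lebesgue. G' x $ i $ j * \<phi> x)"
      unfolding left_diff_distrib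
      by (intro set_integral_diff set_integrable_mult_test_function entry \<phi>)
    also have "\<dots> = 0"
    proof -
      have "(LINT x:\<Omega>|lebesgue. u x $ i * partial j \<phi> x) = - (LINT x:\<Omega>|lebesgue. G x $ i $ j * \<phi> x)"
        "(LINT x:\<Omega>|lebesgue. u x $ i * partial j \<phi> x) = - (LINT x:\<Omega>|lebesgue. G' x $ i $ j * \<phi> x)"
        using G \<phi> unfolding has_weak_gradient_def by blast+
      then show ?thesis by simp
    qed
    finally show "(LINT x:\<Omega>|lebesgue. (G x $ i $ j - G' x $ i $ j) * \<phi> x) = 0" .
  qed
  then have "AE x in lebesgue. \<forall>i\<in>UNIV. \<forall>j\<in>UNIV. x \<in> \<Omega> \<longrightarrow> G x $ i $ j - G' x $ i $ j = 0"
    by (intro AE_ball_countable[THEN iffD2] ballI) (auto intro: countable_finite)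
  then show ?thesis by eventually_elim (simp add: vec_eq_iff)
qed

lemma has_weak_gradient_weak_gradient:
  "has_weak_gradient \<Omega> u G \<Longrightarrow> has_weak_gradient \<Omega> u (weak_gradient \<Omega> u)"
  using someI[of "has_weak_gradient \<Omega> u"] by (simp add: weak_gradient_def)

lemma weak_gradient_AE_eq:
  assumes "open \<Omega>" "has_weak_gradient \<Omega> u G"
  shows "AE x in lebesgue_on \<Omega>. weak_gradient \<Omega> u x = G x"
  using has_weak_gradient_unique[OF assms(1) has_weak_gradient_weak_gradient[OF assms(2)] assms(2)] assms(1)
  by (simp add: AE_restrict_space_iff)

subsection \<open>Traces determine the mean of the weak gradient\<close>

lemma set_integrable_lebesgue_if_continuous:
  fixes f :: "'a :: euclidean_space \<Rightarrow> 'b :: euclidean_space"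
  assumes "bounded A" "A \<in> sets borel" "continuous_on UNIV f"
  shows "set_integrable lebesgue A f"
  using set_integrable_bounded_if_continuous[OF assms] unfolding set_integrable_def
  by (subst integrable_completion) auto

lemma loc_integrable_continuous:
  fixes f :: "plane \<Rightarrow> 'b :: euclidean_space"
  assumes "continuous_on UNIV f"
  shows "loc_integrable \<Omega> f"
proof -
  have "f \<in> borel_measurable lebesgue"
    using assms by (intro measurable_completion) (simp add: borel_measurable_continuous_onI)
  then show ?thesis
    unfolding loc_integrable_def using assms
    by (auto intro: measurable_restrict_space1 set_integrable_lebesgue_if_continuous
        compact_imp_bounded borel_compact)
qed

lemma jacobian_component:
  fixes g :: "plane \<Rightarrow> real ^ 'n"
  assumes "\<And>i. (\<lambda>x. g x $ i) differentiable at x"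
  shows "jacobian g (at x) $ i $ j = partial j (\<lambda>x. g x $ i) x"
proof -
  define D where "D h = (\<chi> i. frechet_derivative (\<lambda>x. g x $ i) (at x) h)" for h
  have "(g has_derivative D) (at x)"
    unfolding has_derivative_componentwise_within[of g D x UNIV]
  proof
    fix b :: "real ^ 'n" assume "b \<in> Basis"
    then obtain k where b: "b = axis k 1" by (auto simp: Basis_vec_def)
    show "((\<lambda>x. g x \<bullet> b) has_derivative (\<lambda>h. D h \<bullet> b)) (at x)"
      unfolding b using has_derivative_frechet[OF assms] by (simp add: inner_axis D_def)
  qed
  then have "frechet_derivative g (at x) = D" by (metis frechet_derivative_at)
  then show ?thesis by (simp add: jacobian_def matrix_def D_def partial_def)
qed

lemma Ck_1_jacobian:
  fixes g :: "plane \<Rightarrow> real ^ 'n"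
  assumes "\<And>i. Ck 1 (\<lambda>x. g x $ i)"
  shows "jacobian g (at x) $ i $ j = partial j (\<lambda>x. g x $ i) x"
    and "continuous_on UNIV (\<lambda>x. jacobian g (at x))"
proof -
  show entry: "jacobian g (at x) $ i $ j = partial j (\<lambda>x. g x $ i) x" for i j x
    using assms by (intro jacobian_component) (auto simp: Ck_1_iff)
  have "continuous_on UNIV (\<lambda>x. \<chi> i j. partial j (\<lambda>x. g x $ i) x)"
    using assms by (intro continuous_on_vec_lambda) (auto simp: Ck_1_iff)
  moreover have "(\<lambda>x. \<chi> i j. partial j (\<lambda>x. g x $ i) x) = (\<lambda>x. jacobian g (at x))"
    by (simp add: fun_eq_iff vec_eq_iff entry)
  ultimately show "continuous_on UNIV (\<lambda>x. jacobian g (at x))" by (simp only:)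
qed

lemma Ck_1_components_continuous_on:
  fixes g :: "plane \<Rightarrow> real ^ 'n"
  assumes "\<And>i. Ck 1 (\<lambda>x. g x $ i)"
  shows "continuous_on UNIV g"
  using continuous_on_vec_lambda[of UNIV "\<lambda>i x. g x $ i"] Ck_1_continuous_on[OF assms] by simp

lemma has_weak_gradient_jacobian:
  assumes \<Omega>: "open \<Omega>" "bounded \<Omega>" and g: "\<And>i. Ck 1 (\<lambda>x. g x $ i)"
  shows "has_weak_gradient \<Omega> g (\<lambda>x. jacobian g (at x))"
  unfolding has_weak_gradient_def
proof (intro conjI ballI allI)
  show "loc_integrable \<Omega> g" by (intro loc_integrable_continuous Ck_1_components_continuous_on g)
  show "loc_integrable \<Omega> (\<lambda>x. jacobian g (at x))" by (intro loc_integrable_continuous Ck_1_jacobian g)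
  fix \<phi> and i j :: 2 assume \<phi>: "\<phi> \<in> test_functions \<Omega>"
  then have "smooth \<phi>" by (simp add: test_functions_def)
  then have "Ck 1 \<phi>" by (rule smooth_imp_Ck)
  define w where "w x = g x $ i * \<phi> x" for x
  have w: "Ck 1 w" unfolding w_def using g \<open>Ck 1 \<phi>\<close> by (rule Ck_1_mult)
  have "ennreal \<bar>LINT x:\<Omega>|lebesgue. partial j w x\<bar> \<le> 2 * (\<integral>\<^sup>+ x\<in>frontier \<Omega>. ennreal \<bar>w x\<bar> \<partial>hausdorff1)"
    by (rule abs_integral_partial_le_boundary[OF \<Omega> w])
  also have "(\<integral>\<^sup>+ x\<in>frontier \<Omega>. ennreal \<bar>w x\<bar> \<partial>hausdorff1) = (\<integral>\<^sup>+ x. 0 \<partial>hausdorff1)"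
  proof (rule nn_integral_cong)
    fix x
    have "\<phi> x = 0" if "x \<notin> \<Omega>" using \<phi> that by (auto simp: test_functions_def)
    then show "ennreal \<bar>w x\<bar> * indicator (frontier \<Omega>) x = 0"
      using \<Omega>(1) by (auto simp: indicator_def w_def frontier_def interior_open)
  qed
  finally have "(LINT x:\<Omega>|lebesgue. partial j w x) = 0" by simp
  moreover have "(LINT x:\<Omega>|lebesgue. partial j w x)
      = (LINT x:\<Omega>|lebesgue. g x $ i * partial j \<phi> x)
        + (LINT x:\<Omega>|lebesgue. jacobian g (at x) $ i $ j * \<phi> x)"
  proof -
    have "partial j w x = g x $ i * partial j \<phi> x + jacobian g (at x) $ i $ j * \<phi> x" for x
      unfolding w_def Ck_1_jacobian(1)[OF g]
      using g \<open>Ck 1 \<phi>\<close> by (intro partial_mult) (auto simp: Ck_1_iff)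
    then show ?thesis
      using \<Omega> \<open>Ck 1 \<phi>\<close> Ck_1_continuous_on[OF \<open>Ck 1 \<phi>\<close>]
        Ck_1_components_continuous_on[OF g] Ck_1_jacobian(2)[OF g]
      by (simp, intro set_integral_add set_integrable_lebesgue_if_continuous)
        (auto simp: Ck_1_iff intro!: continuous_intros)
  qed
  ultimately show "(LINT x:\<Omega>|lebesgue. g x $ i * partial j \<phi> x)
    = - (LINT x:\<Omega>|lebesgue. jacobian g (at x) $ i $ j * \<phi> x)"
    by linarith
qed

lemma le_add_scaled_powr:
  fixes \<eta> r q :: real
  assumes "0 < \<eta>" "0 \<le> r" "1 \<le> q"
  shows "r \<le> \<eta> + \<eta> powr (1 - q) * r powr q"
proof (cases "r \<le> \<eta>")
  case False
  then have "r = r powr (1 - q) * r powr q" using assms by (simp flip: powr_add)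
  also have "\<dots> \<le> \<eta> powr (1 - q) * r powr q"
    using False assms by (intro mult_right_mono powr_mono2') auto
  finally show ?thesis using assms by linarith
qed (simp add: add_increasing2)

lemma nn_integral_norm_le_powr:
  fixes f :: "'a \<Rightarrow> 'b :: euclidean_space"
  assumes f [measurable]: "f \<in> borel_measurable M" and \<eta>: "0 < \<eta>" and q: "1 \<le> q"
  shows "(\<integral>\<^sup>+ x. ennreal (norm (f x)) \<partial>M)
    \<le> ennreal \<eta> * emeasure M (space M)
      + ennreal (\<eta> powr (1 - q)) * (\<integral>\<^sup>+ x. ennreal (norm (f x) powr q) \<partial>M)"
proof -
  have "(\<integral>\<^sup>+ x. ennreal (norm (f x)) \<partial>M)
      \<le> (\<integral>\<^sup>+ x. ennreal \<eta> + ennreal (\<eta> powr (1 - q)) * ennreal (norm (f x) powr q) \<partial>M)"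
  proof (rule nn_integral_mono)
    fix x
    have "ennreal (norm (f x)) \<le> ennreal (\<eta> + \<eta> powr (1 - q) * norm (f x) powr q)"
      using \<eta> q by (intro ennreal_leI le_add_scaled_powr) auto
    then show "ennreal (norm (f x)) \<le> ennreal \<eta> + ennreal (\<eta> powr (1 - q)) * ennreal (norm (f x) powr q)"
      using \<eta> by (simp add: ennreal_mult')
  qed
  also have "\<dots> = ennreal \<eta> * emeasure M (space M)
      + ennreal (\<eta> powr (1 - q)) * (\<integral>\<^sup>+ x. ennreal (norm (f x) powr q) \<partial>M)"
    by (simp add: nn_integral_add nn_integral_cmult)
  finally show ?thesis .
qed

lemma nn_integral_norm_tendsto_0:
  fixes f :: "nat \<Rightarrow> 'a \<Rightarrow> 'b :: euclidean_space"
  assumes finite: "emeasure M (space M) < \<infinity>" and q: "1 \<le> q"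
    and f: "\<And>n. f n \<in> borel_measurable M"
    and lim: "(\<lambda>n. \<integral>\<^sup>+ x. ennreal (norm (f n x) powr q) \<partial>M) \<longlonglongrightarrow> 0"
  shows "(\<lambda>n. \<integral>\<^sup>+ x. ennreal (norm (f n x)) \<partial>M) \<longlonglongrightarrow> 0"
proof (rule order_tendstoI)
  fix a :: ennreal assume a: "0 < a"
  define \<mu> where "\<mu> = measure M (space M)"
  have \<mu>: "emeasure M (space M) = ennreal \<mu>" "0 \<le> \<mu>"
    using finite by (auto simp: \<mu>_def emeasure_eq_ennreal_measure)
  obtain e where e: "0 < e" "ennreal e < a"
  proof (cases a)
    case (real r)
    then have "0 < r" using a by simp
    then show ?thesis using that[of "r / 2"] real by (simp add: ennreal_less_iff)
  qed (use that[of 1] in simp)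
  define \<eta> where "\<eta> = e / (\<mu> + 1)"
  have \<eta>: "0 < \<eta>" "\<eta> * \<mu> < e" using e \<mu> by (auto simp: \<eta>_def field_simps)
  have "(\<lambda>n. ennreal (\<eta> * \<mu>) + ennreal (\<eta> powr (1 - q)) * (\<integral>\<^sup>+ x. ennreal (norm (f n x) powr q) \<partial>M))
      \<longlonglongrightarrow> ennreal (\<eta> * \<mu>) + ennreal (\<eta> powr (1 - q)) * 0"
    by (intro tendsto_add tendsto_const ennreal_tendsto_cmult lim) simp
  moreover have "ennreal (\<eta> * \<mu>) + ennreal (\<eta> powr (1 - q)) * 0 < a"
    using order.strict_trans[OF ennreal_lessI[OF e(1) \<eta>(2)] e(2)] by simp
  ultimately have "eventually (\<lambda>n. ennreal (\<eta> * \<mu>)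
      + ennreal (\<eta> powr (1 - q)) * (\<integral>\<^sup>+ x. ennreal (norm (f n x) powr q) \<partial>M) < a) sequentially"
    by (rule order_tendstoD)
  then show "eventually (\<lambda>n. (\<integral>\<^sup>+ x. ennreal (norm (f n x)) \<partial>M) < a) sequentially"
  proof eventually_elim
    case (elim n)
    then show ?case
      using nn_integral_norm_le_powr[OF f \<eta>(1) q, of n] \<eta> \<mu>
      by (auto simp: ennreal_mult intro: order.strict_trans1)
  qed
qed simp

lemma nn_set_integral_norm_tendsto_0:
  fixes f :: "nat \<Rightarrow> 'a \<Rightarrow> 'b :: euclidean_space"
  assumes A: "A \<in> sets M" "emeasure M A < \<infinity>" and q: "1 \<le> q"
    and f: "\<And>n. f n \<in> borel_measurable (restrict_space M A)"
    and lim: "(\<lambda>n. \<integral>\<^sup>+ x\<in>A. ennreal (norm (f n x) powr q) \<partial>M) \<longlonglongrightarrow> 0"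
  shows "(\<lambda>n. \<integral>\<^sup>+ x\<in>A. ennreal (norm (f n x)) \<partial>M) \<longlonglongrightarrow> 0"
proof -
  have restrict: "(\<integral>\<^sup>+ x\<in>A. h x \<partial>M) = (\<integral>\<^sup>+ x. h x \<partial>restrict_space M A)" for h :: "'a \<Rightarrow> ennreal"
    using A(1) by (simp add: nn_integral_restrict_space)
  have "emeasure (restrict_space M A) (space (restrict_space M A)) < \<infinity>"
    using A sets.sets_into_space[OF A(1)]
    by (simp add: emeasure_restrict_space space_restrict_space Int_absorb2)
  then show ?thesis
    using nn_integral_norm_tendsto_0[of "restrict_space M A" q f, OF _ q f] lim
    unfolding restrict by blast
qed

lemma abs_integral_partial_diff_le_boundary:
  assumes \<Omega>: "open \<Omega>" "bounded \<Omega>" and v: "Ck 1 v" and g: "Ck 1 g"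
  shows "ennreal \<bar>(LINT x:\<Omega>|lebesgue. partial j v x) - (LINT x:\<Omega>|lebesgue. partial j g x)\<bar>
    \<le> 2 * (\<integral>\<^sup>+ x\<in>frontier \<Omega>. ennreal \<bar>v x - g x\<bar> \<partial>hausdorff1)"
proof -
  have "(LINT x:\<Omega>|lebesgue. partial j v x) - (LINT x:\<Omega>|lebesgue. partial j g x)
      = (LINT x:\<Omega>|lebesgue. partial j v x - partial j g x)"
    using \<Omega> v g
    by (intro set_integral_diff(2)[symmetric] set_integrable_lebesgue_if_continuous)
      (auto simp: Ck_1_iff)
  also have "\<dots> = (LINT x:\<Omega>|lebesgue. partial j (\<lambda>x. v x - g x) x)"
    using v g by (simp add: partial_diff Ck_1_iff)
  finally show ?thesis using abs_integral_partial_le_boundary[OF \<Omega> Ck_1_diff[OF v g]] by simp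
qed

lemma integrable_jacobian:
  assumes "open \<Omega>" "bounded \<Omega>" "\<And>i. Ck 1 (\<lambda>x. g x $ i)"
  shows "integrable (lebesgue_on \<Omega>) (\<lambda>x. jacobian g (at x))"
  using set_integrable_lebesgue_if_continuous[OF assms(2) _ Ck_1_jacobian(2)[OF assms(3)]] assms(1)
  by (simp add: set_integrable_def integrable_restrict_space)

lemma integral_jacobian_component:
  assumes \<Omega>: "open \<Omega>" "bounded \<Omega>" and g: "\<And>i. Ck 1 (\<lambda>x. g x $ i)"
  shows "(LINT x|lebesgue_on \<Omega>. jacobian g (at x)) $ i $ j
      = (LINT x:\<Omega>|lebesgue. partial j (\<lambda>x. g x $ i) x)"
  using integral_bounded_linear[OF bounded_linear_matrix_entry integrable_jacobian[OF \<Omega> g], of i j] \<Omega>(1)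
  by (simp add: Ck_1_jacobian(1)[OF g] set_lebesgue_integral_def integral_restrict_space)

lemma tendsto_if_ennreal_abs_diff_le:
  fixes a :: "nat \<Rightarrow> real"
  assumes "\<And>k. ennreal \<bar>a k - l\<bar> \<le> Y k" "Y \<longlonglongrightarrow> 0"
  shows "a \<longlonglongrightarrow> l"
proof -
  have "(\<lambda>k. ennreal \<bar>a k - l\<bar>) \<longlonglongrightarrow> 0"
    using assms by (intro tendsto_sandwich[OF _ _ tendsto_const assms(2)]) auto
  then have "(\<lambda>k. \<bar>a k - l\<bar>) \<longlonglongrightarrow> 0" by (subst (asm) ennreal_tendsto_0_iff) auto
  then show ?thesis by (simp add: tendsto_rabs_zero_iff LIM_zero_iff)
qed

lemma integral_jacobian_tendsto:
  fixes v :: "nat \<Rightarrow> plane \<Rightarrow> real ^ 'n" and g :: "plane \<Rightarrow> real ^ 'n"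
  assumes \<Omega>: "bounded_lipschitz_domain \<Omega>" and q: "1 \<le> q"
    and v: "\<And>k i. Ck 1 (\<lambda>x. v k x $ i)" and g: "\<And>i. Ck 1 (\<lambda>x. g x $ i)"
    and lim: "(\<lambda>k. \<integral>\<^sup>+ x\<in>frontier \<Omega>. ennreal (norm (v k x - g x) powr q) \<partial>hausdorff1) \<longlonglongrightarrow> 0"
  shows "(\<lambda>k. LINT x|lebesgue_on \<Omega>. jacobian (v k) (at x)) \<longlonglongrightarrow> (LINT x|lebesgue_on \<Omega>. jacobian g (at x))"
proof (intro vec_tendstoI)
  fix i :: 'n and j :: 2
  have \<Omega>_open: "open \<Omega>" "bounded \<Omega>" using \<Omega> by (auto simp: bounded_lipschitz_domain_def)
  define Y where "Y k = (\<integral>\<^sup>+ x\<in>frontier \<Omega>. ennreal (norm (v k x - g x)) \<partial>hausdorff1)" for k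
  have "Y \<longlonglongrightarrow> 0"
    unfolding Y_def
  proof (rule nn_set_integral_norm_tendsto_0[OF _ _ q _ lim])
    show "emeasure hausdorff1 (frontier \<Omega>) < \<infinity>" by (rule emeasure_hausdorff1_frontier_finite[OF \<Omega>])
    show "(\<lambda>x. v k x - g x) \<in> borel_measurable (restrict_space hausdorff1 (frontier \<Omega>))" for k
    proof -
      have "(\<lambda>x. v k x - g x) \<in> borel_measurable borel"
        by (intro borel_measurable_continuous_onI continuous_on_diff Ck_1_components_continuous_on v g)
      then show ?thesis by (intro measurable_restrict_space1) simp
    qed
  qed (simp add: borel_closed)
  then have "(\<lambda>k. 2 * Y k) \<longlonglongrightarrow> 2 * 0" by (intro ennreal_tendsto_cmult) auto
  moreover have "ennreal \<bar>(LINT x:\<Omega>|lebesgue. partial j (\<lambda>x. v k x $ i) x)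
      - (LINT x:\<Omega>|lebesgue. partial j (\<lambda>x. g x $ i) x)\<bar>
      \<le> 2 * Y k" for k
  proof -
    have "(\<integral>\<^sup>+ x\<in>frontier \<Omega>. ennreal \<bar>v k x $ i - g x $ i\<bar> \<partial>hausdorff1) \<le> Y k"
      unfolding Y_def
    proof (intro nn_integral_mono mult_right_mono ennreal_leI)
      show "\<bar>v k x $ i - g x $ i\<bar> \<le> norm (v k x - g x)" for x
        using component_le_norm_cart[of "v k x - g x" i] by simp
    qed simp
    then have "2 * (\<integral>\<^sup>+ x\<in>frontier \<Omega>. ennreal \<bar>v k x $ i - g x $ i\<bar> \<partial>hausdorff1) \<le> 2 * Y k"
      by (rule mult_left_mono) simp
    with abs_integral_partial_diff_le_boundary[OF \<Omega>_open v[of k i] g[of i]] show ?thesis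
      by (rule order.trans)
  qed
  ultimately show "(\<lambda>k. (LINT x|lebesgue_on \<Omega>. jacobian (v k) (at x)) $ i $ j)
      \<longlonglongrightarrow> (LINT x|lebesgue_on \<Omega>. jacobian g (at x)) $ i $ j"
    unfolding integral_jacobian_component[OF \<Omega>_open v] integral_jacobian_component[OF \<Omega>_open g]
    by (intro tendsto_if_ennreal_abs_diff_le) auto
qed

lemma emeasure_lebesgue_bounded_open_finite:
  assumes "open \<Omega>" "bounded \<Omega>"
  shows "emeasure lebesgue \<Omega> < \<infinity>"
  using emeasure_bounded_finite[OF assms(2)] assms(1) by (simp add: main_part_sets)

lemma integral_weak_gradient:
  assumes \<Omega>: "bounded_lipschitz_domain \<Omega>" and q: "1 \<le> q"
    and u: "has_weak_gradient \<Omega> u (weak_gradient \<Omega> u)"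
    and trace: "has_trace \<Omega> q u g" and g: "\<And>i. Ck 1 (\<lambda>x. g x $ i)"
  shows "integrable (lebesgue_on \<Omega>) (weak_gradient \<Omega> u)"
    and "(LINT x|lebesgue_on \<Omega>. weak_gradient \<Omega> u x) = (LINT x|lebesgue_on \<Omega>. jacobian g (at x))"
proof -
  have \<Omega>_open: "open \<Omega>" "bounded \<Omega>" using \<Omega> by (auto simp: bounded_lipschitz_domain_def)
  define G where "G = weak_gradient \<Omega> u"
  have G: "G \<in> borel_measurable (lebesgue_on \<Omega>)"
    using u by (auto simp: has_weak_gradient_def loc_integrable_def G_def)
  obtain v where "\<And>k i. smooth (\<lambda>x. v k x $ i)"
    and interior: "(\<lambda>k. \<integral>\<^sup>+ x\<in>\<Omega>. ennreal (norm (jacobian (v k) (at x) - G x) powr q) \<partial>lebesgue) \<longlonglongrightarrow> 0"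
    and boundary: "(\<lambda>k. \<integral>\<^sup>+ x\<in>frontier \<Omega>. ennreal (norm (v k x - g x) powr q) \<partial>hausdorff1) \<longlonglongrightarrow> 0"
    using trace unfolding has_trace_def G_def by blast
  then have v: "Ck 1 (\<lambda>x. v k x $ i)" for k i by (intro smooth_imp_Ck)
  define J where "J k x = jacobian (v k) (at x)" for k x
  have J: "integrable (lebesgue_on \<Omega>) (J k)" for k
    unfolding J_def using \<Omega>_open v by (rule integrable_jacobian)
  have "(\<lambda>k. \<integral>\<^sup>+ x\<in>\<Omega>. ennreal (norm (J k x - G x)) \<partial>lebesgue) \<longlonglongrightarrow> 0"
    using interior \<Omega>_open q emeasure_lebesgue_bounded_open_finite[OF \<Omega>_open]
      G borel_measurable_integrable[OF J]
    by (intro nn_set_integral_norm_tendsto_0) (auto simp: J_def[abs_def])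
  then have lim: "(\<lambda>k. \<integral>\<^sup>+ x. ennreal (norm (J k x - G x)) \<partial>lebesgue_on \<Omega>) \<longlonglongrightarrow> 0"
    using \<Omega>_open(1) by (simp add: nn_integral_restrict_space)
  obtain k where k: "(\<integral>\<^sup>+ x. ennreal (norm (J k x - G x)) \<partial>lebesgue_on \<Omega>) < 1"
    using order_tendstoD(2)[OF lim, of 1] by (auto simp: eventually_sequentially)
  then have "integrable (lebesgue_on \<Omega>) (\<lambda>x. J k x - G x)"
    using G J by (intro integrableI_bounded borel_measurable_diff) (auto intro: order.strict_trans)
  from Bochner_Integration.integrable_diff[OF J[of k] this]
  have G_integrable: "integrable (lebesgue_on \<Omega>) G"
    by simp
  then show "integrable (lebesgue_on \<Omega>) (weak_gradient \<Omega> u)" by (simp add: G_def)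
  have "(\<lambda>k. LINT x|lebesgue_on \<Omega>. J k x) \<longlonglongrightarrow> (LINT x|lebesgue_on \<Omega>. G x)"
    using J G_integrable lim by (rule tendsto_L1_int)
  moreover have "(\<lambda>k. LINT x|lebesgue_on \<Omega>. J k x) \<longlonglongrightarrow> (LINT x|lebesgue_on \<Omega>. jacobian g (at x))"
    unfolding J_def using \<Omega> q v g boundary by (rule integral_jacobian_tendsto)
  ultimately show "(LINT x|lebesgue_on \<Omega>. weak_gradient \<Omega> u x)
      = (LINT x|lebesgue_on \<Omega>. jacobian g (at x))"
    unfolding G_def by (rule LIMSEQ_unique)
qed

lemma Ck_1_u_lin: "Ck 1 (\<lambda>x. u_lin lam x $ i)"
proof -
  have "(\<lambda>x. u_lin lam x $ i) = (\<lambda>x. lam * x $ i)" by (simp add: u_lin_def)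
  then show ?thesis by (simp only:) (intro elementary_smooth_Ck elementary_smooth.intros)
qed

lemma jacobian_u_lin: "jacobian (u_lin lam) (at x) = lam *\<^sub>R mat 1"
proof -
  have "frechet_derivative (u_lin lam) (at x) = (\<lambda>h. lam *\<^sub>R h)"
    unfolding u_lin_def[abs_def]
    by (rule frechet_derivative_at[symmetric]) (auto intro!: derivative_eq_intros)
  then show ?thesis by (simp add: jacobian_def matrix_def vec_eq_iff mat_def axis_def)
qed

subsection \<open>The pointwise lower bound\<close>

lemma concave_on_powr:
  assumes "0 \<le> p" "p \<le> 1"
  shows "concave_on {0<..} (\<lambda>x :: real. x powr p)"
  using assms
  by (intro f''_le0_imp_concave derivative_eq_intros | simp add: mult_nonneg_nonpos mult_nonpos_nonneg)+

lemma powr_above_tangent: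
  fixes x y q :: real
  assumes "0 \<le> x" "0 < y" "1 \<le> q"
  shows "y powr q + q * y powr (q - 1) * (x - y) \<le> x powr q"
proof (cases "x = 0")
  case True
  have "y powr (q - 1) * y = y powr q" using assms by (simp add: powr_diff)
  then have "y powr q + q * y powr (q - 1) * (x - y) = (1 - q) * y powr q"
    using True by (simp add: algebra_simps)
  also have "\<dots> \<le> 0" using assms by (simp add: mult_nonpos_nonneg)
  also have "0 \<le> x powr q" by simp
  finally show ?thesis .
next
  case False
  have "((\<lambda>x. x powr q) has_real_derivative q * y powr (q - 1)) (at y within {0<..})"
    using assms by (auto intro!: derivative_eq_intros)
  then have "q * y powr (q - 1) * (x - y) \<le> x powr q - y powr q"
    using assms False
    by (intro convex_on_imp_above_tangent[OF powr_convex]) (auto simp: interior_open)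
  then show ?thesis by linarith
qed

lemma power2_powr_half [simp]: "((x :: real)\<^sup>2) powr (q / 2) = \<bar>x\<bar> powr q"
  using powr_powr[of "\<bar>x\<bar>" 2 "q / 2"] by simp

lemma scaled_powr_above_tangent_at_1:
  fixes a q :: real
  assumes "1 < q" "1 < a"
  obtains e where "0 < e" "\<And>x. 0 \<le> x \<Longrightarrow> 1 + q * (x - 1) + e * (1 + x powr q) \<le> a * x powr q"
proof -
  define b y where "b = (1 + a) / 2" and "y = b powr (- (1 / (q - 1)))"
  define e where "e = min ((q - 1) * (1 - y)) ((a - 1) / 2)"
  have b: "1 < b" using assms by (simp add: b_def)
  have y: "0 < y" "y < 1" using b assms by (auto simp: y_def powr_less_one)
  have slope: "b * y powr (q - 1) = 1"
    using b assms by (simp add: y_def powr_powr powr_neg_one)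
  have "b * y powr q = y * (b * y powr (q - 1))"
    using y powr_mult_base[of y "q - 1"] by (simp add: mult.left_commute)
  then have value_y: "b * y powr q = y" using slope by simp
  show thesis
  proof
    show "0 < e" using assms y by (simp add: e_def)
    fix x :: real assume x: "0 \<le> x"
    have "b * (y powr q + q * y powr (q - 1) * (x - y)) \<le> b * x powr q"
      using b x y assms by (intro mult_left_mono powr_above_tangent) auto
    moreover have "b * (y powr q + q * y powr (q - 1) * (x - y))
        = b * y powr q + q * (b * y powr (q - 1)) * (x - y)"
      by (simp add: algebra_simps)
    moreover have "e + e * x powr q \<le> (q - 1) * (1 - y) + (a - 1) / 2 * x powr q"
      unfolding e_def by (intro add_mono mult_right_mono min.cobounded1 min.cobounded2) simp
    moreover have "a * x powr q = b * x powr q + (a - 1) / 2 * x powr q"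
      by (simp add: b_def field_simps)
    moreover have "1 + q * (x - 1) + e * (1 + x powr q)
        = y + q * (x - y) + (e + e * x powr q) - (q - 1) * (1 - y)"
      by (simp add: algebra_simps)
    ultimately show "1 + q * (x - 1) + e * (1 + x powr q) \<le> a * x powr q"
      unfolding slope value_y by linarith
  qed
qed

lemma powr_add_le:
  fixes x y p :: real
  assumes "0 \<le> x" "0 \<le> y" "p \<le> 1"
  shows "(x + y) powr p \<le> x powr p + y powr p"
proof (cases "x = 0 \<or> y = 0")
  case False
  then have pos: "0 < x" "0 < y" using assms by auto
  have "(x + y) powr p = x * (x + y) powr (p - 1) + y * (x + y) powr (p - 1)"
    using pos powr_mult_base[of "x + y" "p - 1"] by (simp add: distrib_right)
  also have "\<dots> \<le> x * x powr (p - 1) + y * y powr (p - 1)"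
    using pos assms by (intro add_mono mult_left_mono powr_mono2') auto
  also have "\<dots> = x powr p + y powr p"
    using pos powr_mult_base[of x "p - 1"] powr_mult_base[of y "p - 1"] by simp
  finally show ?thesis .
qed auto

definition min_powr :: "real \<Rightarrow> real \<Rightarrow> real" where
  "min_powr p z = min z (z powr p)"

lemma min_powr_nonneg: "0 \<le> z \<Longrightarrow> 0 \<le> min_powr p z"
  by (simp add: min_powr_def)

lemma min_powr_mono: "0 \<le> p \<Longrightarrow> 0 \<le> x \<Longrightarrow> x \<le> y \<Longrightarrow> min_powr p x \<le> min_powr p y"
  unfolding min_powr_def by (intro min.mono powr_mono2)

lemma min_powr_power2: "min_powr (q / 2) (r\<^sup>2) = min (r\<^sup>2) (r powr q)" if "0 \<le> r"
  using that by (simp add: min_powr_def)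

lemma min_powr_add_le:
  assumes "0 \<le> x" "0 \<le> y" "p \<le> 1"
  shows "min_powr p (x + y) \<le> min_powr p x + y"
proof (cases "x = 0")
  case False
  then have x: "0 < x" using assms by simp
  have factored: "min_powr p z = z * min 1 (z powr (p - 1))" if "0 \<le> z" for z
    using that powr_mult_base[of z "p - 1"] by (simp add: min_powr_def min_mult_distrib_left)
  have "min_powr p (x + y) = x * min 1 ((x + y) powr (p - 1)) + y * min 1 ((x + y) powr (p - 1))"
    using assms by (simp add: factored distrib_right)
  also have "\<dots> \<le> x * min 1 (x powr (p - 1)) + y * 1"
    using x assms by (intro add_mono mult_left_mono min.mono powr_mono2') auto
  finally show ?thesis using x by (simp add: factored)
qed (simp add: min_powr_def)

text \<open>The constant in the hypothesis on \<open>\<lambda>\<close> is the maximum of \<open>t (1 + t\<^sup>2)\<^bsup>-q/2\<^esup>\<close>.\<close>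

lemma le_powr_one_plus_square:
  fixes q t :: real
  assumes q: "1 < q" and t: "0 \<le> t"
  shows "t \<le> (q - 1) powr ((q - 1) / 2) * q powr (- q / 2) * (1 + t\<^sup>2) powr (q / 2)"
proof (cases "t = 0")
  case False
  define v where "v = (1 / (q - 1)) powr ((q - 1) / q) * (t\<^sup>2) powr (1 / q)"
  have "v \<le> (q - 1) / q * (1 / (q - 1)) + 1 / q * t\<^sup>2"
    unfolding v_def using q False by (intro Youngs_inequality_0) (auto simp: field_simps)
  also have "\<dots> = (1 + t\<^sup>2) / q" using q by (simp add: field_simps)
  finally have "v powr (q / 2) \<le> ((1 + t\<^sup>2) / q) powr (q / 2)"
    using q by (intro powr_mono2) (auto simp: v_def)
  moreover have "v powr (q / 2) = t / (q - 1) powr ((q - 1) / 2)"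
  proof -
    have "(t\<^sup>2) powr (1 / 2) = t" using t by simp
    then show ?thesis using q by (simp add: v_def powr_mult powr_powr powr_divide)
  qed
  ultimately show ?thesis
    using q by (simp add: powr_divide powr_minus_divide field_simps)
qed simp

lemma det_slope_le_powr:
  fixes k lam q s :: real
  assumes q: "1 < q" and k: "0 < k" and lam: "0 < lam" and s: "0 \<le> s"
    and small: "1 / (2 powr (3 - q) * k * lam powr (2 - q)) > (q - 1) powr ((q - 1) / 2) * q powr (- q / 2)"
  shows "k * lam * (s - lam) \<le> 2 powr (q - 3) * s powr q"
proof (cases "s \<le> lam")
  case True
  then have "k * lam * (s - lam) \<le> 0" using k lam by (simp add: mult_le_0_iff)
  also have "0 \<le> 2 powr (q - 3) * s powr q" by simp
  finally show ?thesis .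
next
  case False
  define \<kappa> t where "\<kappa> = (q - 1) powr ((q - 1) / 2) * q powr (- q / 2)" and "t = (s - lam) / lam"
  have t: "0 \<le> t" "s = lam * (1 + t)" using False lam by (auto simp: t_def field_simps)
  have "t \<le> \<kappa> * (1 + t\<^sup>2) powr (q / 2)"
    unfolding \<kappa>_def using q t by (intro le_powr_one_plus_square)
  also have "\<dots> \<le> \<kappa> * ((1 + t)\<^sup>2) powr (q / 2)"
    using q t by (intro mult_left_mono powr_mono2) (auto simp: \<kappa>_def power2_sum)
  finally have t_le: "t \<le> \<kappa> * (1 + t) powr q" using t by simp
  have \<kappa>: "\<kappa> * (k * lam powr (2 - q)) \<le> 2 powr (q - 3)"
  proof -
    have "\<kappa> * (2 powr (3 - q) * k * lam powr (2 - q)) < 1"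
      using small k lam by (simp add: \<kappa>_def field_simps)
    moreover have "2 powr (3 - q) = 1 / 2 powr (q - 3)"
      using powr_minus_divide[of 2 "q - 3"] by simp
    ultimately show ?thesis by (simp add: divide_less_eq mult_ac)
  qed
  have lam2: "lam\<^sup>2 = lam powr (2 - q) * lam powr q"
    using lam by (simp flip: powr_add)
  have "k * lam * (s - lam) = k * lam\<^sup>2 * t" by (simp add: t(2) power2_eq_square algebra_simps)
  also have "\<dots> \<le> k * lam\<^sup>2 * (\<kappa> * (1 + t) powr q)" using t_le k by (intro mult_left_mono) auto
  also have "\<dots> = \<kappa> * (k * lam powr (2 - q)) * s powr q"
    by (simp add: t(2) powr_mult lam2 mult_ac)
  also have "\<dots> \<le> 2 powr (q - 3) * s powr q" using \<kappa> by (intro mult_right_mono) auto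
  finally show ?thesis .
qed

text \<open>A matrix with \<open>det > 0\<close> whose singular values have sum \<open>s\<close> and squared difference \<open>D\<close> has
  \<open>|A|\<^sup>2 = (s\<^sup>2 + D) / 2\<close> and \<open>det A = (s\<^sup>2 - D) / 4\<close>.\<close>

definition sv_energy :: "real \<Rightarrow> real \<Rightarrow> real \<Rightarrow> real \<Rightarrow> real" where
  "sv_energy q k s D = ((s\<^sup>2 + D) / 2) powr (q / 2) + k * ((s\<^sup>2 - D) / 4)"

definition sv_slope :: "real \<Rightarrow> real \<Rightarrow> real \<Rightarrow> real" where
  "sv_slope q k lam = q * (2 * lam\<^sup>2) powr (q / 2) / (2 * lam) + k * lam"

text \<open>The tangent at \<open>2\<lambda>\<close> to the energy \<open>s \<mapsto> sv_energy q k s 0\<close> of the multiples of the identity.\<close>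

definition sv_tangent :: "real \<Rightarrow> real \<Rightarrow> real \<Rightarrow> real \<Rightarrow> real" where
  "sv_tangent q k lam s = (2 * lam\<^sup>2) powr (q / 2) + k * lam\<^sup>2 + sv_slope q k lam * (s - 2 * lam)"

lemma sv_energy_isotropic_ge:
  assumes q: "1 < q" and lam: "0 < lam" and s: "0 \<le> s"
  shows "sv_tangent q k lam s + k / 4 * (s - 2 * lam)\<^sup>2 \<le> sv_energy q k s 0"
proof -
  define C x where "C = (2 * lam\<^sup>2) powr (q / 2)" and "x = s / (2 * lam)"
  have x: "0 \<le> x" "s = 2 * lam * x" using s lam by (auto simp: x_def)
  have "C * (1 + q * (x - 1)) \<le> C * x powr q"
    using powr_above_tangent[of x 1 q] x q by (intro mult_left_mono) (auto simp: C_def)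
  also have "\<dots> = (2 * lam\<^sup>2 * x\<^sup>2) powr (q / 2)" using x by (simp add: C_def powr_mult)
  also have "2 * lam\<^sup>2 * x\<^sup>2 = s\<^sup>2 / 2" by (simp add: x(2) power2_eq_square)
  finally have "C * (1 + q * (x - 1)) \<le> (s\<^sup>2 / 2) powr (q / 2)" .
  moreover have "sv_tangent q k lam s + k / 4 * (s - 2 * lam)\<^sup>2 = C * (1 + q * (x - 1)) + k * (s\<^sup>2 / 4)"
    using lam unfolding sv_tangent_def sv_slope_def C_def[symmetric]
    by (simp add: x(2) field_simps power2_eq_square)
  ultimately show ?thesis by (simp add: sv_energy_def)
qed

text \<open>With \<open>b = 2\<^bsup>q/2\<^esup>\<close> the claim \<open>b - b\<^sup>3/8 > 1\<close> reads \<open>(b - 2)(b\<^sup>2 + 2b - 4) < 0\<close>.\<close>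

lemma powr_half_minus_cube_gt_1:
  fixes q :: real
  assumes "1 < q" "q < 2"
  shows "1 < (1 - 2 powr (q - 3)) * 2 powr (q / 2)"
proof -
  define b :: real where "b = 2 powr (q / 2)"
  have b2: "b < 2" using powr_less_mono[of "q / 2" 1 2] assms by (simp add: b_def)
  have "2 powr (1 / 2) < b" unfolding b_def using assms by (intro powr_less_mono) auto
  then have "sqrt 2 < b" by (simp add: powr_half_sqrt)
  moreover have "7 / 5 < sqrt 2" by (intro real_less_rsqrt) (simp add: power2_eq_square)
  ultimately have b1: "7 / 5 < b" by linarith
  have "(7 / 5)\<^sup>2 < b\<^sup>2" using b1 by (intro power_strict_mono) auto
  then have "0 < b\<^sup>2 + 2 * b - 4" using b1 by (simp add: power2_eq_square)
  then have "0 < (2 - b) * (b\<^sup>2 + 2 * b - 4)" using b2 by simp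
  then have "1 < (1 - b\<^sup>2 / 8) * b" by (simp add: field_simps power2_eq_square)
  also have "b\<^sup>2 / 8 = 2 powr (q - 3)" by (simp add: b_def powr_diff powr_power)
  finally show ?thesis by (simp add: b_def)
qed

lemma powr_eq_scaled_powr:
  fixes s lam q :: real
  assumes "0 \<le> s" "0 < lam"
  shows "s powr q = 2 powr (q / 2) * ((2 * lam\<^sup>2) powr (q / 2) * (s / (2 * lam)) powr q)"
proof -
  have "s\<^sup>2 = 2 * (2 * lam\<^sup>2 * (s / (2 * lam))\<^sup>2)"
    using assms by (simp add: power2_eq_square)
  then have "(s\<^sup>2) powr (q / 2)
      = 2 powr (q / 2) * ((2 * lam\<^sup>2) powr (q / 2) * ((s / (2 * lam))\<^sup>2) powr (q / 2))"
    by (simp only: powr_mult)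
  then show ?thesis using assms by simp
qed

lemma sv_energy_collapsed_ge:
  assumes q: "1 < q" "q < 2" and lam: "0 < lam"
    and slope: "\<And>s. 0 \<le> s \<Longrightarrow> k * lam * (s - lam) \<le> 2 powr (q - 3) * s powr q"
  obtains e where "0 < e"
    "\<And>s. 0 \<le> s \<Longrightarrow> sv_tangent q k lam s + e * (1 + s powr q) \<le> sv_energy q k s (s\<^sup>2)"
proof -
  define C where "C = (2 * lam\<^sup>2) powr (q / 2)"
  have C: "0 < C" using lam by (simp add: C_def)
  obtain d where d: "0 < d"
    "\<And>x. 0 \<le> x \<Longrightarrow> 1 + q * (x - 1) + d * (1 + x powr q) \<le> (1 - 2 powr (q - 3)) * 2 powr (q / 2) * x powr q"
    using scaled_powr_above_tangent_at_1[OF q(1) powr_half_minus_cube_gt_1[OF q]] by metis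
  define e where "e = d * min C (1 / 2 powr (q / 2))"
  have e: "0 < e" "e \<le> d * C" "e \<le> d * (1 / 2 powr (q / 2))"
    unfolding e_def using d C by (simp, (intro mult_left_mono; simp)+)
  show thesis
  proof (rule that[OF e(1)])
    fix s :: real assume s: "0 \<le> s"
    define x where "x = s / (2 * lam)"
    have x: "0 \<le> x" "s = 2 * lam * x" using s lam by (auto simp: x_def)
    have s_powr: "s powr q = 2 powr (q / 2) * (C * x powr q)"
      unfolding C_def x_def using s lam by (rule powr_eq_scaled_powr)
    have "C * (1 + q * (x - 1) + d * (1 + x powr q))
        \<le> C * ((1 - 2 powr (q - 3)) * 2 powr (q / 2) * x powr q)"
      using C d(2)[OF x(1)] by (intro mult_left_mono) auto
    also have "\<dots> = s powr q - 2 powr (q - 3) * s powr q"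
      by (simp add: s_powr algebra_simps)
    finally have "C + q * C * (x - 1) + k * lam * (s - lam) + d * C * (1 + x powr q) \<le> s powr q"
      using slope[OF s] by (simp add: algebra_simps)
    moreover have "C + q * C * (x - 1) + k * lam * (s - lam) = sv_tangent q k lam s"
      using lam unfolding sv_tangent_def sv_slope_def C_def[symmetric]
      by (simp add: x(2) field_simps power2_eq_square)
    moreover have "e * (1 + s powr q) \<le> d * C * (1 + x powr q)"
    proof -
      have "e + e * s powr q \<le> d * C + d * (1 / 2 powr (q / 2)) * s powr q"
        using e by (intro add_mono mult_right_mono) auto
      then show ?thesis by (simp add: s_powr algebra_simps)
    qed
    ultimately show "sv_tangent q k lam s + e * (1 + s powr q) \<le> sv_energy q k s (s\<^sup>2)"
      using s by (simp add: sv_energy_def)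
  qed
qed

lemma sv_energy_ge_interpolation:
  assumes q: "0 < q" "q < 2" and t: "0 \<le> t" "t \<le> 1" and s: "0 \<le> s"
  shows "(1 - t) * sv_energy q k s 0 + t * sv_energy q k s (s\<^sup>2) \<le> sv_energy q k s (t * s\<^sup>2)"
proof (cases "s = 0")
  case False
  then have "(1 - t) * (s\<^sup>2 / 2) powr (q / 2) + t * (s\<^sup>2) powr (q / 2)
      \<le> ((1 - t) * (s\<^sup>2 / 2) + t * s\<^sup>2) powr (q / 2)"
    using concave_onD[OF concave_on_powr[of "q / 2"], of t "s\<^sup>2 / 2" "s\<^sup>2"] q t by simp
  also have "(1 - t) * (s\<^sup>2 / 2) + t * s\<^sup>2 = (s\<^sup>2 + t * s\<^sup>2) / 2" by (simp add: field_simps)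
  finally show ?thesis by (simp add: sv_energy_def algebra_simps add_divide_distrib diff_divide_distrib)
qed (simp add: sv_energy_def)

lemma scaled_square_le:
  fixes s t lam :: real
  assumes lam: "0 < lam" and s: "0 \<le> s" and t: "0 \<le> t" "t \<le> 1"
  shows "t * s\<^sup>2 \<le> 4 * (s - 2 * lam)\<^sup>2 + 16 * lam\<^sup>2 * t"
proof (cases "s \<le> 4 * lam")
  case True
  then have "t * s\<^sup>2 \<le> t * (4 * lam)\<^sup>2" using s t by (intro mult_left_mono power_mono) auto
  then show ?thesis by (simp add: power_mult_distrib mult_ac add_increasing)
next
  case False
  then have "s\<^sup>2 \<le> (2 * (s - 2 * lam))\<^sup>2" using lam by (intro power_mono) auto
  then have "s\<^sup>2 \<le> 4 * (s - 2 * lam)\<^sup>2" unfolding power_mult_distrib by simp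
  moreover have "t * s\<^sup>2 \<le> s\<^sup>2" using t by (simp add: mult_left_le_one_le)
  moreover have "0 \<le> 16 * lam\<^sup>2 * t" using t by simp
  ultimately show ?thesis by linarith
qed

lemma powr_shifted_square_le:
  fixes s t lam q :: real
  assumes lam: "0 < lam" and q: "0 < q" "q < 2" and s: "0 \<le> s" and t: "0 \<le> t" "t \<le> 1"
  shows "((s - 2 * lam)\<^sup>2 + t * s\<^sup>2) powr (q / 2) \<le> (2 + (2 * lam) powr q) * (1 + s powr q)"
proof -
  have "(s - 2 * lam)\<^sup>2 \<le> s\<^sup>2 + (2 * lam)\<^sup>2" using s lam by (simp add: power2_diff)
  moreover have "t * s\<^sup>2 \<le> s\<^sup>2" using t by (simp add: mult_left_le_one_le)
  ultimately have "(s - 2 * lam)\<^sup>2 + t * s\<^sup>2 \<le> 2 * s\<^sup>2 + (2 * lam)\<^sup>2" by simp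
  then have "((s - 2 * lam)\<^sup>2 + t * s\<^sup>2) powr (q / 2) \<le> (2 * s\<^sup>2 + (2 * lam)\<^sup>2) powr (q / 2)"
    using q t by (intro powr_mono2) auto
  also have "\<dots> \<le> (2 * s\<^sup>2) powr (q / 2) + ((2 * lam)\<^sup>2) powr (q / 2)"
    using q by (intro powr_add_le) auto
  also have "\<dots> = 2 powr (q / 2) * s powr q + (2 * lam) powr q"
    using s lam by (simp only: powr_mult[of 2 "s\<^sup>2"] power2_powr_half)
  also have "\<dots> \<le> 2 * s powr q + (2 * lam) powr q"
    using powr_mono[of "q / 2" 1 2] q by (intro add_right_mono mult_right_mono) auto
  also have "\<dots> \<le> (2 + (2 * lam) powr q) * (1 + s powr q)" by (simp add: distrib_left distrib_right)
  finally show ?thesis .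
qed

lemma min_powr_le_interpolation:
  fixes k e lam q :: real
  assumes k: "0 < k" and e: "0 < e" and lam: "0 < lam" and q: "0 < q" "q < 2"
  obtains c where "0 < c" "\<And>s t. 0 \<le> s \<Longrightarrow> 0 \<le> t \<Longrightarrow> t \<le> 1 \<Longrightarrow>
    c * min_powr (q / 2) ((s - 2 * lam)\<^sup>2 + t * s\<^sup>2)
      \<le> (1 - t) * (k * (s - 2 * lam)\<^sup>2) + t * (e * (1 + s powr q))"
proof -
  define N where "N = 2 + (2 * lam) powr q"
  define c where "c = min (k / 10) (min (e / (16 * lam\<^sup>2)) (e / (2 * N)))"
  have N: "0 < N" by (simp add: N_def add_pos_nonneg)
  have c: "0 < c" using k e lam N by (simp add: c_def)
  have "c \<le> k / 10" "c \<le> e / (16 * lam\<^sup>2)" "c \<le> e / (2 * N)" by (auto simp: c_def)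
  then have c_le: "c * 10 \<le> k" "c * (16 * lam\<^sup>2) \<le> e" "c * (2 * N) \<le> e"
    using lam N by (auto simp: pos_le_divide_eq)
  show thesis
  proof (rule that[OF c])
    fix s t :: real assume s: "0 \<le> s" and t: "0 \<le> t" "t \<le> 1"
    define X where "X = (s - 2 * lam)\<^sup>2"
    have X: "0 \<le> X" by (simp add: X_def)
    have "c * min_powr (q / 2) (X + t * s\<^sup>2) \<le> (1 - t) * (k * X) + t * (e * (1 + s powr q))"
    proof (cases "t \<le> 1 / 2")
      case True
      have "c * min_powr (q / 2) (X + t * s\<^sup>2) \<le> c * (5 * X + 16 * lam\<^sup>2 * t)"
        using c scaled_square_le[OF lam s t]
        by (intro mult_left_mono) (auto simp: min_powr_def min_le_iff_disj X_def)
      also have "\<dots> = c * 10 * (1 / 2 * X) + c * (16 * lam\<^sup>2) * t" by (simp add: algebra_simps)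
      also have "\<dots> \<le> k * ((1 - t) * X) + e * t"
        using c_le True X t k by (intro add_mono mult_mono mult_right_mono) auto
      also have "\<dots> \<le> (1 - t) * (k * X) + t * (e * (1 + s powr q))"
        using e t by (simp add: algebra_simps)
      finally show ?thesis .
    next
      case False
      have "c * min_powr (q / 2) (X + t * s\<^sup>2) \<le> c * (N * (1 + s powr q))"
        using c powr_shifted_square_le[OF lam q s t]
        by (intro mult_left_mono) (auto simp: min_powr_def min_le_iff_disj X_def N_def)
      also have "\<dots> = c * (2 * N) * (1 / 2 * (1 + s powr q))" by simp
      also have "\<dots> \<le> e * (t * (1 + s powr q))"
        using c_le False e by (intro mult_mono mult_right_mono) auto
      also have "\<dots> \<le> (1 - t) * (k * X) + t * (e * (1 + s powr q))"
        using k t X by (simp add: mult_ac)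
      finally show ?thesis .
    qed
    then show "c * min_powr (q / 2) ((s - 2 * lam)\<^sup>2 + t * s\<^sup>2)
        \<le> (1 - t) * (k * (s - 2 * lam)\<^sup>2) + t * (e * (1 + s powr q))"
      by (simp add: X_def)
  qed
qed

lemma sv_energy_coercive:
  assumes q: "1 < q" "q < 2" and k: "0 < k" and lam: "0 < lam"
    and slope: "\<And>s. 0 \<le> s \<Longrightarrow> k * lam * (s - lam) \<le> 2 powr (q - 3) * s powr q"
  obtains c where "0 < c" "\<And>s D. 0 \<le> s \<Longrightarrow> 0 \<le> D \<Longrightarrow> D \<le> s\<^sup>2 \<Longrightarrow>
    sv_tangent q k lam s + c * min_powr (q / 2) ((s - 2 * lam)\<^sup>2 + D) \<le> sv_energy q k s D"
proof -
  obtain e where e: "0 < e"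
    "\<And>s. 0 \<le> s \<Longrightarrow> sv_tangent q k lam s + e * (1 + s powr q) \<le> sv_energy q k s (s\<^sup>2)"
    using sv_energy_collapsed_ge[OF q lam slope] by blast
  obtain c where c: "0 < c" "\<And>s t. 0 \<le> s \<Longrightarrow> 0 \<le> t \<Longrightarrow> t \<le> 1 \<Longrightarrow>
      c * min_powr (q / 2) ((s - 2 * lam)\<^sup>2 + t * s\<^sup>2)
        \<le> (1 - t) * (k / 4 * (s - 2 * lam)\<^sup>2) + t * (e * (1 + s powr q))"
    using min_powr_le_interpolation[of "k / 4" e lam q] k e lam q by auto
  show thesis
  proof (rule that[OF c(1)])
    fix s D :: real assume s: "0 \<le> s" and D: "0 \<le> D" "D \<le> s\<^sup>2"
    define t where "t = D / s\<^sup>2"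
    have t: "0 \<le> t" "t \<le> 1" "D = t * s\<^sup>2"
      using D by (auto simp: t_def divide_le_eq_1)
    have "sv_tangent q k lam s + c * min_powr (q / 2) ((s - 2 * lam)\<^sup>2 + D)
        \<le> sv_tangent q k lam s + ((1 - t) * (k / 4 * (s - 2 * lam)\<^sup>2) + t * (e * (1 + s powr q)))"
      unfolding t(3) using c(2) s t by (intro add_left_mono) auto
    also have "\<dots> = (1 - t) * (sv_tangent q k lam s + k / 4 * (s - 2 * lam)\<^sup>2)
        + t * (sv_tangent q k lam s + e * (1 + s powr q))"
      by (simp add: algebra_simps)
    also have "\<dots> \<le> (1 - t) * sv_energy q k s 0 + t * sv_energy q k s (s\<^sup>2)"
      using t s q lam e by (intro add_mono mult_left_mono sv_energy_isotropic_ge) auto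
    also have "\<dots> \<le> sv_energy q k s D"
      unfolding t(3) using q t s by (intro sv_energy_ge_interpolation) auto
    finally show "sv_tangent q k lam s + c * min_powr (q / 2) ((s - 2 * lam)\<^sup>2 + D)
        \<le> sv_energy q k s D" .
  qed
qed

definition singular_sum :: "mat2 \<Rightarrow> real" where
  "singular_sum A = sqrt ((trace A)\<^sup>2 + (A $ 1 $ 2 - A $ 2 $ 1)\<^sup>2)"

definition singular_gap :: "mat2 \<Rightarrow> real" where
  "singular_gap A = (A $ 1 $ 1 - A $ 2 $ 2)\<^sup>2 + (A $ 1 $ 2 + A $ 2 $ 1)\<^sup>2"

lemma singular_sum_nonneg: "0 \<le> singular_sum A"
  by (simp add: singular_sum_def)

lemma singular_gap_nonneg: "0 \<le> singular_gap A"
  by (simp add: singular_gap_def)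

lemma trace_le_singular_sum: "trace A \<le> singular_sum A"
  by (simp add: singular_sum_def real_le_rsqrt)

lemma singular_sum_power2: "(singular_sum A)\<^sup>2 = (trace A)\<^sup>2 + (A $ 1 $ 2 - A $ 2 $ 1)\<^sup>2"
  by (simp add: singular_sum_def)

lemma trace_mat2: "trace (A :: mat2) = A $ 1 $ 1 + A $ 2 $ 2"
  by (simp add: trace_def sum_2)

lemma norm_mat2_power2:
  "(norm (A :: mat2))\<^sup>2 = (A $ 1 $ 1)\<^sup>2 + (A $ 1 $ 2)\<^sup>2 + (A $ 2 $ 1)\<^sup>2 + (A $ 2 $ 2)\<^sup>2"
  by (simp add: norm_vec_def L2_set_def sum_2)

lemma det_eq_singular: "det A = ((singular_sum A)\<^sup>2 - singular_gap A) / 4"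
  unfolding singular_sum_power2 singular_gap_def
  by (simp add: trace_mat2 det_2 power2_eq_square field_simps)

lemma norm_power2_eq_singular: "(norm A)\<^sup>2 = ((singular_sum A)\<^sup>2 + singular_gap A) / 2"
  unfolding singular_sum_power2 singular_gap_def norm_mat2_power2
  by (simp add: trace_mat2 power2_eq_square field_simps)

lemma norm_minus_scaled_id_power2_eq_singular:
  "(norm (A - lam *\<^sub>R mat 1))\<^sup>2
    = ((singular_sum A - 2 * lam)\<^sup>2 + singular_gap A) / 2 + 2 * lam * (singular_sum A - trace A)"
  using singular_sum_power2[of A] unfolding singular_gap_def norm_mat2_power2
  by (simp add: trace_mat2 power2_eq_square field_simps mat_def)

lemma sv_energy_singular:
  "sv_energy q k (singular_sum A) (singular_gap A) = norm A powr q + k * det A"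
  by (simp add: sv_energy_def det_eq_singular flip: norm_power2_eq_singular)

lemma sv_tangent_singular_sum:
  "sv_tangent q k lam (singular_sum A)
    = sv_tangent q k lam (trace A) + sv_slope q k lam * (singular_sum A - trace A)"
  by (simp add: sv_tangent_def algebra_simps)

lemma sv_slope_ge:
  assumes "0 \<le> q" "0 < lam"
  shows "k * lam \<le> sv_slope q k lam"
  using assms by (simp add: sv_slope_def)

lemma min_norm_powr_le_singular:
  assumes "0 \<le> q" "q \<le> 2" "0 \<le> lam"
  shows "min ((norm (A - lam *\<^sub>R mat 1))\<^sup>2) (norm (A - lam *\<^sub>R mat 1) powr q)
    \<le> min_powr (q / 2) ((singular_sum A - 2 * lam)\<^sup>2 + singular_gap A)
      + 2 * lam * (singular_sum A - trace A)"
proof -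
  define z where "z = (singular_sum A - 2 * lam)\<^sup>2 + singular_gap A"
  define y where "y = 2 * lam * (singular_sum A - trace A)"
  have z: "0 \<le> z" by (simp add: z_def singular_gap_nonneg)
  have y: "0 \<le> y" using assms trace_le_singular_sum[of A] by (simp add: y_def)
  have "min ((norm (A - lam *\<^sub>R mat 1))\<^sup>2) (norm (A - lam *\<^sub>R mat 1) powr q)
      = min_powr (q / 2) (z / 2 + y)"
    unfolding z_def y_def norm_minus_scaled_id_power2_eq_singular[symmetric]
    by (simp add: min_powr_power2)
  also have "\<dots> \<le> min_powr (q / 2) (z / 2) + y" using z y assms by (intro min_powr_add_le) auto
  also have "\<dots> \<le> min_powr (q / 2) z + y" using z assms by (intro add_right_mono min_powr_mono) auto
  finally show ?thesis by (simp add: z_def y_def)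
qed

lemma norm_powr_plus_det_coercive:
  assumes q: "1 < q" "q < 2" and k: "0 < k" and lam: "0 < lam"
    and slope: "\<And>s. 0 \<le> s \<Longrightarrow> k * lam * (s - lam) \<le> 2 powr (q - 3) * s powr q"
  obtains c where "0 < c" "\<And>A :: mat2. 0 < det A \<Longrightarrow>
    sv_tangent q k lam (trace A)
      + c * min ((norm (A - lam *\<^sub>R mat 1))\<^sup>2) (norm (A - lam *\<^sub>R mat 1) powr q)
    \<le> norm A powr q + k * det A"
proof -
  obtain d where d: "0 < d" "\<And>s D. 0 \<le> s \<Longrightarrow> 0 \<le> D \<Longrightarrow> D \<le> s\<^sup>2 \<Longrightarrow>
      sv_tangent q k lam s + d * min_powr (q / 2) ((s - 2 * lam)\<^sup>2 + D) \<le> sv_energy q k s D"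
    using sv_energy_coercive[OF q k lam slope] by blast
  define c where "c = min d (k / 2)"
  have c: "0 < c" "c \<le> d" "2 * c \<le> k" using d k by (auto simp: c_def)
  show thesis
  proof (rule that[OF c(1)])
    fix A :: mat2 assume A: "0 < det A"
    define M where "M = min_powr (q / 2) ((singular_sum A - 2 * lam)\<^sup>2 + singular_gap A)"
    have M: "0 \<le> M" unfolding M_def by (intro min_powr_nonneg) (simp add: singular_gap_nonneg)
    have gap: "0 \<le> singular_sum A - trace A" using trace_le_singular_sum by simp
    have "c * min ((norm (A - lam *\<^sub>R mat 1))\<^sup>2) (norm (A - lam *\<^sub>R mat 1) powr q)
        \<le> c * (M + 2 * lam * (singular_sum A - trace A))"
      unfolding M_def using q lam c by (intro mult_left_mono min_norm_powr_le_singular) auto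
    also have "\<dots> = c * M + 2 * c * lam * (singular_sum A - trace A)" by (simp add: algebra_simps)
    also have "\<dots> \<le> d * M + k * lam * (singular_sum A - trace A)"
      using c M gap lam by (intro add_mono mult_right_mono) auto
    also have "\<dots> \<le> d * M + sv_slope q k lam * (singular_sum A - trace A)"
      using gap lam q by (intro add_left_mono mult_right_mono sv_slope_ge) auto
    finally have "sv_tangent q k lam (trace A)
        + c * min ((norm (A - lam *\<^sub>R mat 1))\<^sup>2) (norm (A - lam *\<^sub>R mat 1) powr q)
      \<le> sv_tangent q k lam (singular_sum A) + d * M"
      by (simp add: sv_tangent_singular_sum)
    also have "\<dots> \<le> sv_energy q k (singular_sum A) (singular_gap A)"
      unfolding M_def using A
      by (intro d(2) singular_sum_nonneg singular_gap_nonneg) (simp add: det_eq_singular)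
    finally show "sv_tangent q k lam (trace A)
        + c * min ((norm (A - lam *\<^sub>R mat 1))\<^sup>2) (norm (A - lam *\<^sub>R mat 1) powr q)
      \<le> norm A powr q + k * det A"
      by (simp add: sv_energy_singular)
  qed
qed

lemma sqrt_add_square_minus_ge:
  fixes \<tau> w lam :: real
  assumes w: "0 \<le> w" and lam: "0 < lam"
  shows "2 * lam\<^sup>2 * w / (3 * (w + max (4 * lam\<^sup>2) (\<tau>\<^sup>2)) powr (3 / 2)) \<le> sqrt (\<tau>\<^sup>2 + w) - \<tau>"
proof (cases "w = 0")
  case False
  define s N where "s = sqrt (\<tau>\<^sup>2 + w)" and "N = w + max (4 * lam\<^sup>2) (\<tau>\<^sup>2)"
  have s: "0 < s" "s\<^sup>2 = \<tau>\<^sup>2 + w" "\<tau> \<le> s"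
    using w False by (auto simp: s_def real_le_rsqrt add_nonneg_pos)
  have N: "4 * lam\<^sup>2 \<le> N" "s\<^sup>2 \<le> N" "0 < N"
    using w lam s(2) by (auto simp: N_def add_nonneg_pos less_max_iff_disj)
  have "4 * lam\<^sup>2 * s \<le> N * sqrt N" using N s by (intro mult_mono) (auto intro: real_le_rsqrt)
  also have "\<dots> = N powr (3 / 2)" using N powr_mult_base[of N "1 / 2"] by (simp add: powr_half_sqrt)
  finally have N_powr: "4 * lam\<^sup>2 * s \<le> N powr (3 / 2)" .
  have "2 * lam\<^sup>2 * w / (3 * N powr (3 / 2)) \<le> 2 * lam\<^sup>2 * w / (3 * (4 * lam\<^sup>2 * s))"
    using N_powr w s lam N by (intro divide_left_mono mult_left_mono mult_pos_pos) auto
  also have "\<dots> = w / (6 * s)" using lam by simp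
  also have "\<dots> \<le> s - \<tau>"
  proof -
    have "w = (s - \<tau>) * (s + \<tau>)" using s(2) by (simp add: algebra_simps power2_eq_square)
    also have "\<dots> \<le> (s - \<tau>) * (6 * s)" using s by (intro mult_left_mono) auto
    finally show ?thesis using s by (simp add: divide_le_eq)
  qed
  finally show ?thesis by (simp add: s_def N_def)
qed (simp add: real_le_rsqrt)

lemma norm_powr_plus_det_ge_curl:
  fixes A :: mat2
  assumes q: "1 < q" "q < 2" and k: "0 < k" and lam: "0 < lam"
    and slope: "\<And>s. 0 \<le> s \<Longrightarrow> k * lam * (s - lam) \<le> 2 powr (q - 3) * s powr q"
    and A: "0 < det A"
  shows "sv_tangent q k lam (trace A) + lam * k * (2 * lam\<^sup>2 * (A $ 1 $ 2 - A $ 2 $ 1)\<^sup>2 /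
      (3 * ((A $ 1 $ 2 - A $ 2 $ 1)\<^sup>2 + max (4 * lam\<^sup>2) ((trace A)\<^sup>2)) powr (3 / 2)))
    \<le> norm A powr q + k * det A" (is "_ + lam * k * ?Q \<le> _")
proof -
  obtain d where d: "0 < d" "\<And>s D. 0 \<le> s \<Longrightarrow> 0 \<le> D \<Longrightarrow> D \<le> s\<^sup>2 \<Longrightarrow>
      sv_tangent q k lam s + d * min_powr (q / 2) ((s - 2 * lam)\<^sup>2 + D) \<le> sv_energy q k s D"
    using sv_energy_coercive[OF q k lam slope] by blast
  have "lam * k * ?Q \<le> lam * k * (singular_sum A - trace A)"
    unfolding singular_sum_def
    using sqrt_add_square_minus_ge[of "(A $ 1 $ 2 - A $ 2 $ 1)\<^sup>2" lam "trace A"] lam k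
    by (intro mult_left_mono) auto
  also have "\<dots> \<le> sv_slope q k lam * (singular_sum A - trace A)"
    using sv_slope_ge[of q lam k] q lam trace_le_singular_sum[of A]
    by (intro mult_right_mono) (auto simp: mult.commute)
  finally have "sv_tangent q k lam (trace A) + lam * k * ?Q \<le> sv_tangent q k lam (singular_sum A)"
    by (simp add: sv_tangent_singular_sum)
  also have "\<dots> \<le> sv_tangent q k lam (singular_sum A)
      + d * min_powr (q / 2) ((singular_sum A - 2 * lam)\<^sup>2 + singular_gap A)"
    using d(1) singular_gap_nonneg[of A] by (simp add: min_powr_nonneg)
  also have "\<dots> \<le> sv_energy q k (singular_sum A) (singular_gap A)"
    using A by (intro d(2) singular_sum_nonneg singular_gap_nonneg) (simp add: det_eq_singular)
  finally show ?thesis by (simp add: sv_energy_singular)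
qed

subsection \<open>The excess\<close>

lemma admissible_h_tangent:
  assumes h: "admissible_h h" and s: "0 < s" and t: "0 < t"
  shows "(enn2real \<circ> h) s + deriv (enn2real \<circ> h) s * (t - s) \<le> (enn2real \<circ> h) t"
proof -
  have "(enn2real \<circ> h) differentiable (at s within {0<..})"
    using h s by (auto simp: admissible_h_def C1_on_pos_def differentiable_on_def)
  then have "((enn2real \<circ> h) has_real_derivative deriv (enn2real \<circ> h) s) (at s)"
    using s by (simp add: at_within_open[of s "{0<..}"] DERIV_deriv_iff_real_differentiable)
  then have "((enn2real \<circ> h) has_real_derivative deriv (enn2real \<circ> h) s) (at s within {0<..})"
    by (rule has_field_derivative_at_within)
  then have "deriv (enn2real \<circ> h) s * (t - s) \<le> (enn2real \<circ> h) t - (enn2real \<circ> h) s"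
    using h s t unfolding admissible_h_def
    by (intro convex_on_imp_above_tangent[of "{0<..}"])
      (simp_all only: interior_open open_greaterThan greaterThan_iff connected_Ioi)
  then show ?thesis by linarith
qed

lemma admissible_h_measurable:
  assumes h: "admissible_h h"
  shows "(enn2real \<circ> h) \<in> borel_measurable borel"
proof -
  have "(\<lambda>t. if t \<in> {0<..} then (enn2real \<circ> h) t else 0) \<in> borel_measurable borel"
  proof (rule borel_measurable_continuous_on_if)
    show "continuous_on {0<..} (enn2real \<circ> h)"
      using h unfolding admissible_h_def C1_on_pos_def by (blast intro: differentiable_imp_continuous_on)
  qed auto
  moreover have "(\<lambda>t. if t \<in> {0<..} then (enn2real \<circ> h) t else 0) = enn2real \<circ> h"
    using h by (auto simp: admissible_h_def fun_eq_iff not_less)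
  ultimately show ?thesis by simp
qed

lemma stored_energy_eq_ennreal:
  assumes "admissible_h h" "0 < det A"
  shows "stored_energy q h A = ennreal (norm A powr q + (enn2real \<circ> h) (det A))"
  using assms by (simp add: stored_energy_def admissible_h_def)

lemma det_scaled_id: "det (lam *\<^sub>R mat 1 :: mat2) = lam\<^sup>2"
  by (simp add: det_2 mat_def power2_eq_square)

lemma norm_scaled_id_powr: "norm (lam *\<^sub>R mat 1 :: mat2) powr q = (2 * lam\<^sup>2) powr (q / 2)"
proof -
  have "(norm (lam *\<^sub>R mat 1 :: mat2))\<^sup>2 = 2 * lam\<^sup>2"
    unfolding norm_mat2_power2 by (simp add: mat_def)
  then show ?thesis using power2_powr_half[of "norm (lam *\<^sub>R mat 1 :: mat2)" q] by simp
qed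

lemma nn_integral_add_integral_le:
  fixes f g l :: "'a \<Rightarrow> real"
  assumes g: "g \<in> borel_measurable M" "\<And>x. 0 \<le> g x"
    and l: "integrable M l" "0 \<le> integral\<^sup>L M l"
    and f: "\<And>x. 0 \<le> f x" and c: "0 < c" and le: "AE x in M. l x + c * f x \<le> g x"
  shows "ennreal c * (\<integral>\<^sup>+ x. ennreal (f x) \<partial>M) + ennreal (integral\<^sup>L M l) \<le> (\<integral>\<^sup>+ x. ennreal (g x) \<partial>M)"
proof (cases "(\<integral>\<^sup>+ x. ennreal (g x) \<partial>M) = \<infinity>")
  case False
  then have g_integrable: "integrable M g" using g by (intro integrableI_nonneg) (auto simp: less_top)
  define r where "r x = (g x - l x) / c" for x
  have f_le_r: "AE x in M. f x \<le> r x"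
    using le by eventually_elim (use c in \<open>simp add: r_def field_simps\<close>)
  have r: "integrable M r" "integral\<^sup>L M r = (integral\<^sup>L M g - integral\<^sup>L M l) / c"
    using g_integrable l(1) by (simp_all add: r_def[abs_def])
  have r_nonneg: "AE x in M. 0 \<le> r x"
    using f_le_r by eventually_elim (use f in \<open>auto intro: order.trans\<close>)
  have "(\<integral>\<^sup>+ x. ennreal (f x) \<partial>M) \<le> (\<integral>\<^sup>+ x. ennreal (r x) \<partial>M)"
    using f_le_r by (intro nn_integral_mono_AE) (auto intro: ennreal_leI)
  also have "\<dots> = ennreal (integral\<^sup>L M r)" by (rule nn_integral_eq_integral[OF r(1) r_nonneg])
  finally have "ennreal c * (\<integral>\<^sup>+ x. ennreal (f x) \<partial>M) \<le> ennreal c * ennreal (integral\<^sup>L M r)"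
    by (rule mult_left_mono) simp
  also have "\<dots> = ennreal (integral\<^sup>L M g - integral\<^sup>L M l)"
    using c by (simp add: r(2) flip: ennreal_mult')
  finally have "ennreal c * (\<integral>\<^sup>+ x. ennreal (f x) \<partial>M) + ennreal (integral\<^sup>L M l)
      \<le> ennreal (integral\<^sup>L M g - integral\<^sup>L M l) + ennreal (integral\<^sup>L M l)"
    by (rule add_right_mono)
  also have "\<dots> = ennreal (integral\<^sup>L M g)"
  proof -
    have "0 \<le> integral\<^sup>L M r" using r_nonneg by (rule integral_nonneg_AE)
    then have "0 \<le> integral\<^sup>L M g - integral\<^sup>L M l" using c by (simp add: r(2) zero_le_divide_iff)
    then show ?thesis using l(2) by (simp flip: ennreal_plus)
  qed
  also have "\<dots> = (\<integral>\<^sup>+ x. ennreal (g x) \<partial>M)"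
    using g g_integrable by (intro nn_integral_eq_integral[symmetric]) auto
  finally show ?thesis .
qed simp

lemma energy_u_lin:
  assumes \<Omega>: "open \<Omega>" "bounded \<Omega>" and h: "admissible_h h" and lam: "0 < lam"
  shows "energy \<Omega> q h (u_lin lam)
    = ennreal ((norm (lam *\<^sub>R mat 1 :: mat2) powr q + (enn2real \<circ> h) (lam\<^sup>2)) * measure lebesgue \<Omega>)"
proof -
  let ?W = "norm (lam *\<^sub>R mat 1 :: mat2) powr q + (enn2real \<circ> h) (lam\<^sup>2)"
  have "AE x in lebesgue_on \<Omega>. weak_gradient \<Omega> (u_lin lam) x = lam *\<^sub>R mat 1"
    using weak_gradient_AE_eq[OF \<Omega>(1) has_weak_gradient_jacobian[OF \<Omega> Ck_1_u_lin]]
    by (simp add: jacobian_u_lin)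
  then have "AE x in lebesgue_on \<Omega>. stored_energy q h (weak_gradient \<Omega> (u_lin lam) x) = ennreal ?W"
    by eventually_elim
      (use stored_energy_eq_ennreal[OF h, of "lam *\<^sub>R mat 1" q] lam in \<open>simp only: det_scaled_id, simp\<close>)
  then have "(\<integral>\<^sup>+ x. stored_energy q h (weak_gradient \<Omega> (u_lin lam) x) \<partial>lebesgue_on \<Omega>)
      = (\<integral>\<^sup>+ x. ennreal ?W \<partial>lebesgue_on \<Omega>)"
    by (rule nn_integral_cong_AE)
  then have "energy \<Omega> q h (u_lin lam) = (\<integral>\<^sup>+ x. ennreal ?W \<partial>lebesgue_on \<Omega>)"
    using \<Omega>(1) by (simp add: energy_def nn_integral_restrict_space)
  also have "\<dots> = ennreal ?W * emeasure lebesgue \<Omega>"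
    using \<Omega>(1) by (simp add: emeasure_restrict_space)
  also have "\<dots> = ennreal (?W * measure lebesgue \<Omega>)"
    using emeasure_lebesgue_bounded_open_finite[OF \<Omega>]
    by (simp add: emeasure_eq_ennreal_measure ennreal_mult)
  finally show ?thesis .
qed

lemma excess_ge_if_energy_ge:
  assumes "X + energy \<Omega> q h (u_lin lam) \<le> energy \<Omega> q h u" "energy \<Omega> q h (u_lin lam) < \<infinity>"
  shows "enn2ereal X \<le> excess \<Omega> q h lam u"
proof -
  have "enn2ereal X + enn2ereal (energy \<Omega> q h (u_lin lam)) \<le> enn2ereal (energy \<Omega> q h u)"
    using assms(1) by (simp add: less_eq_ennreal.rep_eq plus_ennreal.rep_eq)
  then show ?thesis
    unfolding excess_def using assms(2)
    by (cases "energy \<Omega> q h (u_lin lam)") (auto simp: ereal_le_minus)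
qed

lemma borel_measurable_det: "(det :: mat2 \<Rightarrow> real) \<in> borel_measurable borel"
  unfolding det_2[abs_def] by (intro borel_measurable_continuous_onI continuous_intros)

lemma energy_eq_nn_integral:
  assumes "open \<Omega>" "admissible_h h" "AE x in lebesgue_on \<Omega>. 0 < det (weak_gradient \<Omega> u x)"
  shows "energy \<Omega> q h u
    = (\<integral>\<^sup>+ x. ennreal (norm (weak_gradient \<Omega> u x) powr q
        + (enn2real \<circ> h) (det (weak_gradient \<Omega> u x))) \<partial>lebesgue_on \<Omega>)"
proof -
  have "energy \<Omega> q h u = (\<integral>\<^sup>+ x. stored_energy q h (weak_gradient \<Omega> u x) \<partial>lebesgue_on \<Omega>)"
    unfolding energy_def using assms(1) by (simp add: nn_integral_restrict_space)
  also have "\<dots> = (\<integral>\<^sup>+ x. ennreal (norm (weak_gradient \<Omega> u x) powr q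
      + (enn2real \<circ> h) (det (weak_gradient \<Omega> u x))) \<partial>lebesgue_on \<Omega>)"
    using assms(3)
    by (intro nn_integral_cong_AE, eventually_elim) (rule stored_energy_eq_ennreal[OF assms(2)])
  finally show ?thesis .
qed

lemma integral_linear_deviation_weak_gradient:
  fixes T :: "mat2 \<Rightarrow> real"
  assumes \<Omega>: "bounded_lipschitz_domain \<Omega>" and q: "1 \<le> q" and u: "u \<in> admissible \<Omega> q lam"
    and T: "bounded_linear T"
  shows "weak_gradient \<Omega> u \<in> borel_measurable (lebesgue_on \<Omega>)"
    and "integrable (lebesgue_on \<Omega>) (\<lambda>x. T (weak_gradient \<Omega> u x - lam *\<^sub>R mat 1))"
    and "(LINT x|lebesgue_on \<Omega>. T (weak_gradient \<Omega> u x - lam *\<^sub>R mat 1)) = 0"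
proof -
  have \<Omega>_open: "open \<Omega>" "bounded \<Omega>" using \<Omega> by (auto simp: bounded_lipschitz_domain_def)
  have "has_weak_gradient \<Omega> u (weak_gradient \<Omega> u)"
    using u by (auto simp: admissible_def sobolev_W1_def intro: has_weak_gradient_weak_gradient)
  moreover have "has_trace \<Omega> q u (u_lin lam)" using u by (simp add: admissible_def)
  ultimately have G: "integrable (lebesgue_on \<Omega>) (weak_gradient \<Omega> u)"
      "(LINT x|lebesgue_on \<Omega>. weak_gradient \<Omega> u x) = (LINT x|lebesgue_on \<Omega>. jacobian (u_lin lam) (at x))"
    by (rule integral_weak_gradient[OF \<Omega> q _ _ Ck_1_u_lin])+
  have linear: "integrable (lebesgue_on \<Omega>) (\<lambda>x. lam *\<^sub>R mat 1 :: mat2)"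
    using integrable_jacobian[OF \<Omega>_open Ck_1_u_lin] by (simp only: jacobian_u_lin)
  note deviation = Bochner_Integration.integrable_diff[OF G(1) linear]
  show "weak_gradient \<Omega> u \<in> borel_measurable (lebesgue_on \<Omega>)" using G(1) by simp
  show "integrable (lebesgue_on \<Omega>) (\<lambda>x. T (weak_gradient \<Omega> u x - lam *\<^sub>R mat 1))"
    by (rule integrable_bounded_linear[OF T deviation])
  have "(LINT x|lebesgue_on \<Omega>. weak_gradient \<Omega> u x - lam *\<^sub>R mat 1) = 0"
    unfolding Bochner_Integration.integral_diff[OF G(1) linear] G(2) jacobian_u_lin by simp
  then show "(LINT x|lebesgue_on \<Omega>. T (weak_gradient \<Omega> u x - lam *\<^sub>R mat 1)) = 0"
    using integral_bounded_linear[OF T deviation] linear_0[OF bounded_linear.linear[OF T]] by simp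
qed

lemma excess_lower_bound:
  fixes F T :: "mat2 \<Rightarrow> real"
  assumes \<Omega>: "bounded_lipschitz_domain \<Omega>" and q: "1 \<le> q" and h: "admissible_h h" and lam: "0 < lam"
    and u: "u \<in> admissible \<Omega> q lam" and T: "bounded_linear T" and F: "\<And>A. 0 \<le> F A" and c: "0 < c"
    and le: "\<And>A. 0 < det A \<Longrightarrow> norm (lam *\<^sub>R mat 1 :: mat2) powr q + (enn2real \<circ> h) (lam\<^sup>2)
        + T (A - lam *\<^sub>R mat 1) + c * F A \<le> norm A powr q + (enn2real \<circ> h) (det A)"
  shows "ereal c * enn2ereal (\<integral>\<^sup>+ x\<in>\<Omega>. ennreal (F (weak_gradient \<Omega> u x)) \<partial>lebesgue) \<le> excess \<Omega> q h lam u"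
proof -
  have \<Omega>_open: "open \<Omega>" "bounded \<Omega>" using \<Omega> by (auto simp: bounded_lipschitz_domain_def)
  define M G where "M = lebesgue_on \<Omega>" and "G = weak_gradient \<Omega> u"
  define W0 where "W0 = norm (lam *\<^sub>R mat 1 :: mat2) powr q + (enn2real \<circ> h) (lam\<^sup>2)"
  define W where "W x = norm (G x) powr q + (enn2real \<circ> h) (det (G x))" for x
  define l where "l x = W0 + T (G x - lam *\<^sub>R mat 1)" for x
  interpret finite_measure M
    using emeasure_lebesgue_bounded_open_finite[OF \<Omega>_open] \<Omega>_open(1)
    by (intro finite_measureI) (simp add: M_def emeasure_restrict_space space_restrict_space)
  note deviation = integral_linear_deviation_weak_gradient[OF \<Omega> q u T, folded M_def G_def]
  have M: "space M = \<Omega>" "measure M \<Omega> = measure lebesgue \<Omega>"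
    using \<Omega>_open(1) by (auto simp: M_def space_restrict_space measure_restrict_space)
  have l: "integrable M l" "integral\<^sup>L M l = W0 * measure lebesgue \<Omega>"
    using deviation(2,3) M by (simp_all add: l_def[abs_def])
  have det: "AE x in M. 0 < det (G x)" using u unfolding admissible_def M_def G_def by blast
  have [measurable]: "G \<in> borel_measurable M" "(enn2real \<circ> h) \<in> borel_measurable borel"
      "(det :: mat2 \<Rightarrow> real) \<in> borel_measurable borel"
    using deviation(1) admissible_h_measurable[OF h] borel_measurable_det by auto
  have "ennreal c * (\<integral>\<^sup>+ x. ennreal (F (G x)) \<partial>M) + ennreal (integral\<^sup>L M l) \<le> (\<integral>\<^sup>+ x. ennreal (W x) \<partial>M)"
  proof (rule nn_integral_add_integral_le)
    show "W \<in> borel_measurable M" unfolding W_def by measurable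
    show "AE x in M. l x + c * F (G x) \<le> W x"
      using det by eventually_elim (use le in \<open>simp add: l_def W_def W0_def\<close>)
  qed (use l F c in \<open>auto simp: W_def W0_def\<close>)
  then have "ennreal c * (\<integral>\<^sup>+ x\<in>\<Omega>. ennreal (F (G x)) \<partial>lebesgue) + energy \<Omega> q h (u_lin lam)
      \<le> energy \<Omega> q h u"
    using \<Omega>_open(1) l(2) energy_u_lin[OF \<Omega>_open h lam]
      energy_eq_nn_integral[OF \<Omega>_open(1) h det[unfolded M_def G_def], of q]
    by (simp add: W_def W0_def M_def G_def nn_integral_restrict_space)
  moreover have "energy \<Omega> q h (u_lin lam) < \<infinity>" unfolding energy_u_lin[OF \<Omega>_open h lam] by simp
  ultimately show ?thesis
    using excess_ge_if_energy_ge c by (fastforce simp: G_def times_ennreal.rep_eq enn2ereal_ennreal)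
qed

lemma bounded_linear_trace: "bounded_linear (trace :: real ^ 'n ^ 'n \<Rightarrow> real)"
  unfolding trace_def[abs_def] by (intro bounded_linear_sum bounded_linear_matrix_entry)

lemma excess_ge_if_norm_powr_plus_det_ge:
  fixes F :: "mat2 \<Rightarrow> real" and h :: "real \<Rightarrow> ennreal" and q lam :: real
  defines "k \<equiv> deriv (enn2real \<circ> h) (lam\<^sup>2)"
  assumes \<Omega>: "bounded_lipschitz_domain \<Omega>" and q: "1 \<le> q" and h: "admissible_h h" and lam: "0 < lam"
    and u: "u \<in> admissible \<Omega> q lam" and F: "\<And>A. 0 \<le> F A" and c: "0 < c"
    and le: "\<And>A. 0 < det A \<Longrightarrow> sv_tangent q k lam (trace A) + c * F A \<le> norm A powr q + k * det A"
  shows "ereal c * enn2ereal (\<integral>\<^sup>+ x\<in>\<Omega>. ennreal (F (weak_gradient \<Omega> u x)) \<partial>lebesgue) \<le> excess \<Omega> q h lam u"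
proof (rule excess_lower_bound[OF \<Omega> q h lam u _ F c])
  show "bounded_linear (\<lambda>A :: mat2. sv_slope q k lam * trace A)"
    by (intro bounded_linear_const_mult bounded_linear_trace)
  fix A :: mat2 assume det: "0 < det A"
  have "trace (A - lam *\<^sub>R mat 1) = trace A - 2 * lam" by (simp add: trace_mat2 mat_def)
  then have "sv_tangent q k lam (trace A)
      = norm (lam *\<^sub>R mat 1 :: mat2) powr q + k * lam\<^sup>2 + sv_slope q k lam * trace (A - lam *\<^sub>R mat 1)"
    by (simp only: sv_tangent_def norm_scaled_id_powr)
  moreover have "(enn2real \<circ> h) (lam\<^sup>2) + k * (det A - lam\<^sup>2) \<le> (enn2real \<circ> h) (det A)"
    unfolding k_def using lam det by (intro admissible_h_tangent[OF h]) auto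
  ultimately show "norm (lam *\<^sub>R mat 1 :: mat2) powr q + (enn2real \<circ> h) (lam\<^sup>2)
      + sv_slope q k lam * trace (A - lam *\<^sub>R mat 1) + c * F A \<le> norm A powr q + (enn2real \<circ> h) (det A)"
    using le[OF det] unfolding right_diff_distrib by linarith
qed

lemma ereal_le_divide_multI:
  assumes "0 < c" "ereal c * x \<le> y"
  shows "x \<le> ereal (1 / c) * y"
proof -
  have "ereal (1 / c) * (ereal c * x) \<le> ereal (1 / c) * y"
    using assms by (intro ereal_mult_left_mono) auto
  moreover have "ereal (1 / c) * (ereal c * x) = x"
    using assms(1) by (simp add: one_ereal_def[symmetric] flip: mult.assoc)
  ultimately show ?thesis by simp
qed

theorem theorem2p11:
  fixes \<Omega> :: "(real ^ 2) set" and q lam :: real and h :: "real \<Rightarrow> ennreal"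
  assumes "bounded_lipschitz_domain \<Omega>"
    and "1 < q" and "q < 2"
    and "admissible_h h"
    and "lam > 0"
    and "deriv (enn2real \<circ> h) (lam\<^sup>2) > 0"
    and "1 / (2 powr (3 - q) * deriv (enn2real \<circ> h) (lam\<^sup>2) * lam powr (2 - q))
           > (q - 1) powr ((q - 1) / 2) * q powr (- q / 2)"
  shows "(\<exists>c > 0. \<forall>u \<in> admissible \<Omega> q lam.
            enn2ereal (\<integral>\<^sup>+ x\<in>\<Omega>. ennreal
                (min ((norm (weak_gradient \<Omega> u x - lam *\<^sub>R mat 1))\<^sup>2)
                     (norm (weak_gradient \<Omega> u x - lam *\<^sub>R mat 1) powr q)) \<partial>lebesgue)
              \<le> ereal c * excess \<Omega> q h lam u)
       \<and> (\<forall>u \<in> admissible \<Omega> q lam.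
            ereal (lam * deriv (enn2real \<circ> h) (lam\<^sup>2)) *
              enn2ereal (\<integral>\<^sup>+ x\<in>\<Omega>. ennreal
                (2 * lam\<^sup>2 * (curl \<Omega> u x)\<^sup>2 /
                  (3 * ((curl \<Omega> u x)\<^sup>2 + max (4 * lam\<^sup>2) ((divergence \<Omega> u x)\<^sup>2)) powr (3 / 2)))
                \<partial>lebesgue)
              \<le> excess \<Omega> q h lam u)"
proof -
  define k where "k = deriv (enn2real \<circ> h) (lam\<^sup>2)"
  note k = assms(6)[folded k_def]
  have slope: "k * lam * (s - lam) \<le> 2 powr (q - 3) * s powr q" if "0 \<le> s" for s
    using det_slope_le_powr[OF assms(2) k assms(5) that assms(7)[folded k_def]] .
  obtain c where c: "0 < c" "\<And>A :: mat2. 0 < det A \<Longrightarrow>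
      sv_tangent q k lam (trace A) + c * min ((norm (A - lam *\<^sub>R mat 1))\<^sup>2) (norm (A - lam *\<^sub>R mat 1) powr q)
      \<le> norm A powr q + k * det A"
    using norm_powr_plus_det_coercive[OF assms(2,3) k assms(5) slope] by blast
  note excess_ge =
    excess_ge_if_norm_powr_plus_det_ge[OF assms(1) less_imp_le[OF assms(2)] assms(4,5), folded k_def]
  show ?thesis
  proof (intro conjI exI[of _ "1 / c"] ballI)
    fix u assume u: "u \<in> admissible \<Omega> q lam"
    show "enn2ereal (\<integral>\<^sup>+ x\<in>\<Omega>. ennreal (min ((norm (weak_gradient \<Omega> u x - lam *\<^sub>R mat 1))\<^sup>2)
        (norm (weak_gradient \<Omega> u x - lam *\<^sub>R mat 1) powr q)) \<partial>lebesgue) \<le> ereal (1 / c) * excess \<Omega> q h lam u"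
      using excess_ge[OF u _ c] c(1) by (intro ereal_le_divide_multI) auto
  next
    fix u assume u: "u \<in> admissible \<Omega> q lam"
    show "ereal (lam * deriv (enn2real \<circ> h) (lam\<^sup>2)) * enn2ereal (\<integral>\<^sup>+ x\<in>\<Omega>. ennreal
        (2 * lam\<^sup>2 * (curl \<Omega> u x)\<^sup>2 /
          (3 * ((curl \<Omega> u x)\<^sup>2 + max (4 * lam\<^sup>2) ((divergence \<Omega> u x)\<^sup>2)) powr (3 / 2))) \<partial>lebesgue)
      \<le> excess \<Omega> q h lam u"
      unfolding curl_def divergence_def k_def[symmetric]
      using k assms(5) norm_powr_plus_det_ge_curl[OF assms(2,3) k assms(5) slope]
      by (intro excess_ge[OF u]) auto
  qed (use c in simp)
qed

end
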